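(* Assume that the minimization problems $$u_k\in\arg\min_{u}\{H(u)+J(u)-\langle p_{k-1},u\rangle\}$$ in the original (classical) Bregman iteration have unique solutions. Moreover, assume that in the lifted Bregman iteration the solutions $\boldsymbol u_k$ of $$\boldsymbol u_k\in\arg\min_{\boldsymbol u\in\boldsymbol U}\{\boldsymbol H(\boldsymbol u)+\boldsymbol J(\boldsymbol u)-\langle\boldsymbol p_{k-1},\boldsymbol u\rangle\}$$ in each step satisfy $\boldsymbol u_k(x)\in\boldsymbol\Gamma$ for every $x$, i.e. are sublabel-integral. If at every point $x$ the chosen subgradients $p_{k-1}\in\partial J(u_{k-1})$ and $\boldsymbol p_{k-1}\in\partial\boldsymbol J(\boldsymbol u_{k-1})$ satisfy $$\boldsymbol p_{k-1}(x)=p_{k-1}(x)\,\tilde{\boldsymbol\gamma},\qquad \tilde{\boldsymbol\gamma}:=(\gamma_2-\gamma_1,\ldots,\gamma_L-\gamma_l)^\top\in\mathbb{R}^l,$$ then the lifted iterates $\boldsymbol u_k$ correspond to the iterates $u_k$ of the classical Bregman iteration, via $$u_k(x)=\gamma_1+\sum_{i=1}^l\boldsymbol u_k^i(x)\,(\gamma_{i+1}-\gamma_i).$$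
   Context: Notation: $\overline{\mathbb{R}}:=\mathbb{R}\cup\{\pm\infty\}$. For $f:\mathbb{R}^n\to\overline{\mathbb{R}}$, $f^*(u^* ):=\sup_{u}\{\langle u^*,u\rangle-f(u)\}$ and $f^{**}:=(f^* )^*$. $\delta_C(x):=0$ if $x\in C$, $+\infty$ otherwise; $\delta_c:=\delta_{\{c\}}$ for a point $c$. Subscripts $k$ denote iteration index, superscripts $i$ denote vector components. Problem: minimize $H(u)+J(u)$ over a suitable (discrete or function) space $U$ of functions $u:\Omega\to\Gamma$, where $H(u)=\int_\Omega\rho(x,u(x))\,dx$ and $J(u)=\int_\Omega\eta(\nabla u(x))\,dx$; $\Omega\subset\mathbb{R}^d$ is open and bounded, $\Gamma\subset\mathbb{R}$ compact, $\rho:\Omega\times\Gamma\to\overline{\mathbb{R}}$ proper and non-negative, $\eta$ non-negative and convex. The considerations are formal and pointwise in $x$; they may equally be read in the spatially discrete setting, with $\Omega$ a finite grid (integrals being sums over the grid points). Classical Bregman iteration (defined for $H$ and $J$ both non-negative and convex): set $p_0=0$ and for $k=1,2,\dots$ take $u_k\in\arg\min_u\{H(u)+J(u)-\langle p_{k-1},u\rangle\}$, $p_k\in\partial J(u_k)$. Lifting: choose labels $\gamma_1<\dots<\gamma_L$ with $\Gamma=[\gamma_1,\gamma_L]$, $l:=L-1$. For $i\in\{1,\dots,l\}$, $\alpha\in[0,1]$ let $\gamma_i^\alpha:=\gamma_i+\alpha(\gamma_{i+1}-\gamma_i)$ and $\boldsymbol 1_i^\alpha:=\alpha\boldsymbol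 1_i+(1-\alpha)\boldsymbol 1_{i-1}\in\mathbb{R}^l$, where $\boldsymbol 1_i\in\mathbb{R}^l$ is $i$ ones followed by $l-i$ zeros. The lifted label space is $\boldsymbol\Gamma:=\{\boldsymbol 1_i^\alpha: i\in\{1,\dots,l\},\alpha\in[0,1]\}\subset\mathbb{R}^l$. A function $\boldsymbol u:\Omega\to\mathbb{R}^l$ with $\boldsymbol u(x)\in\boldsymbol\Gamma$ for all $x$ is called sublabel-integral; it is identified with the scalar function $u(x)=\gamma_1+\sum_{i=1}^l\boldsymbol u^i(x)(\gamma_{i+1}-\gamma_i)$. Lifted data term: for each $x$, $\boldsymbol\rho(x,\boldsymbol u):=\inf_{i,\alpha}\{\rho(x,\gamma_i^\alpha)+\delta_{\boldsymbol 1_i^\alpha}(\boldsymbol u)\}$ for $\boldsymbol u\in\mathbb{R}^l$, and $\boldsymbol H(\boldsymbol u):=\int_\Omega\boldsymbol\rho^{**}(x,\boldsymbol u(x))\,dx$, the biconjugate being taken in $\boldsymbol u$ for fixed $x$. Lifted regularizer (for $J$ the total variation): $\boldsymbol J(\boldsymbol u):=\int_\Omega\boldsymbol\phi^{**}(D\boldsymbol u)$, where $D\boldsymbol u$ is the distributional derivative (or its discretization), $\boldsymbol\phi^{**}(\boldsymbol g)=\sup_{\boldsymbol q\in\mathcal K}\langle\boldsymbol q,\boldsymbol g\rangle$ for $\boldsymbol g\in\mathbb{R}^{l\times d}$, and, with $\boldsymbol q_i$ the $i$-th row of $\boldsymbol q$, $\mathcal K=\{\boldsymbol q\in\mathbb{R}^{l\times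 d}:\|\boldsymbol q_i\|_2\le\gamma_{i+1}-\gamma_i\ \forall i=1,\dots,l\}$ for isotropic TV, or the same set with $\|\cdot\|_\infty$ in place of $\|\cdot\|_2$ for anisotropic ($L^1$) TV. Lifted Bregman iteration: over the larger space $\boldsymbol U$ of functions with values in $\mathbb{R}^l$ (the non-convex constraint set $\boldsymbol\Gamma$ being relaxed to its convex hull), set $\boldsymbol p_0=0$ and for $k=1,2,\dots$ take $\boldsymbol u_k\in\arg\min_{\boldsymbol u\in\boldsymbol U}\{\boldsymbol H(\boldsymbol u)+\boldsymbol J(\boldsymbol u)-\langle\boldsymbol p_{k-1},\boldsymbol u\rangle\}$, $\boldsymbol p_k\in\partial\boldsymbol J(\boldsymbol u_k)$. *)

theory Defs
  imports "HOL-Analysis.Analysis"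
begin

definition fenchel_conj :: "('v::real_inner \<Rightarrow> ereal) \<Rightarrow> 'v \<Rightarrow> ereal" where
  "fenchel_conj f y = (SUP u. ereal (y \<bullet> u) - f u)"

definition biconj :: "('v::real_inner \<Rightarrow> ereal) \<Rightarrow> 'v \<Rightarrow> ereal" where
  "biconj f = fenchel_conj (fenchel_conj f)"

definition char_fun :: "'v set \<Rightarrow> 'v \<Rightarrow> ereal" where
  "char_fun C x = (if x \<in> C then 0 else \<infinity>)"

definition convex_ereal_on :: "'v::real_vector set \<Rightarrow> ('v \<Rightarrow> ereal) \<Rightarrow> bool" where
  "convex_ereal_on S f \<longleftrightarrow> convex S \<and>
     (\<forall>x\<in>S. \<forall>y\<in>S. \<forall>a\<ge>0. \<forall>b\<ge>0. a + b = 1 \<longrightarrow>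
        f (a *\<^sub>R x + b *\<^sub>R y) \<le> ereal a * f x + ereal b * f y)"

text \<open>
  Functions on a domain \<open>\<Omega>\<close> are represented by total functions; only their values almost
  everywhere on \<open>\<Omega>\<close> matter.
\<close>

definition L2_on :: "'x::euclidean_space set \<Rightarrow> ('x \<Rightarrow> 'v::euclidean_space) set" where
  "L2_on \<Omega> = {u. u \<in> borel_measurable (lebesgue_on \<Omega>) \<and>
                   integrable (lebesgue_on \<Omega>) (\<lambda>x. (norm (u x))\<^sup>2)}"

definition pairing ::
    "'x::euclidean_space set \<Rightarrow> ('x \<Rightarrow> 'v::euclidean_space) \<Rightarrow> ('x \<Rightarrow> 'v) \<Rightarrow> real" where
  "pairing \<Omega> p u = (LINT x|lebesgue_on \<Omega>. p x \<bullet> u x)"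

definition L2_valued :: "'x::euclidean_space set \<Rightarrow> 'v::euclidean_space set \<Rightarrow> ('x \<Rightarrow> 'v) set" where
  "L2_valued \<Omega> C = {u \<in> L2_on \<Omega>. AE x in lebesgue_on \<Omega>. u x \<in> C}"

text \<open>
  Meant for non-negative \<open>f\<close> only, since \<open>e2ennreal\<close> truncates negative values to 0.
  It is applied to \<open>\<rho> \<ge> 0\<close> and to the lifted biconjugate, which is non-negative
  because the constant 0 is an affine minorant.
\<close>

definition nonneg_integral :: "'x::euclidean_space set \<Rightarrow> ('x \<Rightarrow> ereal) \<Rightarrow> ereal" where
  "nonneg_integral \<Omega> f = enn2ereal (\<integral>\<^sup>+x. e2ennreal (f x) \<partial>lebesgue_on \<Omega>)"

definition C1_compact :: "'x::euclidean_space set \<Rightarrow> ('x \<Rightarrow> 'v::real_normed_vector) set" where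
  "C1_compact \<Omega> = {q. compact (closure {x. q x \<noteq> 0}) \<and> closure {x. q x \<noteq> 0} \<subseteq> \<Omega> \<and>
     (\<exists>q'. (\<forall>x. (q has_derivative blinfun_apply (q' x)) (at x)) \<and> continuous_on UNIV q')}"

definition divergence :: "(real^'d \<Rightarrow> real^'d) \<Rightarrow> real^'d \<Rightarrow> real" where
  "divergence \<xi> x = (\<Sum>j\<in>UNIV. frechet_derivative \<xi> (at x) (axis j 1) $ j)"

definition row_divergence :: "(real^'d \<Rightarrow> real^'d^'l) \<Rightarrow> real^'d \<Rightarrow> real^'l" where
  "row_divergence q x = (\<chi> i. divergence (\<lambda>y. q y $ i) x)"

text \<open>
  The subgradient inequality is required on the whole linear space \<open>L\<^sup>2\<close>, not only
  on functions with constrained values.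
\<close>

definition subdiff ::
    "'x::euclidean_space set \<Rightarrow> (('x \<Rightarrow> 'v::euclidean_space) \<Rightarrow> ereal) \<Rightarrow> ('x \<Rightarrow> 'v) \<Rightarrow> ('x \<Rightarrow> 'v) set" where
  "subdiff \<Omega> J u = {p \<in> L2_on \<Omega>. \<forall>v\<in>L2_on \<Omega>. J u + ereal (pairing \<Omega> p (\<lambda>x. v x - u x)) \<le> J v}"

definition bregman_energy ::
    "'x::euclidean_space set \<Rightarrow> (('x \<Rightarrow> 'v::euclidean_space) \<Rightarrow> ereal) \<Rightarrow> (('x \<Rightarrow> 'v) \<Rightarrow> ereal) \<Rightarrow>
     ('x \<Rightarrow> 'v) \<Rightarrow> ('x \<Rightarrow> 'v) \<Rightarrow> ereal" where
  "bregman_energy \<Omega> H J p u = H u + J u - ereal (pairing \<Omega> p u)"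

definition bregman_iteration ::
    "'x::euclidean_space set \<Rightarrow> ('x \<Rightarrow> 'v::euclidean_space) set \<Rightarrow>
     (('x \<Rightarrow> 'v) \<Rightarrow> ereal) \<Rightarrow> (('x \<Rightarrow> 'v) \<Rightarrow> ereal) \<Rightarrow>
     (nat \<Rightarrow> 'x \<Rightarrow> 'v) \<Rightarrow> (nat \<Rightarrow> 'x \<Rightarrow> 'v) \<Rightarrow> bool" where
  "bregman_iteration \<Omega> U H J u p \<longleftrightarrow>
     p 0 = (\<lambda>x. 0) \<and>
     (\<forall>k\<ge>1. is_arg_min (bregman_energy \<Omega> H J (p (k - 1))) (\<lambda>v. v \<in> U) (u k) \<and>
             p k \<in> subdiff \<Omega> J (u k))"

definition data_term :: "'x::euclidean_space set \<Rightarrow> ('x \<Rightarrow> real \<Rightarrow> ereal) \<Rightarrow> ('x \<Rightarrow> real) \<Rightarrow> ereal" where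
  "data_term \<Omega> \<rho> u = nonneg_integral \<Omega> (\<lambda>x. \<rho> x (u x))"

text \<open>
  Isotropic total variation has the integrand \<open>\<eta> = \<parallel>\<cdot>\<parallel>\<^sub>2\<close>, anisotropic total variation the
  integrand \<open>\<eta> = \<parallel>\<cdot>\<parallel>\<^sub>1\<close>. The norm below is the one dual to \<open>\<eta>\<close>, so that
  \<open>\<eta> g\<close> is the supremum of \<open>q \<bullet> g\<close> over all \<open>q\<close> of dual norm at most 1.
\<close>

datatype tv_kind = Isotropic | Anisotropic

primrec dual_norm :: "tv_kind \<Rightarrow> real^'d \<Rightarrow> real" where
  "dual_norm Isotropic v = norm v"
| "dual_norm Anisotropic v = infnorm v"

text \<open>
  Since \<open>Du\<close> is a distributional derivative, the integral of a support function
  \<open>g \<mapsto> sup {\<langle>q, g\<rangle> | q \<in> K}\<close> against \<open>Du\<close> is the supremum of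
  \<open>\<langle>q, Du\<rangle> = - \<integral> u \<cdot> div q\<close> over all test fields \<open>q\<close> with values in \<open>K\<close>;
  its value is \<open>\<infinity>\<close> if \<open>Du\<close> is not a finite measure.
\<close>

definition total_variation :: "tv_kind \<Rightarrow> (real^'d) set \<Rightarrow> (real^'d \<Rightarrow> real) \<Rightarrow> ereal" where
  "total_variation N \<Omega> u =
     (SUP \<xi>\<in>{\<xi> \<in> C1_compact \<Omega>. \<forall>x. dual_norm N (\<xi> x) \<le> 1}.
        ereal (- (LINT x|lebesgue_on \<Omega>. u x * divergence \<xi> x)))"

text \<open>
  The index type \<open>'l\<close> is linearly ordered and has \<open>l\<close> elements; \<open>pos j\<close> is the
  position in \<open>{1..l}\<close> of the index \<open>j\<close>. The labels are \<open>\<gamma> 1, \<dots>, \<gamma> (l + 1)\<close>.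
\<close>

definition pos :: "'l::{finite,linorder} \<Rightarrow> nat" where
  "pos j = card {i. i \<le> j}"

definition ones :: "nat \<Rightarrow> real^'l::{finite,linorder}" where
  "ones i = (\<chi> j. if pos j \<le> i then 1 else 0)"

definition sublabel :: "(nat \<Rightarrow> real) \<Rightarrow> nat \<Rightarrow> real \<Rightarrow> real" where
  "sublabel \<gamma> i \<alpha> = \<gamma> i + \<alpha> * (\<gamma> (i + 1) - \<gamma> i)"

definition lifted_sublabel :: "nat \<Rightarrow> real \<Rightarrow> real^'l::{finite,linorder}" where
  "lifted_sublabel i \<alpha> = \<alpha> *\<^sub>R ones i + (1 - \<alpha>) *\<^sub>R ones (i - 1)"

definition lifted_labels :: "(real^'l::{finite,linorder}) set" where
  "lifted_labels = {lifted_sublabel i \<alpha> | i \<alpha>. i \<in> {1..CARD('l)} \<and> \<alpha> \<in> {0..1}}"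

definition label_gaps :: "(nat \<Rightarrow> real) \<Rightarrow> real^'l::{finite,linorder}" where
  "label_gaps \<gamma> = (\<chi> j. \<gamma> (pos j + 1) - \<gamma> (pos j))"

definition unlift :: "(nat \<Rightarrow> real) \<Rightarrow> real^'l::{finite,linorder} \<Rightarrow> real" where
  "unlift \<gamma> v = \<gamma> 1 + (\<Sum>j\<in>UNIV. v $ j * (\<gamma> (pos j + 1) - \<gamma> (pos j)))"

definition lifted_rho ::
    "(nat \<Rightarrow> real) \<Rightarrow> ('x \<Rightarrow> real \<Rightarrow> ereal) \<Rightarrow> 'x \<Rightarrow> real^'l::{finite,linorder} \<Rightarrow> ereal" where
  "lifted_rho \<gamma> \<rho> x v =
     (INF (i, \<alpha>)\<in>{1..CARD('l)} \<times> {0..1}.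
        \<rho> x (sublabel \<gamma> i \<alpha>) + char_fun {lifted_sublabel i \<alpha>} v)"

definition lifted_data_term ::
    "'x::euclidean_space set \<Rightarrow> (nat \<Rightarrow> real) \<Rightarrow> ('x \<Rightarrow> real \<Rightarrow> ereal) \<Rightarrow>
     ('x \<Rightarrow> real^'l::{finite,linorder}) \<Rightarrow> ereal" where
  "lifted_data_term \<Omega> \<gamma> \<rho> u = nonneg_integral \<Omega> (\<lambda>x. biconj (lifted_rho \<gamma> \<rho> x) (u x))"

definition lifted_dual_set :: "tv_kind \<Rightarrow> (nat \<Rightarrow> real) \<Rightarrow> (real^'d^'l::{finite,linorder}) set" where
  "lifted_dual_set N \<gamma> = {q. \<forall>i. dual_norm N (q $ i) \<le> \<gamma> (pos i + 1) - \<gamma> (pos i)}"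

definition lifted_total_variation ::
    "tv_kind \<Rightarrow> (real^'d) set \<Rightarrow> (nat \<Rightarrow> real) \<Rightarrow> (real^'d \<Rightarrow> real^'l::{finite,linorder}) \<Rightarrow> ereal" where
  "lifted_total_variation N \<Omega> \<gamma> u =
     (SUP q\<in>{q \<in> C1_compact \<Omega>. \<forall>x. q x \<in> lifted_dual_set N \<gamma>}.
        ereal (- (LINT x|lebesgue_on \<Omega>. u x \<bullet> row_divergence q x)))"

end

theory Submission
  imports Defs
begin

text \<open>
  Fix a step \<open>k\<close>; let \<open>P\<close> be the classical subgradient, \<open>u\<close> the classical minimiser, \<open>U\<close> the
  lifted one and \<open>v = unlift \<circ> U\<close>. Since \<open>U\<close> is sublabel-integral, \<open>U = lift \<circ> v\<close>. The two
  iterations are compared term by term along the maps \<open>lift\<close> and \<open>unlift\<close>. Below, \<open>TV\<close> and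
  \<open>TV\<^sub>l\<close> are the classical and the lifted total variation and \<open>R\<close> is the biconjugate of the
  lifted integrand at a fixed point of the domain.

  The linear terms agree up to a common constant, because the lifted subgradient is \<open>P\<close> times
  the vector of label gaps and the inner product with that vector is \<open>unlift\<close> up to \<open>\<gamma> 1\<close>.

  The total variations satisfy \<open>TV (unlift \<circ> V) \<le> TV\<^sub>l V\<close> whenever \<open>unlift \<circ> V\<close> is integrable: a
  scalar test field multiplied by the gaps is a lifted test field. Conversely
  \<open>TV\<^sub>l (lift \<circ> f) \<le> TV f\<close> for \<open>f\<close> with values in \<open>\<Gamma>\<close>. This is the coarea principle: \<open>lift\<close> cuts
  \<open>f\<close> into the slices between consecutive labels, and the slices vary on disjoint sets. It is
  proved by gluing the rows \<open>q j\<close> of a lifted test field into one scalar test field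
  \<open>\<Sum>j. f j (\<phi> x) / c j * q j x\<close>, where \<open>\<phi>\<close> is a mollification of the function and the weights
  \<open>f j \<ge> 0\<close> of sum at most 1 single out the slice of the value \<open>\<phi> x\<close>. The weights are
  derivatives of smoothed truncations, so that partial integration turns the glued field back
  into the divergences of the rows.

  The data terms satisfy \<open>R (lift t) \<le> \<rho> t\<close>, but equality can fail: a convex function on an
  interval may jump at the ends of its effective domain, and the biconjugate only sees the lower
  semicontinuous envelope. So \<open>v\<close> is not compared with \<open>u\<close> directly; its midpoint
  \<open>w = (u + v) / 2\<close> with \<open>u\<close> is. Wherever \<open>u \<noteq> v\<close>, the point \<open>w\<close> lies strictly between the two
  values, and one-dimensional convexity gives \<open>2 * \<rho> w \<le> \<rho> u + R (lift v)\<close>. Hence in all cases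
  \<open>2 * \<rho> w + R (lift u) \<le> 2 * \<rho> u + R (lift v)\<close>. Adding the optimality of \<open>U\<close> against the
  competitor \<open>lift \<circ> u\<close> shows that the energy of \<open>w\<close> is at most that of \<open>u\<close>. By uniqueness
  \<open>w = u\<close> almost everywhere, that is, \<open>v = u\<close>.

  The carrying lemmas are \<open>lifted_total_variation_lift_le\<close>, \<open>total_variation_unlift_le\<close> and
  \<open>data_terms_midpoint\<close>.
\<close>

section \<open>Functions with bounded support\<close>

lemma uniformly_continuous_compact_support:
  fixes f :: "'a::euclidean_space \<Rightarrow> 'b::real_normed_vector"
  assumes cont: "continuous_on UNIV f" and supp: "\<And>x. r < norm x \<Longrightarrow> f x = 0"
  shows "uniformly_continuous_on UNIV f"
proof -
  have "uniformly_continuous_on (cball 0 (r + 1)) f"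
    by (rule compact_uniformly_continuous) (auto intro: continuous_on_subset[OF cont])
  show ?thesis
    unfolding uniformly_continuous_on_def
  proof (intro allI impI)
    fix e :: real assume "e > 0"
    with \<open>uniformly_continuous_on (cball 0 (r + 1)) f\<close> obtain d where d: "d > 0"
      "\<And>x y. x \<in> cball 0 (r+1) \<Longrightarrow> y \<in> cball 0 (r+1) \<Longrightarrow> dist y x < d \<Longrightarrow> dist (f y) (f x) < e"
      unfolding uniformly_continuous_on_def by metis
    show "\<exists>d>0. \<forall>x\<in>UNIV. \<forall>y\<in>UNIV. dist y x < d \<longrightarrow> dist (f y) (f x) < e"
    proof (intro exI conjI ballI impI)
      show "min d 1 > 0" using d by auto
      fix x y :: 'a assume *: "dist y x < min d 1"
      show "dist (f y) (f x) < e"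
      proof (cases "x \<in> cball 0 (r+1) \<and> y \<in> cball 0 (r+1)")
        case True then show ?thesis using d * by auto
      next
        case False
        have "\<bar>norm y - norm x\<bar> \<le> dist y x" by (simp add: dist_norm norm_triangle_ineq3)
        with False * have "norm x > r" "norm y > r" by (auto simp: not_le)
        then show ?thesis using supp \<open>e > 0\<close> by auto
      qed
    qed
  qed
qed

lemma bounded_compact_support:
  fixes f :: "'a::euclidean_space \<Rightarrow> 'b::real_normed_vector"
  assumes cont: "continuous_on UNIV f" and supp: "\<And>x. r < norm x \<Longrightarrow> f x = 0"
  obtains B where "B \<ge> 0" "\<And>x. norm (f x) \<le> B"
proof -
  have "compact (f ` cball 0 r)"
    by (rule compact_continuous_image) (auto intro: continuous_on_subset[OF cont])
  then obtain B where B: "B > 0" "\<And>x. x \<in> cball 0 r \<Longrightarrow> norm (f x) \<le> B"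
    using compact_imp_bounded bounded_pos by (metis image_eqI)
  show thesis
  proof (rule that[of B])
    fix x show "norm (f x) \<le> B"
      using B supp[of x] by (cases "norm x \<le> r") auto
  qed (use B in auto)
qed

lemma integrable_bounded_support:
  fixes f :: "'a::euclidean_space \<Rightarrow> 'b::{banach,second_countable_topology}"
  assumes "f \<in> borel_measurable borel" "\<And>x. r < norm x \<Longrightarrow> f x = 0" "\<And>x. norm (f x) \<le> B"
  shows "integrable lborel f"
proof (rule integrableI_bounded_set[where A="cball 0 r" and B=B])
  show "emeasure lborel (cball 0 r :: 'a set) < \<infinity>"
    by (intro emeasure_bounded_finite) auto
qed (use assms in auto)

lemma integrable_compact_support:
  fixes f :: "'a::euclidean_space \<Rightarrow> 'b::{banach,second_countable_topology}"
  assumes "continuous_on UNIV f" "\<And>x. r < norm x \<Longrightarrow> f x = 0"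
  shows "integrable lborel f"
proof -
  obtain B where "B \<ge> 0" "\<And>x. norm (f x) \<le> B" using bounded_compact_support[OF assms] by metis
  then show ?thesis
    using assms by (intro integrable_bounded_support[where r=r and B=B]) 
      (auto intro: borel_measurable_continuous_onI)
qed

lemma integral_shift:
  fixes f :: "'a::euclidean_space \<Rightarrow> 'b::{banach,second_countable_topology}"
  assumes "f \<in> borel_measurable borel"
  shows "(LINT x|lborel. f (x + a)) = (LINT x|lborel. f x)"
proof -
  have "(LINT x|lborel. f x) = (LINT x|distr lborel borel ((+) a). f x)"
    by (simp add: lborel_distr_plus)
  also have "\<dots> = (LINT x|lborel. f (a + x))"
    using assms by (subst integral_distr) auto
  finally show ?thesis by (simp add: add.commute)
qed

lemma integrable_shift:
  fixes f :: "'a::euclidean_space \<Rightarrow> 'b::{banach,second_countable_topology}"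
  assumes "integrable lborel f"
  shows "integrable lborel (\<lambda>x. f (x + a))"
proof -
  have "integrable (distr lborel borel ((+) a)) f"
    using assms by (simp add: lborel_distr_plus)
  then have "integrable lborel (\<lambda>x. f (a + x))"
    using assms by (subst (asm) integrable_distr_eq) auto
  then show ?thesis by (simp add: add.commute)
qed

lemma integral_reflect:
  fixes f :: "'a::euclidean_space \<Rightarrow> 'b::{banach,second_countable_topology}"
  assumes "f \<in> borel_measurable borel"
  shows "(LINT y|lborel. f (x - y)) = (LINT y|lborel. f y)"
proof -
  have "lborel = distr lborel borel (\<lambda>y::'a. x + (-1) *\<^sub>R y)"
    using lborel_affine[of "-1" x] by (simp add: density_1)
  then have "(LINT y|lborel. f y) = (LINT y|distr lborel borel (\<lambda>y. x + (-1) *\<^sub>R y). f y)"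
    by simp
  also have "\<dots> = (LINT y|lborel. f (x - y))"
    using assms by (subst integral_distr) auto
  finally show ?thesis by simp
qed

text \<open>
  The difference quotients \<open>(g (x + t *\<^sub>R e) - g x) / t\<close> have integral 0 by translation
  invariance; they converge to the directional derivative, dominated by its maximum on a ball.
\<close>

lemma integral_derivative_zero:
  fixes g :: "'a::euclidean_space \<Rightarrow> real"
  assumes der: "\<And>x. (g has_derivative D x) (at x)"
    and cont: "continuous_on UNIV (\<lambda>x. D x e)"
    and supp: "\<And>x. r < norm x \<Longrightarrow> g x = 0"
    and suppD: "\<And>x. r < norm x \<Longrightarrow> D x e = 0"
  shows "(LINT x|lborel. D x e) = 0"
proof -
  have contg: "continuous_on UNIV g"
    using der by (meson continuous_at_imp_continuous_on has_derivative_continuous)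
  obtain B where B: "B \<ge> 0" "\<And>x. norm (D x e) \<le> B"
    using bounded_compact_support[OF cont suppD] by metis
  have [measurable]: "g \<in> borel_measurable borel"
    using contg by (rule borel_measurable_continuous_onI)
  have [measurable]: "(\<lambda>x. D x e) \<in> borel_measurable borel"
    using cont by (rule borel_measurable_continuous_onI)
  define t where "t n = inverse (real (Suc n))" for n
  have t: "t n > 0" "t n \<le> 1" for n
    by (simp_all add: t_def field_simps)
  have tlim: "t \<longlonglongrightarrow> 0"
    using LIMSEQ_inverse_real_of_nat by (simp add: t_def[abs_def])
  define q where "q n x = (g (x + t n *\<^sub>R e) - g x) / t n" for n x
  have qz: "(LINT x|lborel. q n x) = 0" for n
  proof -
    have i: "integrable lborel g" by (rule integrable_compact_support[OF contg supp])
    show ?thesis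
      unfolding q_def
      using integrable_shift[OF i] i by (simp add: integral_shift)
  qed
  have line: "((\<lambda>s. g (x + s *\<^sub>R e)) has_derivative (\<lambda>h. D (x + s *\<^sub>R e) (h *\<^sub>R e))) (at s)"
    for x s
  proof -
    have "((\<lambda>s. x + s *\<^sub>R e) has_derivative (\<lambda>h. h *\<^sub>R e)) (at s)"
      by (auto intro!: derivative_eq_intros)
    from has_derivative_compose[OF this der] show ?thesis .
  qed
  have qb: "norm (q n x) \<le> B" for n x
  proof -
    have "\<exists>s\<in>{0..t n}. (\<lambda>s. g (x + s *\<^sub>R e)) (t n) - (\<lambda>s. g (x + s *\<^sub>R e)) 0
        = (\<lambda>h. D (x + s *\<^sub>R e) (h *\<^sub>R e)) (t n - 0)"
      by (rule mvt_very_simple)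
        (use t(1)[of n] line in \<open>auto intro: has_derivative_at_withinI\<close>)
    then obtain s where s: "g (x + t n *\<^sub>R e) - g x = D (x + s *\<^sub>R e) (t n *\<^sub>R e)" by auto
    also have "\<dots> = t n * D (x + s *\<^sub>R e) e"
      using linear_cmul[OF has_derivative_linear[OF der]] by auto
    finally show ?thesis using B(2)[of "x + s *\<^sub>R e"] t[of n] by (simp add: q_def)
  qed
  have qs: "q n x = 0" if "r + norm e < norm x" for n x
  proof -
    have "norm (t n *\<^sub>R e) \<le> norm e" using t[of n] by (simp add: mult_left_le_one_le)
    moreover have "norm x \<le> norm (x + t n *\<^sub>R e) + norm (t n *\<^sub>R e)"
      using norm_triangle_ineq4[of "x + t n *\<^sub>R e" "t n *\<^sub>R e"] by simp
    moreover have "norm e \<ge> 0" by simp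
    ultimately have "r < norm (x + t n *\<^sub>R e)" "r < norm x" using that by linarith+
    then show ?thesis by (simp add: q_def supp)
  qed
  have "(\<lambda>n. LINT x|lborel. q n x) \<longlonglongrightarrow> (LINT x|lborel. D x e)"
  proof (rule integral_dominated_convergence[where w="\<lambda>x. indicator (cball 0 (r + norm e)) x * B"])
    have "emeasure lborel (cball 0 (r + norm e) :: 'a set) < \<infinity>"
      by (intro emeasure_bounded_finite) auto
    then show "integrable lborel (\<lambda>x::'a. indicator (cball 0 (r + norm e)) x * B)"
      by simp
    show "AE x in lborel. (\<lambda>n. q n x) \<longlonglongrightarrow> D x e"
    proof (intro AE_I2)
      fix x
      have "((\<lambda>s. g (x + s *\<^sub>R e)) has_derivative (\<lambda>h. D x (h *\<^sub>R e))) (at 0)"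
        using line[of x 0] by simp
      then have "((\<lambda>s. g (x + s *\<^sub>R e)) has_field_derivative D x e) (at 0)"
        unfolding has_field_derivative_def
        by (rule has_derivative_eq_rhs) (auto simp: linear_cmul[OF has_derivative_linear[OF der]])
      then have "(\<lambda>s. (g (x + s *\<^sub>R e) - g x) / s) \<midarrow>0\<rightarrow> D x e"
        by (simp add: DERIV_def)
      moreover have "filterlim t (at 0) sequentially"
        unfolding filterlim_at
      proof
        have "t n \<noteq> 0" for n using t(1)[of n] by linarith
        then show "\<forall>\<^sub>F n in sequentially. t n \<in> UNIV \<and> t n \<noteq> 0" by simp
      qed (rule tlim)
      ultimately show "(\<lambda>n. q n x) \<longlonglongrightarrow> D x e"
        unfolding q_def by (rule filterlim_compose)
    qed
    fix n
    show "AE x in lborel. norm (q n x) \<le> indicator (cball 0 (r + norm e)) x * B"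
      using qb qs by (intro AE_I2) (auto simp: indicator_def not_le)
    show "q n \<in> borel_measurable lborel" unfolding q_def by measurable
  qed measurable
  then show ?thesis using qz by (simp add: LIMSEQ_const_iff)
qed

section \<open>Mollification\<close>

lemma integrable_bounded_scaleR:
  fixes w :: "'a::euclidean_space \<Rightarrow> 'b::{banach,second_countable_topology}"
  assumes [measurable]: "f \<in> borel_measurable borel" and "\<And>y. \<bar>f y\<bar> \<le> B" "integrable lborel w"
  shows "integrable lborel (\<lambda>y. f y *\<^sub>R w y)"
proof (rule Bochner_Integration.integrable_bound[where f="\<lambda>y. B *\<^sub>R norm (w y)"])
  show "integrable lborel (\<lambda>y. B *\<^sub>R norm (w y))" using assms by auto
  have [measurable]: "w \<in> borel_measurable borel" using assms(3) by auto
  show "(\<lambda>y. f y *\<^sub>R w y) \<in> borel_measurable lborel" by measurable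
  have "\<bar>f y\<bar> * norm (w y) \<le> B * norm (w y)" for y by (intro mult_right_mono assms) auto
  moreover have "B \<ge> 0" using assms(2) by (meson abs_ge_zero order_trans)
  ultimately show "AE y in lborel. norm (f y *\<^sub>R w y) \<le> norm (B *\<^sub>R norm (w y))"
    by (intro AE_I2) auto
qed

text \<open>
  Every estimate on a convolution with a kernel below is an instance of this bound, with \<open>f\<close> a
  shifted kernel, a shifted derivative of it, or a difference of such.
\<close>

lemma norm_integral_bounded_scaleR:
  fixes w :: "'a::euclidean_space \<Rightarrow> 'b::{banach,second_countable_topology}"
  assumes [measurable]: "f \<in> borel_measurable borel" and "\<And>y. \<bar>f y\<bar> \<le> B" "integrable lborel w"
  shows "norm (LINT y|lborel. f y *\<^sub>R w y) \<le> B * (LINT y|lborel. norm (w y))"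
proof -
  have "norm (LINT y|lborel. f y *\<^sub>R w y) \<le> (LINT y|lborel. norm (f y *\<^sub>R w y))"
    by (rule integral_norm_bound)
  also have "\<dots> \<le> (LINT y|lborel. B * norm (w y))"
  proof (rule integral_mono)
    show "integrable lborel (\<lambda>y. norm (f y *\<^sub>R w y))"
      by (rule integrable_norm[OF integrable_bounded_scaleR[OF assms]])
  qed (use assms in \<open>auto intro: mult_right_mono\<close>)
  finally show ?thesis by simp
qed

text \<open>
  A kernel \<open>\<eta>\<close> with gradient \<open>G\<close>, both supported in the ball of radius \<open>r\<close>. The gradient is a
  parameter because convolutions with it appear on their own.
\<close>

locale C1_kernel =
  fixes \<eta> :: "'a::euclidean_space \<Rightarrow> real" and G :: "'a \<Rightarrow> 'a" and r :: real
  assumes der: "\<And>z. (\<eta> has_derivative (\<lambda>h. G z \<bullet> h)) (at z)"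
    and contG: "continuous_on UNIV G"
    and supp: "\<And>z. r < norm z \<Longrightarrow> \<eta> z = 0"
    and suppG: "\<And>z. r < norm z \<Longrightarrow> G z = 0"
begin

lemma cont: "continuous_on UNIV \<eta>"
  using der by (meson continuous_at_imp_continuous_on has_derivative_continuous)

lemma meas [measurable]: "\<eta> \<in> borel_measurable borel" "G \<in> borel_measurable borel"
  using cont contG by (auto intro: borel_measurable_continuous_onI)

lemma bounds: obtains B where "B \<ge> 0" "\<And>z. \<bar>\<eta> z\<bar> \<le> B" "\<And>z. norm (G z) \<le> B"
proof -
  obtain B1 where "B1 \<ge> 0" "\<And>z. norm (\<eta> z) \<le> B1" using bounded_compact_support[OF cont supp] by metis
  moreover obtain B2 where "B2 \<ge> 0" "\<And>z. norm (G z) \<le> B2"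
    using bounded_compact_support[OF contG suppG] by metis
  ultimately show thesis
    by (intro that[of "max B1 B2"]) (auto simp: le_max_iff_disj)
qed

lemma integrable_conv:
  fixes w :: "'a \<Rightarrow> 'b::{banach,second_countable_topology}"
  assumes "integrable lborel w"
  shows "integrable lborel (\<lambda>y. \<eta> (x - y) *\<^sub>R w y)"
proof -
  obtain B where "\<And>z. \<bar>\<eta> z\<bar> \<le> B" using bounds by metis
  then show ?thesis using assms by (intro integrable_bounded_scaleR[where B=B]) auto
qed

lemma integrable_conv_deriv:
  fixes w :: "'a \<Rightarrow> 'b::{banach,second_countable_topology}"
  assumes "integrable lborel w"
  shows "integrable lborel (\<lambda>y. (G (x - y) \<bullet> h) *\<^sub>R w y)"
proof -
  obtain B where B: "\<And>z. norm (G z) \<le> B" using bounds by metis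
  have "\<bar>G z \<bullet> h\<bar> \<le> B * norm h" for z
    by (rule order_trans[OF Cauchy_Schwarz_ineq2]) (use B in \<open>auto intro: mult_right_mono\<close>)
  then show ?thesis using assms by (intro integrable_bounded_scaleR[where B="B * norm h"]) auto
qed

text \<open>
  Since \<open>G\<close> is uniformly continuous, the first-order expansion of \<open>\<eta>\<close> has a remainder that is
  small uniformly in the base point. This lets the derivative be taken under the convolution
  integral although the second factor is merely integrable.
\<close>

lemma uniform_remainder:
  assumes "e > 0"
  obtains d where "d > 0"
    "\<And>z h. norm h < d \<Longrightarrow> \<bar>\<eta> (z + h) - \<eta> z - G z \<bullet> h\<bar> \<le> e * norm h"
    "\<And>z h. norm h < d \<Longrightarrow> norm (G (z + h) - G z) \<le> e"
proof -
  have "uniformly_continuous_on UNIV G"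
    by (rule uniformly_continuous_compact_support[OF contG suppG])
  then obtain d where d: "d > 0" "\<And>x y. dist y x < d \<Longrightarrow> dist (G y) (G x) < e"
    using assms unfolding uniformly_continuous_on_def by (metis UNIV_I)
  show thesis
  proof (rule that[OF d(1)])
    fix z h :: 'a assume h: "norm h < d"
    show "norm (G (z + h) - G z) \<le> e"
      using d(2)[of "z + h" z] h by (auto simp: dist_norm)
    have "norm (\<eta> (z + h) - \<eta> z - (\<lambda>k. G z \<bullet> k) (z + h - z)) \<le> norm (z + h - z) * e"
    proof (rule differentiable_bound_linearization
        [where S="cball z (norm h)" and f'="\<lambda>x k. G x \<bullet> k"])
      fix x assume x: "x \<in> cball z (norm h)"
      show "(\<eta> has_derivative (\<lambda>k. G x \<bullet> k)) (at x within cball z (norm h))"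
        using der by (rule has_derivative_at_withinI)
      show "onorm ((\<lambda>k. G x \<bullet> k) - (\<lambda>k. G z \<bullet> k)) \<le> e"
      proof (rule onorm_le)
        fix k
        have "\<bar>(G x - G z) \<bullet> k\<bar> \<le> norm (G x - G z) * norm k" by (rule Cauchy_Schwarz_ineq2)
        also have "\<dots> \<le> e * norm k"
          using d(2)[of x z] x h by (intro mult_right_mono) (auto simp: dist_norm norm_minus_commute)
        finally show "norm (((\<lambda>k. G x \<bullet> k) - (\<lambda>k. G z \<bullet> k)) k) \<le> e * norm k"
          by (simp add: inner_diff_left)
      qed
    qed (auto simp: dist_norm mult_left_le_one_le)
    then show "\<bar>\<eta> (z + h) - \<eta> z - G z \<bullet> h\<bar> \<le> e * norm h" by (simp add: mult.commute)
  qed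
qed

lemma conv_has_derivative:
  fixes w :: "'a \<Rightarrow> 'b::{banach,second_countable_topology}"
  assumes w: "integrable lborel w"
  shows "((\<lambda>x. LINT y|lborel. \<eta> (x - y) *\<^sub>R w y) has_derivative
          (\<lambda>h. LINT y|lborel. (G (x - y) \<bullet> h) *\<^sub>R w y)) (at x)"
  unfolding has_derivative_at_alt
proof (intro conjI allI impI)
  obtain B where B: "\<And>z. norm (G z) \<le> B" using bounds by metis
  have Bh: "\<bar>G z \<bullet> h\<bar> \<le> norm h * B" for z h
    using order_trans[OF Cauchy_Schwarz_ineq2 mult_right_mono[OF B norm_ge_zero]] by (simp add: mult.commute)
  note ig = integrable_conv_deriv[OF w]
  let ?W = "LINT y|lborel. norm (w y)"
  have W: "?W \<ge> 0" by simp
  show "bounded_linear (\<lambda>h. LINT y|lborel. (G (x - y) \<bullet> h) *\<^sub>R w y)"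
  proof (rule bounded_linear_intro[where K="B * ?W"])
    fix h k :: 'a and c :: real
    show "(LINT y|lborel. (G (x - y) \<bullet> (h + k)) *\<^sub>R w y) =
      (LINT y|lborel. (G (x - y) \<bullet> h) *\<^sub>R w y) + (LINT y|lborel. (G (x - y) \<bullet> k) *\<^sub>R w y)"
      using ig by (simp add: inner_add_right scaleR_add_left)
    show "(LINT y|lborel. (G (x - y) \<bullet> (c *\<^sub>R h)) *\<^sub>R w y) = c *\<^sub>R (LINT y|lborel. (G (x - y) \<bullet> h) *\<^sub>R w y)"
      by (simp flip: scaleR_scaleR)
    show "norm (LINT y|lborel. (G (x - y) \<bullet> h) *\<^sub>R w y) \<le> norm h * (B * ?W)"
      using norm_integral_bounded_scaleR[of "\<lambda>y. G (x - y) \<bullet> h" "norm h * B" w] Bh w by (simp add: mult.assoc)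
  qed
  fix e :: real assume "e > 0"
  define e' where "e' = e / (?W + 1)"
  have Wpos: "?W + 1 > 0" using W by linarith
  have e'pos: "e' > 0" unfolding e'_def using \<open>e > 0\<close> Wpos by (rule divide_pos_pos)
  have "e' * ?W \<le> e' * (?W + 1)" using e'pos by (intro mult_left_mono) auto
  also have "\<dots> = e" using Wpos by (simp add: e'_def)
  finally have e': "e' > 0" "e' * ?W \<le> e" using e'pos by auto
  obtain d where d: "d > 0" "\<And>z h. norm h < d \<Longrightarrow> \<bar>\<eta> (z + h) - \<eta> z - G z \<bullet> h\<bar> \<le> e' * norm h"
    using uniform_remainder[OF e'(1)] by metis
  show "\<exists>d>0. \<forall>y. norm (y - x) < d \<longrightarrow>
     norm ((LINT z|lborel. \<eta> (y - z) *\<^sub>R w z) - (LINT z|lborel. \<eta> (x - z) *\<^sub>R w z) -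
       (LINT z|lborel. (G (x - z) \<bullet> (y - x)) *\<^sub>R w z)) \<le> e * norm (y - x)"
  proof (intro exI conjI allI impI)
    fix y assume y: "norm (y - x) < d"
    have "(LINT z|lborel. \<eta> (y - z) *\<^sub>R w z) - (LINT z|lborel. \<eta> (x - z) *\<^sub>R w z) -
       (LINT z|lborel. (G (x - z) \<bullet> (y - x)) *\<^sub>R w z)
       = (LINT z|lborel. (\<eta> (y - z) - \<eta> (x - z) - G (x - z) \<bullet> (y - x)) *\<^sub>R w z)"
      using integrable_conv[OF w] ig by (simp add: scaleR_diff_left)
    also have "norm \<dots> \<le> (e' * norm (y - x)) * ?W"
    proof (rule norm_integral_bounded_scaleR)
      fix z
      show "\<bar>\<eta> (y - z) - \<eta> (x - z) - G (x - z) \<bullet> (y - x)\<bar> \<le> e' * norm (y - x)"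
        using d(2)[OF y, of "x - z"] by simp
    qed (use w in auto)
    also have "\<dots> = (e' * ?W) * norm (y - x)" by simp
    also have "\<dots> \<le> e * norm (y - x)" using e'(2) by (intro mult_right_mono) auto
    finally show "norm ((LINT z|lborel. \<eta> (y - z) *\<^sub>R w z) - (LINT z|lborel. \<eta> (x - z) *\<^sub>R w z) -
       (LINT z|lborel. (G (x - z) \<bullet> (y - x)) *\<^sub>R w z)) \<le> e * norm (y - x)" .
  qed (rule d(1))
qed

lemma continuous_conv_deriv:
  fixes w :: "'a \<Rightarrow> 'b::{banach,second_countable_topology}"
  assumes w: "integrable lborel w"
  shows "continuous_on UNIV (\<lambda>x. LINT y|lborel. (G (x - y) \<bullet> h) *\<^sub>R w y)"
  unfolding continuous_on_iff
proof (intro ballI allI impI)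
  let ?W = "LINT y|lborel. norm (w y)"
  have W: "?W \<ge> 0" by simp
  note ig = integrable_conv_deriv[OF w]
  fix x :: 'a and e :: real assume "e > 0"
  define e' where "e' = e / ((norm h + 1) * (?W + 1))"
  have pos: "norm h + 1 > 0" "?W + 1 > 0" using W norm_ge_zero[of h] by linarith+
  have e': "e' > 0" unfolding e'_def using \<open>e > 0\<close> pos by (intro divide_pos_pos mult_pos_pos)
  have "norm h * ?W < (norm h + 1) * (?W + 1)"
  proof -
    have "(norm h + 1) * (?W + 1) = norm h * ?W + (norm h + ?W + 1)" by (simp add: algebra_simps)
    then show ?thesis using norm_ge_zero[of h] W by linarith
  qed
  then have "e' * (norm h * ?W) < e' * ((norm h + 1) * (?W + 1))"
    using e' by (rule mult_strict_left_mono)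
  also have "\<dots> = e"
    using pos unfolding e'_def by (intro nonzero_divide_eq_eq[THEN iffD1, symmetric]) (auto intro: less_imp_neq)
  finally have lt: "e' * (norm h * ?W) < e" .
  obtain d where d: "d > 0" "\<And>z h. norm h < d \<Longrightarrow> norm (G (z + h) - G z) \<le> e'"
    using uniform_remainder[OF e'] by metis
  show "\<exists>d>0. \<forall>x'\<in>UNIV. dist x' x < d \<longrightarrow>
    dist (LINT y|lborel. (G (x' - y) \<bullet> h) *\<^sub>R w y) (LINT y|lborel. (G (x - y) \<bullet> h) *\<^sub>R w y) < e"
  proof (intro exI conjI ballI impI)
    fix x' assume "dist x' x < d"
    then have x': "norm (x' - x) < d" by (simp add: dist_norm)
    have "dist (LINT y|lborel. (G (x' - y) \<bullet> h) *\<^sub>R w y) (LINT y|lborel. (G (x - y) \<bullet> h) *\<^sub>R w y)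
      = norm (LINT y|lborel. ((G (x' - y) - G (x - y)) \<bullet> h) *\<^sub>R w y)"
      using ig by (simp add: dist_norm inner_diff_left scaleR_diff_left)
    also have "\<dots> \<le> (e' * norm h) * ?W"
    proof (rule norm_integral_bounded_scaleR)
      fix y
      have "norm (G (x' - y) - G (x - y)) \<le> e'" using d(2)[OF x', of "x - y"] by simp
      then show "\<bar>(G (x' - y) - G (x - y)) \<bullet> h\<bar> \<le> e' * norm h"
        using order_trans[OF Cauchy_Schwarz_ineq2 mult_right_mono] norm_ge_zero by blast
    qed (use w in auto)
    also have "\<dots> < e" using lt by (simp add: mult.assoc)
    finally show "dist (LINT y|lborel. (G (x' - y) \<bullet> h) *\<^sub>R w y)
      (LINT y|lborel. (G (x - y) \<bullet> h) *\<^sub>R w y) < e" .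
  qed (rule d(1))
qed

end

text \<open>
  Oddness of the gradient lets the kernel be moved from the test field to the function in
  \<open>\<integral> u * divergence (\<eta> * \<zeta>)\<close>.
\<close>

locale mollifier = C1_kernel +
  assumes nonneg: "\<And>z. \<eta> z \<ge> 0"
    and integrable_kernel: "integrable lborel \<eta>"
    and integral_kernel: "(LINT z|lborel. \<eta> z) = 1"
    and odd_gradient: "\<And>z. G (- z) = - G z"
begin

lemma integral_kernel_reflect: "(LINT y|lborel. \<eta> (x - y)) = 1"
  using integral_reflect[of \<eta> x] integral_kernel by simp

lemma integrable_kernel_reflect: "integrable lborel (\<lambda>y. \<eta> (x - y))"
  using integral_kernel_reflect[of x] not_integrable_integral_eq[of lborel "\<lambda>y. \<eta> (x - y)"] by fastforce

end

text \<open>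
  The squared positive part is the cheapest \<open>C\<^sup>1\<close> function that vanishes on a half-line. It is
  used for the mollifier and again for the smoothed truncations.
\<close>

lemma has_derivative_square_max:
  "((\<lambda>s::real. (max 0 s)\<^sup>2) has_derivative (\<lambda>h. 2 * max 0 s * h)) (at s)"
proof -
  consider "s < 0" | "s > 0" | "s = 0" by linarith
  then have "((\<lambda>s::real. (max 0 s)\<^sup>2) has_real_derivative (2 * max 0 s)) (at s)"
  proof cases
    case 1
    have "((\<lambda>s::real. 0) has_real_derivative (2 * max 0 s)) (at s)" using 1 by simp
    then show ?thesis
      by (rule DERIV_cong_ev[THEN iffD1, rotated -1])
        (use 1 eventually_nhds_in_open[of "{..<0}" s] in \<open>auto elim!: eventually_mono\<close>)
  next
    case 2
    have "((\<lambda>s::real. s\<^sup>2) has_real_derivative (2 * max 0 s)) (at s)"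
      using 2 by (auto intro!: derivative_eq_intros)
    then show ?thesis
      by (rule DERIV_cong_ev[THEN iffD1, rotated -1])
        (use 2 eventually_nhds_in_open[of "{0<..}" s] in \<open>auto elim!: eventually_mono\<close>)
  next
    case 3
    have "(\<lambda>h::real. ((max 0 h)\<^sup>2) / h) \<midarrow>0\<rightarrow> 0"
    proof (rule Lim_null_comparison[where g="\<lambda>h. \<bar>h\<bar>"])
      show "\<forall>\<^sub>F h in at (0::real). norm ((max 0 h)\<^sup>2 / h) \<le> \<bar>h\<bar>"
        by (intro always_eventually allI) (auto simp: max_def power2_eq_square)
      show "((\<lambda>h::real. \<bar>h\<bar>) \<longlongrightarrow> 0) (at 0)" by (rule tendsto_rabs_zero) (rule tendsto_ident_at)
    qed
    then show ?thesis using 3 by (simp add: DERIV_def)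
  qed
  then show ?thesis by (simp add: has_field_derivative_def)
qed

lemma mollifier_exists:
  assumes "\<epsilon> > 0"
  obtains \<eta> :: "'a::euclidean_space \<Rightarrow> real" and G where
    "mollifier \<eta> G \<epsilon>"
proof -
  define k :: "'a \<Rightarrow> real" where "k z = (max 0 (\<epsilon>\<^sup>2 - z \<bullet> z))\<^sup>2" for z
  define K :: "'a \<Rightarrow> 'a" where "K z = (- 4 * max 0 (\<epsilon>\<^sup>2 - z \<bullet> z)) *\<^sub>R z" for z
  have far: "\<epsilon>\<^sup>2 - z \<bullet> z < 0" if "\<epsilon> < norm z" for z :: 'a
    using that assms power_strict_mono[of \<epsilon> "norm z" 2] by (simp add: power2_norm_eq_inner)
  have k: "C1_kernel k K \<epsilon>"
  proof
    fix z
    have "((\<lambda>z::'a. \<epsilon>\<^sup>2 - z \<bullet> z) has_derivative (\<lambda>h. - 2 * (z \<bullet> h))) (at z)"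
      by (auto intro!: derivative_eq_intros simp: inner_commute)
    from has_derivative_compose[OF this has_derivative_square_max]
    show "(k has_derivative (\<lambda>h. K z \<bullet> h)) (at z)"
      unfolding k_def[abs_def] K_def by (simp add: algebra_simps)
  next
    show "continuous_on UNIV K" unfolding K_def by (intro continuous_intros)
  qed (use far in \<open>auto simp: k_def K_def max_def not_less\<close>, insert far, force+)
  interpret k: C1_kernel k K \<epsilon> by (rule k)
  have ik: "integrable lborel k"
    by (rule integrable_compact_support[OF k.cont k.supp])
  define I where "I = (LINT z|lborel. k z)"
  have "I > 0"
  proof -
    define c where "c = (\<epsilon>\<^sup>2 - (\<epsilon>/2)\<^sup>2)\<^sup>2"
    have c: "c > 0" using assms by (auto simp: c_def power2_eq_square)
    have "0 < measure lborel (ball (0::'a) (\<epsilon>/2))"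
      using assms by (intro content_ball_pos) auto
    with c have "0 < c * measure lborel (ball (0::'a) (\<epsilon>/2))" by simp
    also have "\<dots> = (LINT z|lborel. c * indicator (ball (0::'a) (\<epsilon>/2)) z)" by simp
    also have "\<dots> \<le> I"
      unfolding I_def
    proof (rule integral_mono)
      have "emeasure lborel (ball (0::'a) (\<epsilon>/2)) < \<infinity>" by (intro emeasure_bounded_finite) auto
      then show "integrable lborel (\<lambda>z. c * indicator (ball (0::'a) (\<epsilon>/2)) z)" by auto
      fix z :: 'a
      show "c * indicator (ball 0 (\<epsilon>/2)) z \<le> k z"
      proof (cases "z \<in> ball 0 (\<epsilon>/2)")
        case True
        then have "z \<bullet> z \<le> (\<epsilon>/2)\<^sup>2"
          using power_mono[of "norm z" "\<epsilon>/2" 2] by (simp add: power2_norm_eq_inner)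
        moreover have "(\<epsilon>/2)\<^sup>2 \<le> \<epsilon>\<^sup>2" using assms by (intro power_mono) auto
        ultimately show ?thesis using True unfolding c_def k_def by (auto intro!: power_mono)
      qed (simp add: k_def)
    qed (rule ik)
    finally show ?thesis .
  qed
  show thesis
  proof (rule that[of "\<lambda>z. k z / I" "\<lambda>z. (1 / I) *\<^sub>R K z"])
    show "mollifier (\<lambda>z. k z / I) (\<lambda>z. (1 / I) *\<^sub>R K z) \<epsilon>"
    proof
      fix z
      show "((\<lambda>z. k z / I) has_derivative (\<lambda>h. ((1 / I) *\<^sub>R K z) \<bullet> h)) (at z)"
        using has_derivative_mult_right[OF k.der[of z], of "1 / I"] by (simp)
      show "integrable lborel (\<lambda>z. k z / I)" using ik by simp
      show "(LINT z|lborel. k z / I) = 1" using \<open>I > 0\<close> by (simp flip: I_def)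
    qed (use \<open>I > 0\<close> k.supp k.suppG k.contG in \<open>auto simp: k_def K_def intro!: continuous_intros\<close>)
  qed
qed

text \<open>
  A measurable function is an almost everywhere limit of continuous functions; clamping these to
  the range of \<open>u\<close> and cutting them off outside a ball provides a dominating function.
\<close>

lemma L1_approximation_by_continuous:
  fixes u :: "'a::euclidean_space \<Rightarrow> real"
  assumes u: "u \<in> borel_measurable borel" "\<And>x. s < norm x \<Longrightarrow> u x = 0" "\<And>x. \<bar>u x\<bar> \<le> M" and "e > 0"
  shows "\<exists>g t. continuous_on UNIV g \<and> (\<forall>x. t < norm x \<longrightarrow> g x = 0) \<and> (LINT x|lborel. \<bar>u x - g x\<bar>) < e"
proof -
  have M: "M \<ge> 0" using u(3)[of 0] by linarith
  have "u measurable_on UNIV"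
    using u(1) by (intro lebesgue_measurable_imp_measurable_on_real) (auto intro: measurable_completion)
  then obtain N g where N: "negligible N" and g: "\<And>n. continuous_on UNIV (g n)"
      "\<And>x. x \<notin> N \<Longrightarrow> (\<lambda>n. g n x) \<longlonglongrightarrow> u x"
    unfolding measurable_on_def by auto
  \<comment> \<open>Equal to 1 where \<open>u\<close> may be non-zero, and 0 outside the ball of radius \<open>s + 1\<close>.\<close>
  define cut where "cut x = max 0 (min 1 (s + 1 - norm x))" for x :: 'a
  define h where "h n x = cut x * max (- M) (min M (g n x))" for n x
  have hc: "continuous_on UNIV (h n)" for n
    unfolding h_def cut_def by (intro continuous_intros g)
  have h0: "h n x = 0" if "s + 1 < norm x" for n x
    using that by (simp add: h_def cut_def max_def)
  have hM: "\<bar>h n x\<bar> \<le> M" for n x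
  proof -
    have "\<bar>h n x\<bar> \<le> 1 * M"
      unfolding h_def abs_mult by (intro mult_mono) (use M in \<open>auto simp: cut_def\<close>)
    then show ?thesis by simp
  qed
  have [measurable]: "h n \<in> borel_measurable borel" "u \<in> borel_measurable borel" for n
    using hc u by (auto intro: borel_measurable_continuous_onI)
  have "(\<lambda>n. LINT x|lborel. \<bar>u x - h n x\<bar>) \<longlonglongrightarrow> (LINT x::'a|lborel. 0)"
  proof (rule integral_dominated_convergence[where w="\<lambda>x. indicator (cball 0 (s+1)) x * (2 * M)"])
    have "emeasure lborel (cball 0 (s+1) :: 'a set) < \<infinity>" by (intro emeasure_bounded_finite) auto
    then show "integrable lborel (\<lambda>x::'a. indicator (cball 0 (s+1)) x * (2 * M))" by simp
    have "AE x in lebesgue. x \<notin> N"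
      using N by (simp add: AE_not_in negligible_iff_null_sets)
    then have "AE x in lborel. x \<notin> N" by (simp add: AE_completion_iff)
    then show "AE x in lborel. (\<lambda>n. \<bar>u x - h n x\<bar>) \<longlonglongrightarrow> 0"
    proof eventually_elim
      case (elim x)
      have "(\<lambda>n. h n x) \<longlonglongrightarrow> cut x * max (- M) (min M (u x))"
        unfolding h_def by (intro tendsto_intros g elim)
      also have "cut x * max (- M) (min M (u x)) = u x"
        using u(3)[of x] u(2)[of x] by (cases "s < norm x") (auto simp: cut_def max_def min_def abs_le_iff)
      finally have "(\<lambda>n. \<bar>u x - h n x\<bar>) \<longlonglongrightarrow> \<bar>u x - u x\<bar>" by (intro tendsto_intros)
      then show ?case by simp
    qed
    fix n
    show "AE x in lborel. norm \<bar>u x - h n x\<bar> \<le> indicator (cball 0 (s+1)) x * (2 * M)"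
    proof (intro AE_I2)
      fix x
      show "norm \<bar>u x - h n x\<bar> \<le> indicator (cball 0 (s+1)) x * (2 * M)"
        using hM[of n x] u(3)[of x] h0[of x n] u(2)[of x] by (cases "s + 1 < norm x") (auto simp: indicator_def)
    qed
  qed measurable
  then have "\<forall>\<^sub>F n in sequentially. (LINT x|lborel. \<bar>u x - h n x\<bar>) < e"
    using \<open>e > 0\<close> by (intro order_tendstoD) auto
  then obtain n where "(LINT x|lborel. \<bar>u x - h n x\<bar>) < e"
    unfolding eventually_sequentially by blast
  then show ?thesis using hc h0 by blast
qed

context mollifier begin

lemma borel_measurable_conv:
  fixes w :: "'a \<Rightarrow> 'b::{banach,second_countable_topology}"
  assumes "integrable lborel w"
  shows "(\<lambda>x. LINT y|lborel. \<eta> (x - y) *\<^sub>R w y) \<in> borel_measurable borel"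
  using conv_has_derivative[OF assms]
  by (intro borel_measurable_continuous_onI) (meson continuous_at_imp_continuous_on has_derivative_continuous)

text \<open>
  Tonelli, since the kernel has mass 1 in either variable.
\<close>

lemma conv_L1_contraction:
  fixes w :: "'a \<Rightarrow> real"
  assumes w: "integrable lborel w"
  shows "integrable lborel (\<lambda>x. LINT y|lborel. \<eta> (x - y) * w y)"
    "(LINT x|lborel. \<bar>LINT y|lborel. \<eta> (x - y) * w y\<bar>) \<le> (LINT y|lborel. \<bar>w y\<bar>)"
proof -
  let ?c = "\<lambda>x. LINT y|lborel. \<eta> (x - y) * w y"
  have [measurable]: "?c \<in> borel_measurable borel" using borel_measurable_conv[OF w] by simp
  have [measurable]: "w \<in> borel_measurable borel" using w by auto
  have ig: "integrable lborel (\<lambda>y. \<eta> (x - y) * w y)" for x using integrable_conv[OF w, of x] by simp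
  have one: "(\<integral>\<^sup>+x. ennreal (\<eta> (x - y)) \<partial>lborel) = 1" for y
  proof -
    have "(\<integral>\<^sup>+x. ennreal (\<eta> (x - y)) \<partial>lborel) = ennreal (LINT x|lborel. \<eta> (x - y))"
      using integrable_shift[OF integrable_kernel, of "- y"] nonneg by (intro nn_integral_eq_integral) auto
    also have "(LINT x|lborel. \<eta> (x - y)) = 1" using integral_shift[of \<eta> "- y"] integral_kernel by simp
    finally show ?thesis by simp
  qed
  have "(\<integral>\<^sup>+x. ennreal \<bar>?c x\<bar> \<partial>lborel) \<le> (\<integral>\<^sup>+x. (\<integral>\<^sup>+y. ennreal (\<eta> (x - y) * \<bar>w y\<bar>) \<partial>lborel) \<partial>lborel)"
  proof (rule nn_integral_mono)
    fix x
    have "ennreal \<bar>?c x\<bar> \<le> ennreal (LINT y|lborel. \<bar>\<eta> (x - y) * w y\<bar>)"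
      using integral_norm_bound[of lborel "\<lambda>y. \<eta> (x - y) * w y"] by (intro ennreal_leI) simp
    also have "\<dots> = (\<integral>\<^sup>+y. ennreal \<bar>\<eta> (x - y) * w y\<bar> \<partial>lborel)"
      using ig by (intro nn_integral_eq_integral[symmetric]) auto
    finally show "ennreal \<bar>?c x\<bar> \<le> (\<integral>\<^sup>+y. ennreal (\<eta> (x - y) * \<bar>w y\<bar>) \<partial>lborel)"
      using nonneg by (simp add: abs_mult)
  qed
  also have "\<dots> = (\<integral>\<^sup>+y. (\<integral>\<^sup>+x. ennreal (\<eta> (x - y) * \<bar>w y\<bar>) \<partial>lborel) \<partial>lborel)"
    by (rule lborel_pair.Fubini'[symmetric]) measurable
  also have "\<dots> = (\<integral>\<^sup>+y. ennreal \<bar>w y\<bar> \<partial>lborel)"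
    by (simp add: ennreal_mult nonneg nn_integral_multc one)
  also have "\<dots> = ennreal (LINT y|lborel. \<bar>w y\<bar>)"
    using w by (intro nn_integral_eq_integral) auto
  finally have le: "(\<integral>\<^sup>+x. ennreal \<bar>?c x\<bar> \<partial>lborel) \<le> ennreal (LINT y|lborel. \<bar>w y\<bar>)" .
  show int: "integrable lborel ?c"
    using le_less_trans[OF le] by (intro integrableI_bounded) auto
  have "ennreal (LINT x|lborel. \<bar>?c x\<bar>) = (\<integral>\<^sup>+x. ennreal \<bar>?c x\<bar> \<partial>lborel)"
    using int by (intro nn_integral_eq_integral[symmetric]) auto
  with le have "ennreal (LINT x|lborel. \<bar>?c x\<bar>) \<le> ennreal (LINT y|lborel. \<bar>w y\<bar>)" by simp
  then show "(LINT x|lborel. \<bar>?c x\<bar>) \<le> (LINT y|lborel. \<bar>w y\<bar>)"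
    by (subst (asm) ennreal_le_iff) auto
qed

lemma conv_near_continuous:
  fixes g :: "'a \<Rightarrow> real"
  assumes g: "integrable lborel g" and near: "\<And>x y. dist y x \<le> r \<Longrightarrow> \<bar>g y - g x\<bar> \<le> e"
  shows "\<bar>(LINT y|lborel. \<eta> (x - y) * g y) - g x\<bar> \<le> e"
proof -
  have i1: "integrable lborel (\<lambda>y. \<eta> (x - y) * g y)" using integrable_conv[OF g, of x] by simp
  have i2: "integrable lborel (\<lambda>y. \<eta> (x - y) * g x)" using integrable_kernel_reflect[of x] by simp
  have "(LINT y|lborel. \<eta> (x - y) * g y) - g x = (LINT y|lborel. \<eta> (x - y) * g y) - (LINT y|lborel. \<eta> (x - y) * g x)"
    using integral_kernel_reflect[of x] by simp
  also have "\<dots> = (LINT y|lborel. \<eta> (x - y) * (g y - g x))"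
    using i1 i2 by (simp add: right_diff_distrib)
  also have "\<bar>\<dots>\<bar> \<le> (LINT y|lborel. \<bar>\<eta> (x - y) * (g y - g x)\<bar>)"
    using integral_norm_bound[of lborel "\<lambda>y. \<eta> (x - y) * (g y - g x)"] by simp
  also have "\<dots> \<le> (LINT y|lborel. \<eta> (x - y) * e)"
  proof (rule integral_mono)
    show "integrable lborel (\<lambda>y. \<bar>\<eta> (x - y) * (g y - g x)\<bar>)"
      using Bochner_Integration.integrable_diff[OF i1 i2] by (simp add: right_diff_distrib)
    show "integrable lborel (\<lambda>y. \<eta> (x - y) * e)" using integrable_kernel_reflect[of x] by simp
    fix y
    show "\<bar>\<eta> (x - y) * (g y - g x)\<bar> \<le> \<eta> (x - y) * e"
    proof (cases "r < norm (x - y)")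
      case False
      then have "\<bar>g y - g x\<bar> \<le> e" by (intro near) (simp add: dist_norm norm_minus_commute)
      then show ?thesis using nonneg[of "x - y"] by (simp add: abs_mult mult_left_mono)
    qed (simp add: supp)
  qed
  also have "\<dots> = e" using integral_kernel_reflect[of x] by simp
  finally show ?thesis .
qed

end

text \<open>
  The standard three-term estimate: replace \<open>u\<close> by a continuous \<open>g\<close> of compact support, for
  which mollification converges uniformly; the two errors are controlled by
  \<open>conv_L1_contraction\<close>. One threshold \<open>d\<close> serves all smaller kernels, so the radius can also be
  adapted to a support.
\<close>

lemma mollification_L1_convergence:
  fixes u :: "'a::euclidean_space \<Rightarrow> real"
  assumes u: "u \<in> borel_measurable borel" "\<And>x. s < norm x \<Longrightarrow> u x = 0" "\<And>x. \<bar>u x\<bar> \<le> M" and "e > 0"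
  obtains d where "d > 0"
    "\<And>\<epsilon> \<eta> G. \<epsilon> \<le> d \<Longrightarrow> mollifier \<eta> G \<epsilon> \<Longrightarrow> (LINT x|lborel. \<bar>(LINT y|lborel. \<eta> (x - y) * u y) - u x\<bar>) \<le> e"
proof -
  have e3: "e / 3 > 0" using \<open>e > 0\<close> by simp
  have "\<exists>g t. continuous_on UNIV g \<and> (\<forall>x. t < norm x \<longrightarrow> g x = 0) \<and> (LINT x|lborel. \<bar>u x - g x\<bar>) < e / 3"
    by (rule L1_approximation_by_continuous[OF u(1) _ u(3) e3]) (rule u(2))
  then obtain g t where g: "continuous_on UNIV g" "\<And>x. t < norm x \<Longrightarrow> g x = 0"
    and ug: "(LINT x|lborel. \<bar>u x - g x\<bar>) < e / 3"
    by blast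
  have iu: "integrable lborel u" by (rule integrable_bounded_support[OF u(1,2)]) (use u in auto)
  have ig: "integrable lborel g" by (rule integrable_compact_support[OF g])
  have iug: "integrable lborel (\<lambda>x. u x - g x)" using iu ig by simp
  define V where "V = measure lborel (cball 0 (t + 1) :: 'a set)"
  have V: "V \<ge> 0" by (simp add: V_def)
  have fin: "emeasure lborel (cball 0 (t + 1) :: 'a set) < \<infinity>" by (intro emeasure_bounded_finite) auto
  define e' where "e' = e / 3 / (V + 1)"
  have e': "e' > 0" using \<open>e > 0\<close> V by (auto simp: e'_def)
  have "e' * V \<le> e' * (V + 1)" using e' by simp
  also have "\<dots> = e / 3"
    by (rule nonzero_divide_eq_eq[THEN iffD1, symmetric]) (use V in \<open>auto simp: e'_def\<close>)
  finally have e'V: "e' * V \<le> e / 3" .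
  have "uniformly_continuous_on UNIV g"
    by (rule uniformly_continuous_compact_support[OF g])
  then obtain d where d: "d > 0" "\<And>x y. dist y x < d \<Longrightarrow> dist (g y) (g x) < e'"
    using e' unfolding uniformly_continuous_on_def by (metis UNIV_I)
  show thesis
  proof (rule that[of "min 1 (d / 2)"])
    show "min 1 (d / 2) > 0" using d by simp
    fix \<epsilon> G and \<eta> :: "'a \<Rightarrow> real"
    assume \<epsilon>: "\<epsilon> \<le> min 1 (d / 2)" and "mollifier \<eta> G \<epsilon>"
    then interpret mollifier \<eta> G \<epsilon> by simp
    define c where "c w x = (LINT y|lborel. \<eta> (x - y) * w y)" for w :: "'a \<Rightarrow> real" and x
    have [measurable]: "c w \<in> borel_measurable borel" if "integrable lborel w" for w
      using borel_measurable_conv[OF that] by (simp add: c_def[abs_def])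
    have near: "\<bar>c g x - g x\<bar> \<le> e' * indicator (cball 0 (t + 1)) x" for x
    proof (cases "t + 1 < norm x")
      case True
      have "\<eta> (x - y) * g y = 0" for y
      proof (cases "t < norm y")
        case False
        then have "\<epsilon> < norm (x - y)" using True \<epsilon> norm_triangle_ineq2[of x y] by linarith
        then show ?thesis by (simp add: supp)
      qed (simp add: g)
      then have "(\<lambda>y. \<eta> (x - y) * g y) = (\<lambda>y. 0)" by (rule ext)
      then have "c g x = 0" unfolding c_def by (simp only: integral_zero)
      then show ?thesis using True e' by (simp add: g)
    next
      case False
      have "\<bar>c g x - g x\<bar> \<le> e'" unfolding c_def
      proof (rule conv_near_continuous[OF ig])
        fix x y :: 'a assume "dist y x \<le> \<epsilon>"
        then have "dist y x < d" using \<epsilon> d(1) by linarith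
        from d(2)[OF this] show "\<bar>g y - g x\<bar> \<le> e'" by (simp add: dist_real_def)
      qed
      then show ?thesis using False by simp
    qed
    have ind: "integrable lborel (\<lambda>x::'a. e' * indicator (cball 0 (t + 1)) x :: real)" using fin by simp
    have i1: "integrable lborel (\<lambda>x. \<bar>c (\<lambda>x. u x - g x) x\<bar>)" 
      unfolding c_def by (rule integrable_abs[OF conv_L1_contraction(1)[OF iug]])
    have i3: "integrable lborel (\<lambda>x. \<bar>u x - g x\<bar>)" using iug by (rule integrable_abs)
    have split: "c u x - u x = c (\<lambda>x. u x - g x) x + (c g x - g x) - (u x - g x)" for x
      using integrable_conv[OF iu, of x] integrable_conv[OF ig, of x] by (simp add: c_def right_diff_distrib)
    have "(LINT x|lborel. \<bar>c u x - u x\<bar>) \<le>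
      (LINT x|lborel. \<bar>c (\<lambda>x. u x - g x) x\<bar> + e' * indicator (cball 0 (t + 1)) x + \<bar>u x - g x\<bar>)"
    proof (rule integral_mono)
      show "integrable lborel (\<lambda>x. \<bar>c u x - u x\<bar>)"
        using conv_L1_contraction(1)[OF iu] iu unfolding c_def by simp
      show "integrable lborel (\<lambda>x. \<bar>c (\<lambda>x. u x - g x) x\<bar> + e' * indicator (cball 0 (t + 1)) x + \<bar>u x - g x\<bar>)"
        by (intro Bochner_Integration.integrable_add i1 ind i3)
      show "\<bar>c u x - u x\<bar> \<le> \<bar>c (\<lambda>x. u x - g x) x\<bar> + e' * indicator (cball 0 (t + 1)) x + \<bar>u x - g x\<bar>" for x
        using near[of x] unfolding split[of x] by linarith
    qed
    also have "\<dots> = (LINT x|lborel. \<bar>c (\<lambda>x. u x - g x) x\<bar>) + e' * V + (LINT x|lborel. \<bar>u x - g x\<bar>)"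
      using i1 ind i3 by (simp add: V_def)
    also have "\<dots> \<le> (LINT x|lborel. \<bar>u x - g x\<bar>) + e' * V + (LINT x|lborel. \<bar>u x - g x\<bar>)"
      using conv_L1_contraction(2)[OF iug] by (simp add: c_def)
    also have "\<dots> \<le> e" using ug e'V by linarith
    finally show "(LINT x|lborel. \<bar>(LINT y|lborel. \<eta> (x - y) * u y) - u x\<bar>) \<le> e"
      by (simp add: c_def)
  qed
qed

section \<open>Test fields and divergence\<close>

lemma infnorm_le_iff_cart: "infnorm (v :: real^'n) \<le> r \<longleftrightarrow> (\<forall>j. \<bar>v $ j\<bar> \<le> r)"
proof -
  have "infnorm v \<le> r \<longleftrightarrow> (\<forall>b\<in>Basis. \<bar>v \<bullet> b\<bar> \<le> r)"
    unfolding infnorm_Max by (subst Max_le_iff) auto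
  then show ?thesis by (auto simp: Basis_vec_def inner_axis)
qed

text \<open>
  Directions whose half-spaces \<open>{v. a \<bullet> v \<le> r}\<close> intersect in the ball of radius \<open>r\<close> of the dual
  norm. They reduce bounds on the dual norm of sums and integrals to scalar inequalities, for
  both kinds of total variation at once.
\<close>

definition dual_test :: "tv_kind \<Rightarrow> (real^'d) set" where
  "dual_test N = (case N of Isotropic \<Rightarrow> cball 0 1 | Anisotropic \<Rightarrow> {a. \<exists>j. a = axis j 1 \<or> a = - axis j 1})"

lemma dual_norm_le_iff:
  assumes "0 \<le> r"
  shows "dual_norm N v \<le> r \<longleftrightarrow> (\<forall>a\<in>dual_test N. a \<bullet> v \<le> r)"
proof (cases N)
  case Isotropic
  have "norm v \<le> r" if "\<forall>a\<in>cball 0 1. a \<bullet> v \<le> r"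
  proof -
    have "sgn v \<bullet> v = norm v"
      by (cases "v = 0") (simp_all add: sgn_div_norm dot_square_norm power2_eq_square)
    then show ?thesis using that[rule_format, of "sgn v"] by (simp add: norm_sgn)
  qed
  moreover have "a \<bullet> v \<le> r" if "norm v \<le> r" "a \<in> cball 0 1" for a
  proof -
    have "a \<bullet> v \<le> norm a * norm v" by (rule norm_cauchy_schwarz)
    also have "\<dots> \<le> 1 * r" using that by (intro mult_mono) auto
    finally show ?thesis by simp
  qed
  ultimately show ?thesis using Isotropic by (auto simp: dual_test_def)
next
  case Anisotropic
  then show ?thesis
    by (force simp: dual_test_def infnorm_le_iff_cart inner_axis' abs_le_iff)
qed

lemma dual_norm_scaleR: "dual_norm N (c *\<^sub>R v) = \<bar>c\<bar> * dual_norm N v"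
  by (cases N) (auto simp: infnorm_mul)

text \<open>
  It suffices that the derivative is continuous in each direction, as the domain is
  finite-dimensional.
\<close>

lemma C1_compactI:
  fixes q :: "'a::euclidean_space \<Rightarrow> 'b::real_normed_vector"
  assumes K: "compact K" "K \<subseteq> \<Omega>" "\<And>x. x \<notin> K \<Longrightarrow> q x = 0"
    and der: "\<And>x. (q has_derivative D x) (at x)"
    and cont: "\<And>h. continuous_on UNIV (\<lambda>x. D x h)"
  shows "q \<in> C1_compact \<Omega>"
proof -
  have sub: "closure {x. q x \<noteq> 0} \<subseteq> K"
    using K by (intro closure_minimal) (auto intro: compact_imp_closed)
  then have "compact (closure {x. q x \<noteq> 0})"
    using K(1) by (metis closed_closure compact_Int_closed inf.absorb_iff2)
  moreover have "\<exists>q'. (\<forall>x. (q has_derivative blinfun_apply (q' x)) (at x)) \<and> continuous_on UNIV q'"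
  proof (intro exI[of _ "\<lambda>x. Blinfun (D x)"] conjI allI)
    have D: "blinfun_apply (Blinfun (D x)) = D x" for x
      using has_derivative_bounded_linear[OF der] by (rule bounded_linear_Blinfun_apply)
    show "(q has_derivative blinfun_apply (Blinfun (D x))) (at x)" for x
      using der by (simp add: D)
    show "continuous_on UNIV (\<lambda>x. Blinfun (D x))"
      by (rule continuous_on_blinfun_componentwise) (simp add: D cont)
  qed
  ultimately show ?thesis using sub K by (auto simp: C1_compact_def)
qed

lemma C1_compactE:
  fixes q :: "'a::euclidean_space \<Rightarrow> 'b::real_normed_vector"
  assumes "q \<in> C1_compact \<Omega>"
  obtains K where "compact K" "K \<subseteq> \<Omega>" "\<And>x. x \<notin> K \<Longrightarrow> q x = 0"
    "\<And>x. (q has_derivative frechet_derivative q (at x)) (at x)"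
    "\<And>h. continuous_on UNIV (\<lambda>x. frechet_derivative q (at x) h)"
    "\<And>x h. x \<notin> K \<Longrightarrow> frechet_derivative q (at x) h = 0"
proof -
  let ?K = "closure {x. q x \<noteq> 0}"
  obtain q' where q': "\<And>x. (q has_derivative blinfun_apply (q' x)) (at x)" "continuous_on UNIV q'"
    and K: "compact ?K" "?K \<subseteq> \<Omega>"
    using assms by (auto simp: C1_compact_def)
  have eq: "frechet_derivative q (at x) = blinfun_apply (q' x)" for x
    using frechet_derivative_at[OF q'(1)] by simp
  have zero: "q x = 0" if "x \<notin> ?K" for x
    using that closure_subset[of "{x. q x \<noteq> 0}"] by auto
  show thesis
  proof (rule that[OF K zero])
    show "(q has_derivative frechet_derivative q (at x)) (at x)" for x
      using q'(1) by (simp add: eq)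
    show "continuous_on UNIV (\<lambda>x. frechet_derivative q (at x) h)" for h
      unfolding eq by (intro continuous_intros q'(2))
    fix x h assume x: "x \<notin> ?K"
    have op: "open (- ?K)" and xK: "x \<in> - ?K" using x by auto
    have "0 = q y" if "y \<in> - ?K" for y
      using zero[of y] that unfolding Compl_iff by metis
    with has_derivative_const op xK have "(q has_derivative (\<lambda>_. 0)) (at x)"
      by (rule has_derivative_transform_within_open)
    then show "frechet_derivative q (at x) h = 0"
      using frechet_derivative_at by metis
  qed
qed

lemma lebesgue_on_integral_eq_lborel:
  fixes h :: "'a::euclidean_space \<Rightarrow> 'b::{banach,second_countable_topology}"
  assumes "open \<Omega>" "h \<in> borel_measurable borel" "\<And>x. x \<notin> \<Omega> \<Longrightarrow> h x = 0"
  shows "(LINT x|lebesgue_on \<Omega>. h x) = (LINT x|lborel. h x)"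
proof -
  have "(LINT x|lebesgue_on \<Omega>. h x) = (LINT x|lebesgue. indicator \<Omega> x *\<^sub>R h x)"
    using assms by (intro integral_restrict_space) auto
  also have "(\<lambda>x. indicator \<Omega> x *\<^sub>R h x) = h"
    using assms(3) by (auto simp: indicator_def)
  also have "(LINT x|lebesgue. h x) = (LINT x|lborel. h x)"
    using assms by (intro integral_completion) auto
  finally show ?thesis .
qed

lemma divergence_eq:
  assumes "(\<xi> has_derivative D) (at x)"
  shows "divergence \<xi> x = (\<Sum>j\<in>UNIV. D (axis j 1) $ j)"
  using frechet_derivative_at[OF assms] by (simp add: divergence_def)

lemma compact_supp_norm:
  assumes "compact (K :: 'a::euclidean_space set)"
  obtains r where "r > 0" "\<And>x. r < norm x \<Longrightarrow> x \<notin> K"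
  using compact_imp_bounded[OF assms] unfolding bounded_pos by (meson not_le)

lemma continuous_on_divergence:
  assumes "\<xi> \<in> C1_compact \<Omega>"
  shows "continuous_on UNIV (divergence \<xi>)"
proof -
  obtain K where "\<And>h. continuous_on UNIV (\<lambda>x. frechet_derivative \<xi> (at x) h)"
    using C1_compactE[OF assms] by metis
  then show ?thesis unfolding divergence_def[abs_def] by (intro continuous_intros)
qed

text \<open>
  \<open>D x (\<xi> x) + \<phi> x * divergence \<xi> x\<close> is the divergence of the compactly supported field \<open>\<phi> \<xi>\<close>,
  whose integral vanishes coordinate by coordinate.
\<close>

lemma integral_by_parts_divergence:
  fixes \<phi> :: "real^'d \<Rightarrow> real"
  assumes \<xi>: "\<xi> \<in> C1_compact \<Omega>"
    and der: "\<And>x. (\<phi> has_derivative D x) (at x)" and cont: "\<And>h. continuous_on UNIV (\<lambda>x. D x h)"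
  shows "integrable lborel (\<lambda>x. D x (\<xi> x))" "integrable lborel (\<lambda>x. \<phi> x * divergence \<xi> x)"
    "(LINT x|lborel. D x (\<xi> x)) = - (LINT x|lborel. \<phi> x * divergence \<xi> x)"
proof -
  obtain K where K: "compact K" "\<And>x. x \<notin> K \<Longrightarrow> \<xi> x = 0"
    and d\<xi>: "\<And>x. (\<xi> has_derivative frechet_derivative \<xi> (at x)) (at x)"
      "\<And>h. continuous_on UNIV (\<lambda>x. frechet_derivative \<xi> (at x) h)"
      "\<And>x h. x \<notin> K \<Longrightarrow> frechet_derivative \<xi> (at x) h = 0"
    using C1_compactE[OF \<xi>] by metis
  obtain r where r: "r > 0" "\<And>x. r < norm x \<Longrightarrow> x \<notin> K" using compact_supp_norm[OF K(1)] by metis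
  let ?E = "\<lambda>x. frechet_derivative \<xi> (at x)"
  have c\<phi>: "continuous_on UNIV \<phi>"
    using der by (meson continuous_at_imp_continuous_on has_derivative_continuous)
  have c\<xi>: "continuous_on UNIV \<xi>"
    using d\<xi>(1) by (meson continuous_at_imp_continuous_on has_derivative_continuous)
  let ?A = "\<lambda>j x. D x (axis j 1) * \<xi> x $ j" and ?B = "\<lambda>j x. \<phi> x * ?E x (axis j 1) $ j"
  have cA: "continuous_on UNIV (?A j)" and cB: "continuous_on UNIV (?B j)" for j
    by (intro continuous_intros c\<phi> c\<xi> cont d\<xi>)+
  have iA: "integrable lborel (?A j)" and iB: "integrable lborel (?B j)" for j
    by (rule integrable_compact_support[OF cA, where r=r], use r K d\<xi> in auto)
       (rule integrable_compact_support[OF cB, where r=r], use r K d\<xi> in auto)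
  have zero: "(LINT x|lborel. ?A j x + ?B j x) = 0" for j
  proof -
    have "((\<lambda>x. \<phi> x * \<xi> x $ j) has_derivative (\<lambda>h. \<phi> x * ?E x h $ j + D x h * \<xi> x $ j)) (at x)" for x
      by (rule has_derivative_mult[OF der bounded_linear.has_derivative[OF bounded_linear_vec_nth d\<xi>(1)]])
    from integral_derivative_zero[OF this, of "axis j 1" r]
    have "(LINT x|lborel. ?B j x + ?A j x) = 0"
      using continuous_on_add[OF cB[of j] cA[of j]] r(2) K(2) d\<xi>(3) by simp
    then show ?thesis by (simp only: add.commute)
  qed
  have DA: "D x (\<xi> x) = (\<Sum>j\<in>UNIV. ?A j x)" for x
  proof -
    have lin: "linear (D x)" using der has_derivative_linear by blast
    have "D x (\<xi> x) = D x (\<Sum>j\<in>UNIV. \<xi> x $ j *\<^sub>R axis j 1)"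
      using basis_expansion[of "\<xi> x"] by (simp add: scalar_mult_eq_scaleR)
    also have "\<dots> = (\<Sum>j\<in>UNIV. ?A j x)"
      by (simp add: linear_sum[OF lin] linear_cmul[OF lin] mult.commute)
    finally show ?thesis .
  qed
  have EB: "\<phi> x * divergence \<xi> x = (\<Sum>j\<in>UNIV. ?B j x)" for x
    by (simp add: divergence_def sum_distrib_left)
  show "integrable lborel (\<lambda>x. D x (\<xi> x))" unfolding DA by (intro Bochner_Integration.integrable_sum iA)
  show "integrable lborel (\<lambda>x. \<phi> x * divergence \<xi> x)" unfolding EB by (intro Bochner_Integration.integrable_sum iB)
  have "(\<Sum>j\<in>UNIV. (LINT x|lborel. ?A j x)) + (\<Sum>j\<in>UNIV. (LINT x|lborel. ?B j x)) = 0"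
    using zero iA iB by (simp add: sum.distrib[symmetric])
  then show "(LINT x|lborel. D x (\<xi> x)) = - (LINT x|lborel. \<phi> x * divergence \<xi> x)"
    unfolding DA EB using iA iB by simp
qed

lemma integral_divergence_zero:
  fixes \<xi> :: "real^'d \<Rightarrow> real^'d"
  assumes "\<xi> \<in> C1_compact \<Omega>"
  shows "(LINT x|lborel. divergence \<xi> x) = 0"
  using integral_by_parts_divergence(3)[OF assms, of "\<lambda>_. 1" "\<lambda>_ _. 0"] by simp

section \<open>Gluing test fields along a mollified function\<close>

text \<open>
  Mollifying a field that is only continuous makes it a \<open>C\<^sup>1\<close> test field: the derivative falls
  on the kernel, the support grows by at most \<open>\<epsilon>\<close>, and averaging respects the convex constraint
  on the values.
\<close>

lemma mollified_field_admissible: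
  fixes \<eta> :: "real^'d \<Rightarrow> real"
  assumes "mollifier \<eta> G \<epsilon>"
    and \<zeta>: "continuous_on UNIV \<zeta>" "compact K" "\<And>y. y \<notin> K \<Longrightarrow> \<zeta> y = 0" "\<And>y. dual_norm N (\<zeta> y) \<le> 1"
    and K: "\<And>y. y \<in> K \<Longrightarrow> cball y \<epsilon> \<subseteq> \<Omega>"
  defines "Z \<equiv> \<lambda>x. LINT y|lborel. \<eta> (x - y) *\<^sub>R \<zeta> y"
  shows "Z \<in> C1_compact \<Omega>" "dual_norm N (Z x) \<le> 1"
    "divergence Z x = (LINT y|lborel. G (x - y) \<bullet> \<zeta> y)"
proof -
  interpret mollifier \<eta> G \<epsilon> by fact
  obtain r where r: "r > 0" "\<And>x. r < norm x \<Longrightarrow> x \<notin> K" using compact_supp_norm[OF \<zeta>(2)] by metis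
  have i\<zeta>: "integrable lborel \<zeta>"
    by (rule integrable_compact_support[OF \<zeta>(1), where r=r]) (use r \<zeta> in auto)
  show "Z \<in> C1_compact \<Omega>"
  proof (rule C1_compactI)
    show "compact {y + z | y z. y \<in> K \<and> z \<in> cball 0 \<epsilon>}"
      by (rule compact_sums) (use \<zeta> in auto)
    show "{y + z | y z. y \<in> K \<and> z \<in> cball 0 \<epsilon>} \<subseteq> \<Omega>"
      using K by (force simp: dist_norm)
    fix x assume x: "x \<notin> {y + z | y z. y \<in> K \<and> z \<in> cball 0 \<epsilon>}"
    have "\<eta> (x - y) *\<^sub>R \<zeta> y = 0" for y
    proof (cases "y \<in> K")
      case True
      have "\<epsilon> < norm (x - y)"
      proof (rule ccontr)
        assume "\<not> \<epsilon> < norm (x - y)"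
        then have "x = y + (x - y) \<and> y \<in> K \<and> x - y \<in> cball 0 \<epsilon>" using True by auto
        with x show False by blast
      qed
      then show ?thesis using supp by simp
    qed (use \<zeta> in auto)
    then have "(\<lambda>y. \<eta> (x - y) *\<^sub>R \<zeta> y) = (\<lambda>y. 0)" by (rule ext)
    then show "Z x = 0" unfolding Z_def by (simp only: integral_zero)
  next
    show "(Z has_derivative (\<lambda>h. LINT y|lborel. (G (x - y) \<bullet> h) *\<^sub>R \<zeta> y)) (at x)" for x
      unfolding Z_def by (rule conv_has_derivative[OF i\<zeta>])
    show "continuous_on UNIV (\<lambda>x. LINT y|lborel. (G (x - y) \<bullet> h) *\<^sub>R \<zeta> y)" for h
      by (rule continuous_conv_deriv[OF i\<zeta>])
  qed
  have der: "(Z has_derivative (\<lambda>h. LINT y|lborel. (G (x - y) \<bullet> h) *\<^sub>R \<zeta> y)) (at x)"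
    unfolding Z_def by (rule conv_has_derivative[OF i\<zeta>])
  have comp: "(LINT y|lborel. (G (x - y) \<bullet> h) *\<^sub>R \<zeta> y) $ j = (LINT y|lborel. (G (x - y) \<bullet> h) * \<zeta> y $ j)" for h j
    using integral_bounded_linear[OF bounded_linear_vec_nth[of j] integrable_conv_deriv[OF i\<zeta>, of x h]] by simp
  have ic: "integrable lborel (\<lambda>y. (G (x - y) \<bullet> h) * \<zeta> y $ j)" for h j
    using integrable_bounded_linear[OF bounded_linear_vec_nth[of j] integrable_conv_deriv[OF i\<zeta>, of x h]] by simp
  show "divergence Z x = (LINT y|lborel. G (x - y) \<bullet> \<zeta> y)"
  proof -
    have ic': "integrable lborel (\<lambda>y. G (x - y) $ j * \<zeta> y $ j)" for j
      using ic[of "axis j 1" j] by (simp add: inner_axis)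
    have "divergence Z x = (\<Sum>j\<in>UNIV. LINT y|lborel. G (x - y) $ j * \<zeta> y $ j)"
      unfolding divergence_eq[OF der] comp by (simp add: inner_axis)
    also have "\<dots> = (LINT y|lborel. (\<Sum>j\<in>UNIV. G (x - y) $ j * \<zeta> y $ j))"
      by (rule Bochner_Integration.integral_sum[symmetric]) (rule ic')
    finally show ?thesis by (simp add: inner_vec_def)
  qed
  show "dual_norm N (Z x) \<le> 1"
    unfolding dual_norm_le_iff[OF zero_le_one]
  proof
    fix a :: "real^'d" assume a: "a \<in> dual_test N"
    have "a \<bullet> Z x = (LINT y|lborel. \<eta> (x - y) * (a \<bullet> \<zeta> y))"
      unfolding Z_def
      using integral_bounded_linear[OF bounded_linear_inner_right[of a] integrable_conv[OF i\<zeta>, of x]] by simp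
    also have "\<dots> \<le> (LINT y|lborel. \<eta> (x - y))"
    proof (rule integral_mono)
      show "integrable lborel (\<lambda>y. \<eta> (x - y) * (a \<bullet> \<zeta> y))"
        using integrable_bounded_linear[OF bounded_linear_inner_right[of a] integrable_conv[OF i\<zeta>, of x]] by simp
      fix y
      have "a \<bullet> \<zeta> y \<le> 1" using \<zeta>(4)[of y] a by (simp add: dual_norm_le_iff)
      then show "\<eta> (x - y) * (a \<bullet> \<zeta> y) \<le> \<eta> (x - y)"
        using mult_left_mono[OF _ nonneg] by fastforce
    qed (rule integrable_kernel_reflect)
    finally show "a \<bullet> Z x \<le> 1" by (simp add: integral_kernel_reflect)
  qed
qed

text \<open>
  The inner integral is the derivative of the mollified \<open>u\<close> at \<open>y\<close> in direction \<open>\<zeta> y\<close>. By Fubini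
  and the oddness of \<open>G\<close> the double integral equals \<open>- \<integral> u * divergence (\<eta> * \<zeta>)\<close>, which is one
  of the numbers in the supremum defining the total variation.
\<close>

lemma mollified_gradient_le_total_variation:
  fixes \<eta> :: "real^'d \<Rightarrow> real"
  assumes mol: "mollifier \<eta> G \<epsilon>"
    and \<zeta>: "continuous_on UNIV \<zeta>" "compact K" "\<And>y. y \<notin> K \<Longrightarrow> \<zeta> y = 0" "\<And>y. dual_norm N (\<zeta> y) \<le> 1"
    and K: "\<And>y. y \<in> K \<Longrightarrow> cball y \<epsilon> \<subseteq> \<Omega>"
    and \<Omega>: "open \<Omega>" "bounded \<Omega>"
    and u: "u \<in> borel_measurable borel" "\<And>x. x \<notin> \<Omega> \<Longrightarrow> u x = 0" "\<And>x. \<bar>u x\<bar> \<le> M"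
  shows "ereal (LINT y|lborel. (LINT x|lborel. (G (y - x) \<bullet> \<zeta> y) * u x)) \<le> total_variation N \<Omega> u"
proof -
  interpret mollifier \<eta> G \<epsilon> by fact
  define Z where "Z = (\<lambda>x. LINT y|lborel. \<eta> (x - y) *\<^sub>R \<zeta> y)"
  note Z = mollified_field_admissible[OF mol \<zeta> K, folded Z_def]
  obtain r where r: "r > 0" "\<And>x. r < norm x \<Longrightarrow> x \<notin> K" using compact_supp_norm[OF \<zeta>(2)] by metis
  obtain s where s: "s > 0" "\<And>x. x \<in> \<Omega> \<Longrightarrow> norm x \<le> s" using \<Omega>(2) unfolding bounded_pos by metis
  obtain B where B: "B \<ge> 0" "\<And>z. norm (G z) \<le> B" using bounds by metis
  obtain C where C: "C \<ge> 0" "\<And>y. norm (\<zeta> y) \<le> C"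
    using bounded_compact_support[OF \<zeta>(1), of r] r \<zeta>(3) by metis
  have M: "M \<ge> 0" using u(3)[of 0] by linarith
  have [measurable]: "\<zeta> \<in> borel_measurable borel" "u \<in> borel_measurable borel"
    using \<zeta>(1) u by (auto intro: borel_measurable_continuous_onI)
  have cdiv: "continuous_on UNIV (divergence Z)"
    by (rule continuous_on_divergence[OF Z(1)])
  then have [measurable]: "divergence Z \<in> borel_measurable borel"
    by (rule borel_measurable_continuous_onI)
  let ?f = "\<lambda>x y. u x * (G (x - y) \<bullet> \<zeta> y)"
  have int: "integrable (lborel \<Otimes>\<^sub>M lborel) (case_prod ?f)"
    unfolding lborel_prod
  proof (rule integrable_bounded_support[where r="r + s" and B="M * (B * C)"])
    show "case_prod ?f \<in> borel_measurable borel"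
      unfolding borel_prod[symmetric] by measurable
    fix p :: "(real^'d) \<times> (real^'d)"
    obtain x y where p: "p = (x, y)" by force
    show "case_prod ?f p = 0" if "r + s < norm p"
    proof -
      have "norm p \<le> norm x + norm y" unfolding p by (rule norm_Pair_le)
      then have "s < norm x \<or> r < norm y" using that by linarith
      then have "u x = 0 \<or> \<zeta> y = 0" using s(2)[of x] r(2)[of y] u(2)[of x] \<zeta>(3)[of y] by linarith
      then show ?thesis unfolding p by auto
    qed
    have "\<bar>G (x - y) \<bullet> \<zeta> y\<bar> \<le> B * C"
      by (rule order_trans[OF Cauchy_Schwarz_ineq2]) (intro mult_mono B C norm_ge_zero)
    then show "norm (case_prod ?f p) \<le> M * (B * C)"
      unfolding p using u(3)[of x] M by (auto simp: abs_mult intro!: mult_mono)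
  qed
  have "(LINT x|lebesgue_on \<Omega>. u x * divergence Z x) = (LINT x|lborel. u x * divergence Z x)"
    by (rule lebesgue_on_integral_eq_lborel[OF \<Omega>(1)]) (use u in auto)
  also have "\<dots> = (LINT x|lborel. (LINT y|lborel. ?f x y))"
    by (simp add: Z(3))
  also have "\<dots> = (LINT y|lborel. (LINT x|lborel. ?f x y))"
    by (rule lborel_pair.Fubini_integral[OF int, symmetric])
  also have "\<dots> = (LINT y|lborel. - (LINT x|lborel. (G (y - x) \<bullet> \<zeta> y) * u x))"
  proof (rule Bochner_Integration.integral_cong[OF refl])
    fix y
    have "?f x y = - ((G (y - x) \<bullet> \<zeta> y) * u x)" for x
      using odd_gradient[of "y - x"] by (simp add: mult.commute)
    then show "(LINT x|lborel. ?f x y) = - (LINT x|lborel. (G (y - x) \<bullet> \<zeta> y) * u x)" by simp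
  qed
  finally have "(LINT y|lborel. (LINT x|lborel. (G (y - x) \<bullet> \<zeta> y) * u x)) = - (LINT x|lebesgue_on \<Omega>. u x * divergence Z x)"
    by simp
  also have "ereal \<dots> \<le> total_variation N \<Omega> u"
    unfolding total_variation_def
  proof (rule SUP_upper)
    have "dual_norm N (Z x) \<le> 1" for x
      using mollified_field_admissible(2)[OF mol \<zeta> K] by (simp add: Z_def)
    then show "Z \<in> {\<xi> \<in> C1_compact \<Omega>. \<forall>x. dual_norm N (\<xi> x) \<le> 1}" using Z(1) by simp
  qed
  finally show ?thesis .
qed

lemma C1_compact_row:
  fixes q :: "real^'d \<Rightarrow> real^'d^'l"
  assumes "q \<in> C1_compact \<Omega>"
  shows "(\<lambda>y. q y $ i) \<in> C1_compact \<Omega>"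
proof -
  obtain K where K: "compact K" "K \<subseteq> \<Omega>" "\<And>x. x \<notin> K \<Longrightarrow> q x = 0"
    and d: "\<And>x. (q has_derivative frechet_derivative q (at x)) (at x)"
      "\<And>h. continuous_on UNIV (\<lambda>x. frechet_derivative q (at x) h)"
    using C1_compactE[OF assms] by metis
  show ?thesis
  proof (rule C1_compactI[OF K(1,2)])
    show "((\<lambda>y. q y $ i) has_derivative (\<lambda>h. frechet_derivative q (at x) h $ i)) (at x)" for x
      by (rule bounded_linear.has_derivative[OF bounded_linear_vec_nth d(1)])
    show "continuous_on UNIV (\<lambda>x. frechet_derivative q (at x) h $ i)" for h
      by (intro continuous_on_component d(2))
  qed (simp add: K)
qed

text \<open>
  The gluing step. With \<open>\<phi>\<close> the mollified \<open>u\<close>, the field \<open>\<zeta> = \<Sum>j. f j (\<phi> x) / c j * q j x\<close> has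
  dual norm at most \<open>\<Sum>j. f j (\<phi> x) \<le> 1\<close>, and \<open>\<nabla>\<phi> \<bullet> \<zeta>\<close> is the sum of the \<open>\<nabla>(F j \<circ> \<phi>) \<bullet> q j / c j\<close>
  by the chain rule, so that partial integration yields the divergences of the rows.
\<close>

lemma smooth_split_le_total_variation:
  fixes \<eta> :: "real^'d \<Rightarrow> real" and q :: "real^'d \<Rightarrow> real^'d^'l" and c :: "'l::finite \<Rightarrow> real"
  assumes mol: "mollifier \<eta> G \<epsilon>"
    and \<Omega>: "open \<Omega>" "bounded \<Omega>"
    and u: "u \<in> borel_measurable borel" "\<And>x. x \<notin> \<Omega> \<Longrightarrow> u x = 0" "\<And>x. \<bar>u x\<bar> \<le> M"
    and q: "q \<in> C1_compact \<Omega>" "\<And>x j. dual_norm N (q x $ j) \<le> c j" "\<And>j. c j > 0"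
    and K: "compact K" "\<And>y. y \<notin> K \<Longrightarrow> q y = 0" "\<And>y. y \<in> K \<Longrightarrow> cball y \<epsilon> \<subseteq> \<Omega>"
    and F: "\<And>j t. (F j has_real_derivative f j t) (at t)" "\<And>j. continuous_on UNIV (f j)"
      "\<And>j t. f j t \<ge> 0" "\<And>t. (\<Sum>j\<in>UNIV. f j t) \<le> 1"
  defines "\<phi> \<equiv> \<lambda>x. LINT y|lborel. \<eta> (x - y) * u y"
  shows "ereal (- (LINT x|lborel. (\<Sum>j\<in>UNIV. F j (\<phi> x) / c j * divergence (\<lambda>y. q y $ j) x)))
    \<le> total_variation N \<Omega> u"
    and "integrable lborel (\<lambda>x. F j (\<phi> x) / c j * divergence (\<lambda>y. q y $ j) x)"
proof -
  interpret mollifier \<eta> G \<epsilon> by fact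
  obtain s where s: "s > 0" "\<And>x. x \<in> \<Omega> \<Longrightarrow> norm x \<le> s" using \<Omega>(2) unfolding bounded_pos by metis
  have iu: "integrable lborel u"
    by (rule integrable_bounded_support[OF u(1), where r=s and B=M]) (use u s in \<open>auto simp: not_le[symmetric]\<close>)
  define D where "D x h = (LINT y|lborel. (G (x - y) \<bullet> h) * u y)" for x h
  have d\<phi>: "(\<phi> has_derivative D x) (at x)" for x
    using conv_has_derivative[OF iu, of x] unfolding \<phi>_def D_def[abs_def] by simp
  have cD: "continuous_on UNIV (\<lambda>x. D x h)" for h
    using continuous_conv_deriv[OF iu, of h] unfolding D_def by simp
  have c\<phi>: "continuous_on UNIV \<phi>"
    using d\<phi> by (meson continuous_at_imp_continuous_on has_derivative_continuous)
  have cf: "continuous_on UNIV (\<lambda>x. f j (\<phi> x))" for j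
    by (rule continuous_on_compose2[OF F(2) c\<phi>]) auto
  have dF: "((\<lambda>x. F j (\<phi> x) / c j) has_derivative (\<lambda>h. f j (\<phi> x) / c j * D x h)) (at x)" for j x
  proof -
    have "((\<lambda>x. F j (\<phi> x)) has_derivative (\<lambda>h. f j (\<phi> x) * D x h)) (at x)"
      using has_derivative_compose[OF d\<phi> F(1)[of j, unfolded has_field_derivative_def]] by simp
    from has_derivative_mult_right[OF this, of "1 / c j"] show ?thesis by simp
  qed
  have cont: "continuous_on UNIV (\<lambda>x. f j (\<phi> x) / c j * D x h)" for j h
    using q(3)[of j] by (intro continuous_intros cf cD) auto
  note row = C1_compact_row[OF q(1)]
  note ibp = integral_by_parts_divergence[OF row dF cont]
  show "integrable lborel (\<lambda>x. F j (\<phi> x) / c j * divergence (\<lambda>y. q y $ j) x)"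
    by (rule ibp(2))
  define \<zeta> where "\<zeta> x = (\<Sum>j\<in>UNIV. (f j (\<phi> x) / c j) *\<^sub>R (q x $ j))" for x
  obtain q' where "\<And>x. (q has_derivative q' x) (at x)" using C1_compactE[OF q(1)] by metis
  then have cq: "continuous_on UNIV q"
    by (meson continuous_at_imp_continuous_on has_derivative_continuous)
  have c\<zeta>: "continuous_on UNIV \<zeta>"
    unfolding \<zeta>_def using q(3) by (intro continuous_intros cf cq) (auto simp: less_imp_neq[symmetric])
  have \<zeta>1: "dual_norm N (\<zeta> x) \<le> 1" for x
    unfolding dual_norm_le_iff[OF zero_le_one]
  proof
    fix a :: "real^'d" assume a: "a \<in> dual_test N"
    have "a \<bullet> \<zeta> x = (\<Sum>j\<in>UNIV. f j (\<phi> x) / c j * (a \<bullet> (q x $ j)))"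
      unfolding \<zeta>_def by (simp add: inner_sum_right)
    also have "\<dots> \<le> (\<Sum>j\<in>UNIV. f j (\<phi> x) / c j * c j)"
    proof (intro sum_mono mult_left_mono)
      fix j
      show "a \<bullet> (q x $ j) \<le> c j"
        using q(2)[of x j] q(3)[of j] a by (simp add: dual_norm_le_iff)
      show "0 \<le> f j (\<phi> x) / c j" using F(3)[of j "\<phi> x"] q(3)[of j] by simp
    qed
    also have "\<dots> = (\<Sum>j\<in>UNIV. f j (\<phi> x))"
      using q(3) by (intro sum.cong) (auto simp: less_imp_neq[symmetric])
    also have "\<dots> \<le> 1" by (rule F(4))
    finally show "a \<bullet> \<zeta> x \<le> 1" .
  qed
  have D\<zeta>: "D x (\<zeta> x) = (\<Sum>j\<in>UNIV. f j (\<phi> x) / c j * D x (q x $ j))" for x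
  proof -
    have lin: "linear (D x)" using d\<phi> has_derivative_linear by blast
    show ?thesis unfolding \<zeta>_def by (simp add: linear_sum[OF lin] linear_cmul[OF lin])
  qed
  have "- (LINT x|lborel. (\<Sum>j\<in>UNIV. F j (\<phi> x) / c j * divergence (\<lambda>y. q y $ j) x))
    = (\<Sum>j\<in>UNIV. - (LINT x|lborel. F j (\<phi> x) / c j * divergence (\<lambda>y. q y $ j) x))"
    using ibp(2) by (simp add: sum_negf)
  also have "\<dots> = (\<Sum>j\<in>UNIV. LINT x|lborel. f j (\<phi> x) / c j * D x (q x $ j))"
    by (simp only: ibp(3))
  also have "\<dots> = (LINT x|lborel. D x (\<zeta> x))"
    unfolding D\<zeta> using ibp(1) by (intro Bochner_Integration.integral_sum[symmetric]) simp
  also have "ereal \<dots> \<le> total_variation N \<Omega> u"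
    unfolding D_def
  proof (rule mollified_gradient_le_total_variation[OF mol c\<zeta> K(1) _ \<zeta>1 K(3) \<Omega> u])
    show "\<zeta> y = 0" if "y \<notin> K" for y using K(2)[OF that] by (simp add: \<zeta>_def)
  qed
  finally show "ereal (- (LINT x|lborel. (\<Sum>j\<in>UNIV. F j (\<phi> x) / c j * divergence (\<lambda>y. q y $ j) x)))
    \<le> total_variation N \<Omega> u" .
qed

text \<open>
  A \<open>C\<^sup>1\<close> approximation from below of the positive part: its derivative \<open>ramp_slope\<close> grows
  linearly from 0 to 1 on \<open>[0, \<delta>]\<close>.
\<close>

definition ramp :: "real \<Rightarrow> real \<Rightarrow> real" where
  "ramp \<delta> t = ((max 0 t)\<^sup>2 - (max 0 (t - \<delta>))\<^sup>2) / (2 * \<delta>)"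

definition ramp_slope :: "real \<Rightarrow> real \<Rightarrow> real" where
  "ramp_slope \<delta> t = (max 0 t - max 0 (t - \<delta>)) / \<delta>"

lemma ramp_derivative: "(ramp \<delta> has_real_derivative ramp_slope \<delta> t) (at t)"
proof -
  have sq: "((\<lambda>s::real. (max 0 s)\<^sup>2) has_real_derivative (2 * max 0 s)) (at s)" for s
    using has_derivative_square_max[of s] by (simp add: has_field_derivative_def)
  have "((\<lambda>t. (max 0 (t - \<delta>))\<^sup>2) has_real_derivative (2 * max 0 (t - \<delta>)) * 1) (at t)"
    by (rule DERIV_chain2[OF sq]) (auto intro!: derivative_eq_intros)
  from DERIV_cdivide[OF DERIV_diff[OF sq[of t] this], of "2 * \<delta>"]
  have "(ramp \<delta> has_real_derivative (2 * max 0 t - 2 * max 0 (t - \<delta>) * 1) / (2 * \<delta>)) (at t)"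
    unfolding ramp_def[abs_def] .
  also have "(2 * max 0 t - 2 * max 0 (t - \<delta>) * 1) / (2 * \<delta>) = ramp_slope \<delta> t"
    unfolding ramp_slope_def by (simp add: diff_divide_distrib)
  finally show ?thesis .
qed

lemma ramp_slope_bounds: "\<delta> > 0 \<Longrightarrow> 0 \<le> ramp_slope \<delta> t" "\<delta> > 0 \<Longrightarrow> ramp_slope \<delta> t \<le> 1"
  by (auto simp: ramp_slope_def max_def)

lemma ramp_slope_mono: "\<delta> > 0 \<Longrightarrow> s \<le> t \<Longrightarrow> ramp_slope \<delta> s \<le> ramp_slope \<delta> t"
  unfolding ramp_slope_def by (intro divide_right_mono) (auto simp: max_def)

lemma ramp_approx:
  assumes "\<delta> > 0"
  shows "max 0 t - \<delta> \<le> ramp \<delta> t" "ramp \<delta> t \<le> max 0 t"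
proof -
  have "max 0 t - \<delta> \<le> ramp \<delta> t \<and> ramp \<delta> t \<le> max 0 t"
  proof -
    consider "t \<le> 0" | "0 < t" "t \<le> \<delta>" | "\<delta> < t" by linarith
    then show ?thesis
    proof cases
      case 1 then show ?thesis using assms by (simp add: ramp_def)
    next
      case 2
      have "t * t \<le> t * (2 * \<delta>)" using 2 by (intro mult_left_mono) auto
      then have "ramp \<delta> t \<le> t" using 2 assms by (simp add: ramp_def power2_eq_square divide_le_eq)
      moreover have "ramp \<delta> t \<ge> 0" using 2 assms by (simp add: ramp_def)
      ultimately show ?thesis using 2 by simp
    next
      case 3
      have "ramp \<delta> t = t - \<delta> / 2" using 3 assms by (simp add: ramp_def power2_eq_square field_simps)
      then show ?thesis using 3 assms by simp
    qed
  qed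
  then show "max 0 t - \<delta> \<le> ramp \<delta> t" "ramp \<delta> t \<le> max 0 t" by auto
qed

section \<open>Labels and the lifting map\<close>

lemma pos_less: "i < j \<Longrightarrow> pos i < pos (j :: 'l::{finite,linorder})"
  unfolding pos_def
proof (rule psubset_card_mono)
  assume "i < j"
  then have "j \<in> {k. k \<le> j} - {k. k \<le> i}" by auto
  with \<open>i < j\<close> show "{k. k \<le> i} \<subset> {k. k \<le> j}" by auto
qed simp

lemma bij_betw_pos: "bij_betw pos (UNIV :: 'l::{finite,linorder} set) {1..CARD('l)}"
proof -
  have inj: "inj (pos :: 'l \<Rightarrow> nat)"
    by (rule linorder_injI) (metis pos_less less_irrefl)
  have "pos j \<in> {1..CARD('l)}" for j :: 'l
  proof -
    have "{i. i \<le> j} \<noteq> {}" by auto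
    then have "pos j \<ge> 1" by (simp add: pos_def Suc_le_eq card_gt_0_iff)
    moreover have "pos j \<le> CARD('l)" unfolding pos_def by (rule card_mono) auto
    ultimately show ?thesis by simp
  qed
  then have "range (pos :: 'l \<Rightarrow> nat) = {1..CARD('l)}"
    using inj by (intro card_subset_eq) (auto simp: card_image)
  then show ?thesis using inj by (simp add: bij_betw_def)
qed

lemma pos_bounds: "1 \<le> pos (j :: 'l::{finite,linorder})" "pos j \<le> CARD('l)"
  using bij_betwE[OF bij_betw_pos] by auto

lemma sum_pos_telescope:
  fixes h :: "nat \<Rightarrow> real"
  shows "(\<Sum>j\<in>UNIV. h (pos (j :: 'l::{finite,linorder})) - h (pos j + 1)) = h 1 - h (CARD('l) + 1)"
proof -
  have "(\<Sum>j\<in>UNIV. h (pos (j :: 'l)) - h (pos j + 1)) = (\<Sum>k=1..CARD('l). h k - h (k + 1))"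
    by (rule sum.reindex_bij_betw[OF bij_betw_pos])
  also have "\<dots> = - (\<Sum>k=1..CARD('l). h (Suc k) - h k)"
    by (simp add: sum_negf[symmetric])
  also have "\<dots> = h 1 - h (CARD('l) + 1)"
    by (subst sum_Suc_diff) auto
  finally show ?thesis .
qed

lemma label_gap_pos:
  assumes "strict_mono_on {1..CARD('l) + 1} \<gamma>"
  shows "\<gamma> (pos (j :: 'l::{finite,linorder})) < \<gamma> (pos j + 1)"
  using pos_bounds[of j] by (intro strict_mono_onD[OF assms]) auto

text \<open>
  The \<open>j\<close>-th component is the normalised length of the part of \<open>[\<gamma> 1, t]\<close> that lies in the
  \<open>j\<close>-th label interval. On \<open>\<Gamma>\<close> this is the inverse of \<open>unlift\<close> restricted to the
  sublabel-integral vectors; writing it with positive parts makes it continuous on the whole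
  line and shows the truncations of \<open>t\<close>.
\<close>

definition lift :: "(nat \<Rightarrow> real) \<Rightarrow> real \<Rightarrow> real^'l::{finite,linorder}" where
  "lift \<gamma> t = (\<chi> j. (max 0 (t - \<gamma> (pos j)) - max 0 (t - \<gamma> (pos j + 1))) / (\<gamma> (pos j + 1) - \<gamma> (pos j)))"

lemma sublabel_between:
  assumes \<gamma>: "strict_mono_on {1..CARD('l::{finite,linorder}) + 1} \<gamma>" and "i \<in> {1..CARD('l)}" "\<alpha> \<in> {0..1}"
  shows "\<gamma> i \<le> sublabel \<gamma> i \<alpha>" "sublabel \<gamma> i \<alpha> \<le> \<gamma> (i + 1)"
    "sublabel \<gamma> i \<alpha> \<in> {\<gamma> 1..\<gamma> (CARD('l) + 1)}"
proof -
  have g: "\<gamma> i < \<gamma> (i + 1)" using assms by (intro strict_mono_onD[OF \<gamma>]) auto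
  show 1: "\<gamma> i \<le> sublabel \<gamma> i \<alpha>" using g assms by (simp add: sublabel_def)
  have "\<alpha> * (\<gamma> (i + 1) - \<gamma> i) \<le> 1 * (\<gamma> (i + 1) - \<gamma> i)" using g assms by (intro mult_right_mono) auto
  then show 2: "sublabel \<gamma> i \<alpha> \<le> \<gamma> (i + 1)" by (simp add: sublabel_def)
  have "\<gamma> 1 \<le> \<gamma> i" "\<gamma> (i + 1) \<le> \<gamma> (CARD('l) + 1)"
    using assms by (auto intro!: strict_mono_on_leD[OF \<gamma>])
  then show "sublabel \<gamma> i \<alpha> \<in> {\<gamma> 1..\<gamma> (CARD('l) + 1)}" using 1 2 by simp
qed

lemma exists_sublabel:
  assumes \<gamma>: "strict_mono_on {1..CARD('l::{finite,linorder}) + 1} \<gamma>"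
    and t: "t \<in> {\<gamma> 1..\<gamma> (CARD('l) + 1)}"
  obtains i \<alpha> where "i \<in> {1..CARD('l)}" "\<alpha> \<in> {0..1}" "t = sublabel \<gamma> i \<alpha>"
proof -
  define I where "I = {i \<in> {1..CARD('l)}. \<gamma> i \<le> t}"
  have I: "finite I" "1 \<in> I" using t by (auto simp: I_def Suc_le_eq)
  define i where "i = Max I"
  have "i \<in> I" unfolding i_def using Max_in[OF I(1)] I(2) by blast
  then have i: "i \<in> {1..CARD('l)}" "\<gamma> i \<le> t" by (auto simp: I_def)
  have le: "t \<le> \<gamma> (i + 1)"
  proof (cases "i = CARD('l)")
    case False
    then have "i + 1 \<in> {1..CARD('l)}" using i by auto
    moreover have "i + 1 \<notin> I" using Max_ge[OF I(1), of "i + 1"] by (auto simp: i_def)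
    ultimately show ?thesis by (auto simp: I_def)
  qed (use t in auto)
  have g: "\<gamma> i < \<gamma> (i + 1)" using i by (intro strict_mono_onD[OF \<gamma>]) auto
  show thesis
    by (rule that[of i "(t - \<gamma> i) / (\<gamma> (i + 1) - \<gamma> i)"]) (use i le g in \<open>auto simp: sublabel_def\<close>)
qed

lemma lift_sublabel:
  assumes \<gamma>: "strict_mono_on {1..CARD('l::{finite,linorder}) + 1} \<gamma>" and i: "i \<in> {1..CARD('l)}" and \<alpha>: "\<alpha> \<in> {0..1}"
  shows "lift \<gamma> (sublabel \<gamma> i \<alpha>) = (lifted_sublabel i \<alpha> :: real^'l::{finite,linorder})"
  unfolding vec_eq_iff
proof
  fix j :: 'l
  let ?t = "sublabel \<gamma> i \<alpha>"
  note b = sublabel_between[OF \<gamma> i \<alpha>]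
  note g = label_gap_pos[OF \<gamma>, of j]
  note p = pos_bounds[of j]
  consider "pos j < i" | "pos j = i" | "i < pos j" by linarith
  then show "lift \<gamma> ?t $ j = (lifted_sublabel i \<alpha> :: real^'l::{finite,linorder}) $ j"
  proof cases
    case 1
    then have "\<gamma> (pos j + 1) \<le> \<gamma> i" using i by (intro strict_mono_on_leD[OF \<gamma>]) auto
    then show ?thesis using 1 b g i by (simp add: lift_def lifted_sublabel_def ones_def max_def)
  next
    case 2
    have "max 0 (?t - \<gamma> i) = \<alpha> * (\<gamma> (i + 1) - \<gamma> i)" "max 0 (?t - \<gamma> (i + 1)) = 0" "\<not> i \<le> i - 1"
      using b i by (auto simp: sublabel_def)
    then show ?thesis using 2 g by (simp add: lift_def lifted_sublabel_def ones_def)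
  next
    case 3
    then have "\<gamma> (i + 1) \<le> \<gamma> (pos j)" using i p by (intro strict_mono_on_leD[OF \<gamma>]) auto
    then have "max 0 (?t - \<gamma> (pos j)) = 0" "max 0 (?t - \<gamma> (pos j + 1)) = 0" "\<not> pos j \<le> i - 1"
      using b g 3 by auto
    then show ?thesis using 3 by (simp add: lift_def lifted_sublabel_def ones_def)
  qed
qed

lemma lift_mem_lifted_labels:
  assumes \<gamma>: "strict_mono_on {1..CARD('l::{finite,linorder}) + 1} \<gamma>" and t: "t \<in> {\<gamma> 1..\<gamma> (CARD('l) + 1)}"
  shows "lift \<gamma> t \<in> (lifted_labels :: (real^'l::{finite,linorder}) set)"
proof -
  obtain i \<alpha> where "i \<in> {1..CARD('l)}" "\<alpha> \<in> {0..1}" "t = sublabel \<gamma> i \<alpha>"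
    using exists_sublabel[OF \<gamma> t] by metis
  then show ?thesis using lift_sublabel[OF \<gamma>] unfolding lifted_labels_def by blast
qed

lemma unlift_lift:
  assumes \<gamma>: "strict_mono_on {1..CARD('l::{finite,linorder}) + 1} \<gamma>" and t: "t \<in> {\<gamma> 1..\<gamma> (CARD('l) + 1)}"
  shows "unlift \<gamma> (lift \<gamma> t :: real^'l::{finite,linorder}) = t"
proof -
  have "(lift \<gamma> t :: real^'l::{finite,linorder}) $ j * (\<gamma> (pos j + 1) - \<gamma> (pos j)) = max 0 (t - \<gamma> (pos j)) - max 0 (t - \<gamma> (pos j + 1))" for j
    using label_gap_pos[OF \<gamma>, of j] by (simp add: lift_def)
  then have "unlift \<gamma> (lift \<gamma> t :: real^'l::{finite,linorder}) = \<gamma> 1 + (max 0 (t - \<gamma> 1) - max 0 (t - \<gamma> (CARD('l) + 1)))"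
    unfolding unlift_def using sum_pos_telescope[of "\<lambda>k. max 0 (t - \<gamma> k)", where 'l='l] by simp
  then show ?thesis using t by simp
qed

text \<open>
  Together with \<open>lift_mem_lifted_labels\<close> and \<open>unlift_lift\<close>: lifting is a bijection between \<open>\<Gamma>\<close>
  and the sublabel-integral vectors.
\<close>

lemma lifted_labels_cases:
  assumes \<gamma>: "strict_mono_on {1..CARD('l::{finite,linorder}) + 1} \<gamma>" and v: "v \<in> (lifted_labels :: (real^'l::{finite,linorder}) set)"
  shows "unlift \<gamma> v \<in> {\<gamma> 1..\<gamma> (CARD('l) + 1)}" "lift \<gamma> (unlift \<gamma> v) = v"
proof -
  obtain i \<alpha> where i: "i \<in> {1..CARD('l)}" "\<alpha> \<in> {0..1}" and v: "v = lifted_sublabel i \<alpha>"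
    using v unfolding lifted_labels_def by blast
  have v: "v = lift \<gamma> (sublabel \<gamma> i \<alpha>)" using lift_sublabel[OF \<gamma> i] v by simp
  have "unlift \<gamma> v = sublabel \<gamma> i \<alpha>"
    unfolding v by (rule unlift_lift[OF \<gamma> sublabel_between(3)[OF \<gamma> i]])
  then show "unlift \<gamma> v \<in> {\<gamma> 1..\<gamma> (CARD('l) + 1)}" "lift \<gamma> (unlift \<gamma> v) = v"
    using sublabel_between(3)[OF \<gamma> i] v by auto
qed

lemma unlift_eq_inner: "unlift \<gamma> v = \<gamma> 1 + label_gaps \<gamma> \<bullet> v"
  by (simp add: unlift_def label_gaps_def inner_vec_def mult.commute)

lemma lift_component_bounds:
  assumes \<gamma>: "strict_mono_on {1..CARD('l::{finite,linorder}) + 1} \<gamma>"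
  shows "0 \<le> (lift \<gamma> t :: real^'l::{finite,linorder}) $ j" "(lift \<gamma> t :: real^'l::{finite,linorder}) $ j \<le> 1"
  using label_gap_pos[OF \<gamma>, of j] by (auto simp: lift_def max_def)

lemma borel_measurable_lift [measurable]: "lift \<gamma> \<in> borel_measurable borel"
proof (rule borel_measurable_continuous_onI)
  show "continuous_on UNIV (lift \<gamma>)"
    unfolding lift_def[abs_def] divide_inverse by (intro continuous_intros)
qed

lemma borel_measurable_unlift [measurable]: "unlift \<gamma> \<in> borel_measurable borel"
  unfolding unlift_def[abs_def] by measurable

section \<open>Total variation of lifted functions\<close>

lemma row_divergence_inner:
  "v \<bullet> row_divergence q x = (\<Sum>j\<in>UNIV. v $ j * divergence (\<lambda>y. q y $ j) x)"
  by (simp add: row_divergence_def inner_vec_def)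

lemma divergence_zero_outside:
  assumes "\<xi> \<in> C1_compact \<Omega>" "x \<notin> \<Omega>" shows "divergence \<xi> x = 0"
  using C1_compactE[OF assms(1)] assms(2) unfolding divergence_def by (metis (no_types, lifting) subsetD sum.neutral zero_index)

text \<open>
  For a lifted test field \<open>q\<close>, the pairing with \<open>lift \<circ> u\<close> involves the truncations \<open>T j\<close> of
  \<open>u\<close>. Replacing \<open>T j\<close> by differences \<open>F j\<close> of ramps and \<open>u\<close> by a mollification \<open>\<phi>\<close> puts the
  pairing in reach of \<open>smooth_split_le_total_variation\<close>; the slopes \<open>f j\<close> telescope to at most
  1. One parameter \<open>d\<close> controls both replacements, as
  \<open>\<bar>F j (\<phi> x) - T j (u x)\<bar> \<le> \<bar>\<phi> x - u x\<bar> + d\<close>.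
\<close>

lemma lifted_total_variation_lift_le_borel:
  fixes u :: "real^'d \<Rightarrow> real"
  assumes \<Omega>: "open \<Omega>" "bounded \<Omega>"
    and u: "u \<in> borel_measurable borel" "\<And>x. x \<notin> \<Omega> \<Longrightarrow> u x = 0" "\<And>x. \<bar>u x\<bar> \<le> M"
    and \<gamma>: "strict_mono_on {1..CARD('l::{finite,linorder}) + 1} \<gamma>"
  shows "lifted_total_variation N \<Omega> \<gamma> (\<lambda>x. lift \<gamma> (u x) :: real^'l::{finite,linorder}) \<le> total_variation N \<Omega> u"
  unfolding lifted_total_variation_def
proof (rule SUP_least)
  fix q :: "real^'d \<Rightarrow> real^'d^'l::{finite,linorder}"
  assume "q \<in> {q \<in> C1_compact \<Omega>. \<forall>x. q x \<in> lifted_dual_set N \<gamma>}"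
  then have q: "q \<in> C1_compact \<Omega>" "\<And>x. q x \<in> lifted_dual_set N \<gamma>" by auto
  define c :: "'l \<Rightarrow> real" where "c j = \<gamma> (pos j + 1) - \<gamma> (pos j)" for j
  define b where "b j = divergence (\<lambda>y. q y $ j)" for j
  define T where "T j t = max 0 (t - \<gamma> (pos j)) - max 0 (t - \<gamma> (pos j + 1))" for j :: 'l and t
  have c: "c j > 0" for j using label_gap_pos[OF \<gamma>, of j] by (simp add: c_def)
  have qc: "dual_norm N (q x $ j) \<le> c j" for x j
    using q(2)[of x] by (simp add: lifted_dual_set_def c_def)
  note row = C1_compact_row[OF q(1)]
  have cb: "continuous_on UNIV (b j)" for j unfolding b_def by (rule continuous_on_divergence[OF row])
  have b\<Omega>: "b j x = 0" if "x \<notin> \<Omega>" for j x unfolding b_def by (rule divergence_zero_outside[OF row that])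
  have mb [measurable]: "b j \<in> borel_measurable borel" for j
    using cb by (rule borel_measurable_continuous_onI)
  have mu [measurable]: "u \<in> borel_measurable borel" by (rule u)
  obtain s where s: "s > 0" "\<And>x. x \<in> \<Omega> \<Longrightarrow> norm x \<le> s" using \<Omega>(2) unfolding bounded_pos by metis
  have us: "u x = 0" if "s < norm x" for x using u(2)[of x] s(2)[of x] that by linarith
  have bs: "b j x = 0" if "s < norm x" for j x using b\<Omega>[of x j] s(2)[of x] that by linarith
  have iu: "integrable lborel u"
    by (rule integrable_bounded_support[OF u(1) us u(3)[folded real_norm_def]])
  have ib: "integrable lborel (b j)" for j by (rule integrable_compact_support[OF cb bs])
  have "\<exists>C. \<forall>x. \<bar>b j x\<bar> \<le> C" for j
    using bounded_compact_support[OF cb bs] by (metis real_norm_def)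
  then obtain C where C: "\<And>j x. \<bar>b j x\<bar> \<le> C j" by metis
  have C0: "C j \<ge> 0" for j using C[of j 0] by linarith
  have Tb: "T j t \<ge> 0" "T j t \<le> c j" for j t using c[of j] by (auto simp: T_def c_def max_def)
  have mT [measurable]: "T j \<in> borel_measurable borel" for j unfolding T_def[abs_def] by measurable
  have iT: "integrable lborel (\<lambda>x. T j (u x) / c j * b j x)" for j
    using integrable_bounded_scaleR[of "\<lambda>x. T j (u x) / c j" 1 "b j"] ib Tb c[of j] by (simp add: divide_le_eq)
  obtain K where K: "compact K" "K \<subseteq> \<Omega>" "\<And>x. x \<notin> K \<Longrightarrow> q x = 0"
    using C1_compactE[OF q(1)] by metis
  obtain \<epsilon>0 where \<epsilon>0: "\<epsilon>0 > 0" "(\<Union>x\<in>K. cball x \<epsilon>0) \<subseteq> \<Omega>"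
    using compact_subset_open_imp_cball_epsilon_subset[OF K(1) \<Omega>(1) K(2)] by metis
  define A where "A = - (LINT x|lborel. (\<Sum>j\<in>UNIV. T j (u x) / c j * b j x))"
  define V where "V = measure lborel (cball 0 s :: (real^'d) set)"
  define B where "B = (\<Sum>j\<in>UNIV. C j / c j) * (1 + V)"
  have fin: "emeasure lborel (cball 0 s :: (real^'d) set) < \<infinity>" by (intro emeasure_bounded_finite) auto
  have SC: "(\<Sum>j\<in>UNIV. C j / c j) \<ge> 0" using C0 c by (intro sum_nonneg divide_nonneg_pos) auto
  have B: "B \<ge> 0" unfolding B_def using SC by (intro mult_nonneg_nonneg) (auto simp: V_def)
  have approx: "\<exists>a. ereal a \<le> total_variation N \<Omega> u \<and> \<bar>a - A\<bar> \<le> B * d" if d: "d > 0" for d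
  proof -
    have "\<exists>d1>0. \<forall>\<epsilon> \<eta> G. \<epsilon> \<le> d1 \<longrightarrow> mollifier \<eta> G \<epsilon> \<longrightarrow>
      (LINT x|lborel. \<bar>(LINT y|lborel. \<eta> (x - y) * u y) - u x\<bar>) \<le> d"
      by (rule mollification_L1_convergence[OF u(1) us u(3) d]) blast+
    then obtain d1 where d1: "d1 > 0" "\<And>\<epsilon> \<eta> G. \<epsilon> \<le> d1 \<Longrightarrow> mollifier \<eta> G \<epsilon> \<Longrightarrow>
      (LINT x|lborel. \<bar>(LINT y|lborel. \<eta> (x - y) * u y) - u x\<bar>) \<le> d" by blast
    \<comment> \<open>Small enough for the \<open>L\<^sup>1\<close> error and for the mollified field to stay supported in \<open>\<Omega>\<close>.\<close>
    define \<epsilon> where "\<epsilon> = min d1 \<epsilon>0"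
    have \<epsilon>: "\<epsilon> > 0" "\<epsilon> \<le> d1" "\<epsilon> \<le> \<epsilon>0" using d1 \<epsilon>0 by (auto simp: \<epsilon>_def)
    obtain \<eta> :: "real^'d \<Rightarrow> real" and G where "mollifier \<eta> G \<epsilon>"
      using mollifier_exists[OF \<epsilon>(1), where 'a="real^'d"] by metis
    then interpret mollifier \<eta> G \<epsilon> by simp
    have mol: "mollifier \<eta> G \<epsilon>" by unfold_locales
    define \<phi> where "\<phi> = (\<lambda>x. LINT y|lborel. \<eta> (x - y) * u y)"
    have L1: "(LINT x|lborel. \<bar>\<phi> x - u x\<bar>) \<le> d" unfolding \<phi>_def by (rule d1(2)[OF \<epsilon>(2) mol])
    have i\<phi>: "integrable lborel (\<lambda>x. \<bar>\<phi> x - u x\<bar>)"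
      using conv_L1_contraction(1)[OF iu] iu unfolding \<phi>_def by simp
    define F where "F j t = ramp d (t - \<gamma> (pos j)) - ramp d (t - \<gamma> (pos j + 1))" for j :: 'l and t
    define f where "f j t = ramp_slope d (t - \<gamma> (pos j)) - ramp_slope d (t - \<gamma> (pos j + 1))" for j :: 'l and t
    have dF: "(F j has_real_derivative f j t) (at t)" for j t
    proof -
      have "((\<lambda>t. ramp d (t - k)) has_real_derivative ramp_slope d (t - k) * 1) (at t)" for k
        by (rule DERIV_chain2[OF ramp_derivative]) (auto intro!: derivative_eq_intros)
      from DERIV_diff[OF this this] show ?thesis unfolding F_def[abs_def] f_def by simp
    qed
    have cf: "continuous_on UNIV (f j)" for j
      unfolding f_def[abs_def] ramp_slope_def divide_inverse by (intro continuous_intros)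
    have f0: "f j t \<ge> 0" for j t
      using ramp_slope_mono[OF d, of "t - \<gamma> (pos j + 1)" "t - \<gamma> (pos j)"] c[of j] by (simp add: f_def c_def)
    have f1: "f j t \<le> 1" for j t
      using ramp_slope_bounds[OF d, of "t - \<gamma> (pos j)"] ramp_slope_bounds[OF d, of "t - \<gamma> (pos j + 1)"]
      by (simp add: f_def)
    have fs: "(\<Sum>j\<in>UNIV. f j t) \<le> 1" for t
      unfolding f_def sum_pos_telescope[of "\<lambda>k. ramp_slope d (t - \<gamma> k)"]
      using ramp_slope_bounds[OF d, of "t - \<gamma> 1"] ramp_slope_bounds[OF d, of "t - \<gamma> (CARD('l) + 1)"] by linarith
    have lip: "\<bar>F j x - F j y\<bar> \<le> \<bar>x - y\<bar>" for j x y
      using field_differentiable_bound[of UNIV "F j" "f j" 1 x y] dF f0 f1 by (simp add: abs_le_iff)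
    have FT: "\<bar>F j t - T j t\<bar> \<le> d" for j t
      using ramp_approx[OF d, of "t - \<gamma> (pos j)"] ramp_approx[OF d, of "t - \<gamma> (pos j + 1)"]
      unfolding F_def T_def by linarith
    have KK: "\<And>y. y \<in> K \<Longrightarrow> cball y \<epsilon> \<subseteq> \<Omega>" using \<epsilon>0(2) \<epsilon>(3) by (fastforce simp: dist_norm)
    note split = smooth_split_le_total_variation[OF mol \<Omega> u q(1) qc c K(1) K(3) KK dF cf f0 fs]
    define a where "a = - (LINT x|lborel. (\<Sum>j\<in>UNIV. F j (\<phi> x) / c j * b j x))"
    have "ereal a \<le> total_variation N \<Omega> u" unfolding a_def b_def \<phi>_def by (rule split(1))
    moreover have "\<bar>a - A\<bar> \<le> B * d"
    proof -
      let ?g = "\<lambda>x. (\<Sum>j\<in>UNIV. C j / c j) * (\<bar>\<phi> x - u x\<bar> + d * indicator (cball 0 s) x)"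
      have ind: "integrable lborel (\<lambda>x::real^'d. d * indicator (cball 0 s) x)" using fin by simp
      have i1: "integrable lborel (\<lambda>x. \<Sum>j\<in>UNIV. F j (\<phi> x) / c j * b j x)"
        unfolding b_def \<phi>_def by (intro Bochner_Integration.integrable_sum split(2))
      have i2: "integrable lborel (\<lambda>x. \<Sum>j\<in>UNIV. T j (u x) / c j * b j x)"
        by (intro Bochner_Integration.integrable_sum iT)
      have "\<bar>a - A\<bar> = \<bar>LINT x|lborel. (\<Sum>j\<in>UNIV. F j (\<phi> x) / c j * b j x) - (\<Sum>j\<in>UNIV. T j (u x) / c j * b j x)\<bar>"
        unfolding a_def A_def using i1 i2 by simp
      also have "\<dots> \<le> (LINT x|lborel. \<bar>(\<Sum>j\<in>UNIV. F j (\<phi> x) / c j * b j x) - (\<Sum>j\<in>UNIV. T j (u x) / c j * b j x)\<bar>)"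
        by (rule integral_abs_bound)
      also have "\<dots> \<le> (LINT x|lborel. ?g x)"
      proof (rule integral_mono)
        show "integrable lborel (\<lambda>x. \<bar>(\<Sum>j\<in>UNIV. F j (\<phi> x) / c j * b j x) - (\<Sum>j\<in>UNIV. T j (u x) / c j * b j x)\<bar>)"
          using i1 i2 by (intro integrable_abs Bochner_Integration.integrable_diff)
        show "integrable lborel ?g"
          by (intro integrable_mult_right Bochner_Integration.integrable_add i\<phi> ind)
        fix x
        have "\<bar>(\<Sum>j\<in>UNIV. F j (\<phi> x) / c j * b j x) - (\<Sum>j\<in>UNIV. T j (u x) / c j * b j x)\<bar>
          = \<bar>\<Sum>j\<in>UNIV. (F j (\<phi> x) - T j (u x)) / c j * b j x\<bar>"
          by (simp add: sum_subtractf[symmetric] diff_divide_distrib left_diff_distrib)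
        also have "\<dots> \<le> (\<Sum>j\<in>UNIV. \<bar>(F j (\<phi> x) - T j (u x)) / c j * b j x\<bar>)" by (rule sum_abs)
        also have "\<dots> \<le> (\<Sum>j\<in>UNIV. C j / c j * (\<bar>\<phi> x - u x\<bar> + d * indicator (cball 0 s) x))"
        proof (rule sum_mono)
          fix j :: 'l
          show "\<bar>(F j (\<phi> x) - T j (u x)) / c j * b j x\<bar> \<le> C j / c j * (\<bar>\<phi> x - u x\<bar> + d * indicator (cball 0 s) x)"
          proof (cases "norm x \<le> s")
            case True
            have "\<bar>F j (\<phi> x) - T j (u x)\<bar> \<le> \<bar>\<phi> x - u x\<bar> + d"
              using lip[of j "\<phi> x" "u x"] FT[of j "u x"] by linarith
            then have "\<bar>F j (\<phi> x) - T j (u x)\<bar> * \<bar>b j x\<bar> / c j \<le> (\<bar>\<phi> x - u x\<bar> + d) * C j / c j"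
              using C[of j x] c[of j] by (intro divide_right_mono mult_mono) auto
            then show ?thesis using True c[of j] by (simp add: abs_mult mult.commute)
          next
            case False
            then show ?thesis using bs[of x j] C0[of j] c[of j] by simp
          qed
        qed
        finally show "\<bar>(\<Sum>j\<in>UNIV. F j (\<phi> x) / c j * b j x) - (\<Sum>j\<in>UNIV. T j (u x) / c j * b j x)\<bar> \<le> ?g x"
          by (simp add: sum_distrib_right)
      qed
      also have "\<dots> = (\<Sum>j\<in>UNIV. C j / c j) * ((LINT x|lborel. \<bar>\<phi> x - u x\<bar>) + d * V)"
        using i\<phi> ind by (simp add: V_def)
      also have "\<dots> \<le> (\<Sum>j\<in>UNIV. C j / c j) * (d + d * V)"
        using SC L1 by (intro mult_left_mono) auto
      also have "\<dots> = B * d" by (simp add: B_def algebra_simps)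
      finally show ?thesis .
    qed
    ultimately show ?thesis by blast
  qed
  have "ereal A \<le> total_variation N \<Omega> u"
  proof (rule ereal_le_epsilon2)
    fix e :: real assume e: "e > 0"
    then have "e / (B + 1) > 0" using B by simp
    then obtain a where a: "ereal a \<le> total_variation N \<Omega> u" "\<bar>a - A\<bar> \<le> B * (e / (B + 1))"
      using approx by blast
    have "B * (e / (B + 1)) \<le> e" using B e by (simp add: field_simps)
    then have "ereal A \<le> ereal a + ereal e" using a(2) by simp
    also have "\<dots> \<le> total_variation N \<Omega> u + ereal e" using a(1) by (rule add_right_mono)
    finally show "ereal A \<le> total_variation N \<Omega> u + ereal e" .
  qed
  moreover have "- (LINT x|lebesgue_on \<Omega>. lift \<gamma> (u x) \<bullet> row_divergence q x) = A"
  proof -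
    have "lift \<gamma> (u x) \<bullet> row_divergence q x = (\<Sum>j\<in>UNIV. T j (u x) / c j * b j x)" for x
      by (simp add: row_divergence_inner lift_def T_def c_def b_def)
    moreover have "(LINT x|lebesgue_on \<Omega>. (\<Sum>j\<in>UNIV. T j (u x) / c j * b j x)) = (LINT x|lborel. (\<Sum>j\<in>UNIV. T j (u x) / c j * b j x))"
      by (rule lebesgue_on_integral_eq_lborel[OF \<Omega>(1)]) (use b\<Omega> in \<open>auto\<close>)
    ultimately show ?thesis by (simp add: A_def)
  qed
  ultimately show "ereal (- (LINT x|lebesgue_on \<Omega>. lift \<gamma> (u x) \<bullet> row_divergence q x)) \<le> total_variation N \<Omega> u"
    by simp
qed

lemma total_variation_nonneg: "0 \<le> total_variation N \<Omega> u"
proof -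
  have "(\<lambda>_. 0) \<in> C1_compact \<Omega>"
    by (rule C1_compactI[where K="{}" and D="\<lambda>_ _. 0"]) auto
  moreover have "dual_norm N (0 :: real^'d) \<le> 1" by (cases N) (auto simp: infnorm_0)
  ultimately have "(\<lambda>_. 0) \<in> {\<xi> \<in> C1_compact \<Omega>. \<forall>x. dual_norm N (\<xi> x) \<le> 1}" by simp
  from SUP_upper[OF this, of "\<lambda>\<xi>. ereal (- (LINT x|lebesgue_on \<Omega>. u x * divergence \<xi> x))"]
  show ?thesis
    unfolding total_variation_def by (simp add: divergence_eq[OF has_derivative_const] zero_ereal_def)
qed

lemma borel_measurable_lebesgue_on:
  assumes "f \<in> borel_measurable borel" shows "f \<in> borel_measurable (lebesgue_on \<Omega>)"
  using assms by (intro measurable_restrict_space1 measurable_completion) auto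

lemma integrable_times_divergence:
  fixes u :: "real^'d \<Rightarrow> real"
  assumes "integrable (lebesgue_on \<Omega>) u" "\<xi> \<in> C1_compact \<Omega>'"
  shows "integrable (lebesgue_on \<Omega>) (\<lambda>x. u x * divergence \<xi> x)"
proof -
  obtain K where K: "compact K" "\<And>x h. x \<notin> K \<Longrightarrow> frechet_derivative \<xi> (at x) h = 0"
    using C1_compactE[OF assms(2)] by metis
  obtain r where r: "r > 0" "\<And>x. r < norm x \<Longrightarrow> x \<notin> K" using compact_supp_norm[OF K(1)] by metis
  have z: "divergence \<xi> x = 0" if "r < norm x" for x
    using K(2)[OF r(2)[OF that]] by (simp add: divergence_def)
  have c: "continuous_on UNIV (divergence \<xi>)" by (rule continuous_on_divergence[OF assms(2)])
  obtain B where B: "B \<ge> 0" "\<And>x. norm (divergence \<xi> x) \<le> B" using bounded_compact_support[OF c z] by metis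
  have [measurable]: "divergence \<xi> \<in> borel_measurable (lebesgue_on \<Omega>)"
    by (rule borel_measurable_lebesgue_on[OF borel_measurable_continuous_onI[OF c]])
  have [measurable]: "u \<in> borel_measurable (lebesgue_on \<Omega>)" using assms(1) by auto
  show ?thesis
  proof (rule Bochner_Integration.integrable_bound[where f="\<lambda>x. B * u x"])
    show "AE x in lebesgue_on \<Omega>. norm (u x * divergence \<xi> x) \<le> norm (B * u x)"
      using B by (intro AE_I2) (simp add: abs_mult mult.commute[of B] mult_left_mono)
  qed (use assms(1) in auto)
qed

lemma total_variation_midpoint:
  assumes "integrable (lebesgue_on \<Omega>) u" "integrable (lebesgue_on \<Omega>) v"
    and "total_variation N \<Omega> u \<le> ereal a" "total_variation N \<Omega> v \<le> ereal b"
  shows "total_variation N \<Omega> (\<lambda>x. (u x + v x) / 2) \<le> ereal ((a + b) / 2)"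
  unfolding total_variation_def
proof (rule SUP_least)
  fix \<xi> :: "real^'a \<Rightarrow> real^'a" assume \<xi>: "\<xi> \<in> {\<xi> \<in> C1_compact \<Omega>. \<forall>x. dual_norm N (\<xi> x) \<le> 1}"
  then have C: "\<xi> \<in> C1_compact \<Omega>" by simp
  have average: "- Z \<le> (a + b) / 2" if "- X \<le> a" "- Y \<le> b" "Z = (X + Y) / 2" for X Y Z :: real
    using that by simp
  have "ereal (- (LINT x|lebesgue_on \<Omega>. u x * divergence \<xi> x)) \<le> ereal a"
    using SUP_upper[OF \<xi>, of "\<lambda>\<xi>. ereal (- (LINT x|lebesgue_on \<Omega>. u x * divergence \<xi> x))"] assms(3)
    unfolding total_variation_def by (rule order_trans)
  moreover have "ereal (- (LINT x|lebesgue_on \<Omega>. v x * divergence \<xi> x)) \<le> ereal b"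
    using SUP_upper[OF \<xi>, of "\<lambda>\<xi>. ereal (- (LINT x|lebesgue_on \<Omega>. v x * divergence \<xi> x))"] assms(4)
    unfolding total_variation_def by (rule order_trans)
  moreover have "(LINT x|lebesgue_on \<Omega>. (u x + v x) / 2 * divergence \<xi> x) =
    ((LINT x|lebesgue_on \<Omega>. u x * divergence \<xi> x) + (LINT x|lebesgue_on \<Omega>. v x * divergence \<xi> x)) / 2"
    using integrable_times_divergence[OF assms(1) C] integrable_times_divergence[OF assms(2) C]
    by (simp add: distrib_right add_divide_distrib)
  ultimately show "ereal (- (LINT x|lebesgue_on \<Omega>. (u x + v x) / 2 * divergence \<xi> x)) \<le> ereal ((a + b) / 2)"
    unfolding ereal_less_eq by (rule average)
qed

lemma total_variation_cong_AE:
  assumes "u \<in> borel_measurable (lebesgue_on \<Omega>)" "v \<in> borel_measurable (lebesgue_on \<Omega>)"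
    "AE x in lebesgue_on \<Omega>. u x = v x"
  shows "total_variation N \<Omega> u = total_variation N \<Omega> v"
  unfolding total_variation_def
proof (rule SUP_cong[OF refl])
  fix \<xi> :: "real^'a \<Rightarrow> real^'a" assume "\<xi> \<in> {\<xi> \<in> C1_compact \<Omega>. \<forall>x. dual_norm N (\<xi> x) \<le> 1}"
  then have "\<xi> \<in> C1_compact \<Omega>" by simp
  then have [measurable]: "divergence \<xi> \<in> borel_measurable (lebesgue_on \<Omega>)"
    by (intro borel_measurable_lebesgue_on borel_measurable_continuous_onI continuous_on_divergence)
  note assms(1,2)[measurable]
  have "(LINT x|lebesgue_on \<Omega>. u x * divergence \<xi> x) = (LINT x|lebesgue_on \<Omega>. v x * divergence \<xi> x)"
    by (rule integral_cong_AE) (use assms(3) in \<open>auto elim!: eventually_mono\<close>)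
  then show "ereal (- (LINT x|lebesgue_on \<Omega>. u x * divergence \<xi> x)) = ereal (- (LINT x|lebesgue_on \<Omega>. v x * divergence \<xi> x))"
    by simp
qed

lemma lifted_total_variation_cong_AE:
  fixes u v :: "real^'d \<Rightarrow> real^'l::{finite,linorder}"
  assumes "u \<in> borel_measurable (lebesgue_on \<Omega>)" "v \<in> borel_measurable (lebesgue_on \<Omega>)"
    "AE x in lebesgue_on \<Omega>. u x = v x"
  shows "lifted_total_variation N \<Omega> \<gamma> u = lifted_total_variation N \<Omega> \<gamma> v"
  unfolding lifted_total_variation_def
proof (rule SUP_cong[OF refl])
  fix q :: "real^'d \<Rightarrow> real^'d^'l::{finite,linorder}" assume "q \<in> {q \<in> C1_compact \<Omega>. \<forall>x. q x \<in> lifted_dual_set N \<gamma>}"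
  then have "q \<in> C1_compact \<Omega>" by simp
  then have "continuous_on UNIV (row_divergence q)"
    unfolding row_divergence_def[abs_def]
    by (intro continuous_on_vec_lambda continuous_on_divergence C1_compact_row)
  then have [measurable]: "row_divergence q \<in> borel_measurable (lebesgue_on \<Omega>)"
    by (intro borel_measurable_lebesgue_on borel_measurable_continuous_onI)
  note assms(1,2)[measurable]
  have "(LINT x|lebesgue_on \<Omega>. u x \<bullet> row_divergence q x) = (LINT x|lebesgue_on \<Omega>. v x \<bullet> row_divergence q x)"
    by (rule integral_cong_AE) (use assms(3) in \<open>auto elim!: eventually_mono\<close>)
  then show "ereal (- (LINT x|lebesgue_on \<Omega>. u x \<bullet> row_divergence q x)) = ereal (- (LINT x|lebesgue_on \<Omega>. v x \<bullet> row_divergence q x))"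
    by simp
qed

text \<open>
  Fubini's theorem is used for the product of Borel measures, so functions that are only
  Lebesgue measurable on \<open>\<Omega>\<close> are first replaced by Borel functions; the values stay in the
  interval \<open>[a, b]\<close>.
\<close>

lemma borel_representative:
  fixes u :: "'a::euclidean_space \<Rightarrow> real"
  assumes \<Omega>: "open \<Omega>" and u: "u \<in> borel_measurable (lebesgue_on \<Omega>)" and ab: "AE x in lebesgue_on \<Omega>. u x \<in> {a..b}"
    and "a \<le> b"
  obtains u' where "u' \<in> borel_measurable borel" "\<And>x. x \<notin> \<Omega> \<Longrightarrow> u' x = 0" "\<And>x. x \<in> \<Omega> \<Longrightarrow> u' x \<in> {a..b}"
    "\<And>x. \<bar>u' x\<bar> \<le> max \<bar>a\<bar> \<bar>b\<bar>" "AE x in lebesgue_on \<Omega>. u x = u' x"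
proof -
  have S: "\<Omega> \<in> sets lebesgue" "\<Omega> \<in> sets borel" using \<Omega> by auto
  have "(\<lambda>x. if x \<in> \<Omega> then u x else 0) \<in> borel_measurable lebesgue"
    using u S by (simp add: borel_measurable_if)
  from completion_ex_borel_measurable_real[OF this]
  obtain g where g: "g \<in> borel_measurable lborel" "AE x in lborel. (if x \<in> \<Omega> then u x else 0) = g x" by blast
  have [measurable]: "g \<in> borel_measurable borel" "\<Omega> \<in> sets borel" using g S by auto
  define u' where "u' x = (if x \<in> \<Omega> then max a (min b (g x)) else 0)" for x
  have "AE x in lebesgue. x \<in> \<Omega> \<longrightarrow> u x = g x"
    using AE_completion[OF g(2)] by (rule eventually_mono) auto
  then have "AE x in lebesgue_on \<Omega>. u x = g x" using S by (simp add: AE_restrict_space_iff)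
  with ab have eq: "AE x in lebesgue_on \<Omega>. u x = u' x"
  proof (rule AE_mp[OF AE_conjI], intro AE_I2 impI)
    fix x assume "x \<in> space (lebesgue_on \<Omega>)" "u x \<in> {a..b} \<and> u x = g x"
    then show "u x = u' x" by (auto simp: u'_def max_def min_def)
  qed
  show thesis
  proof (rule that[of u', OF _ _ _ _ eq])
    show "u' \<in> borel_measurable borel" unfolding u'_def by measurable
  qed (use \<open>a \<le> b\<close> in \<open>auto simp: u'_def max_def min_def\<close>)
qed

lemma lifted_total_variation_lift_le:
  fixes u :: "real^'d \<Rightarrow> real"
  assumes \<Omega>: "open \<Omega>" "bounded \<Omega>"
    and u: "u \<in> borel_measurable (lebesgue_on \<Omega>)" "AE x in lebesgue_on \<Omega>. u x \<in> {a..b}" "a \<le> b"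
    and \<gamma>: "strict_mono_on {1..CARD('l::{finite,linorder}) + 1} \<gamma>"
  shows "lifted_total_variation N \<Omega> \<gamma> (\<lambda>x. lift \<gamma> (u x) :: real^'l::{finite,linorder}) \<le> total_variation N \<Omega> u"
proof -
  obtain u' where u': "u' \<in> borel_measurable borel" "\<And>x. x \<notin> \<Omega> \<Longrightarrow> u' x = 0"
    "\<And>x. \<bar>u' x\<bar> \<le> max \<bar>a\<bar> \<bar>b\<bar>" "AE x in lebesgue_on \<Omega>. u x = u' x"
    using borel_representative[OF \<Omega>(1) u] by metis
  note m = u(1)[measurable] borel_measurable_lebesgue_on[OF u'(1), of \<Omega>, measurable]
  have "lifted_total_variation N \<Omega> \<gamma> (\<lambda>x. lift \<gamma> (u x) :: real^'l::{finite,linorder})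
    = lifted_total_variation N \<Omega> \<gamma> (\<lambda>x. lift \<gamma> (u' x) :: real^'l::{finite,linorder})"
    by (rule lifted_total_variation_cong_AE) (use u'(4) in \<open>auto elim!: eventually_mono\<close>)
  also have "\<dots> \<le> total_variation N \<Omega> u'"
    by (rule lifted_total_variation_lift_le_borel[OF \<Omega> u'(1-3) \<gamma>])
  also have "\<dots> = total_variation N \<Omega> u"
    by (rule total_variation_cong_AE[symmetric]) (use u'(4) m in auto)
  finally show ?thesis .
qed

text \<open>
  The test field with rows \<open>c j *\<^sub>R \<xi>\<close>, \<open>c j\<close> the label gaps, pairs with \<open>U\<close> as \<open>\<xi>\<close> pairs with
  \<open>unlift \<circ> U\<close>; the additive constant \<open>\<gamma> 1\<close> drops out because the divergence of \<open>\<xi>\<close> has integral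
  0.
\<close>

lemma total_variation_unlift_le:
  fixes U :: "real^'d \<Rightarrow> real^'l::{finite,linorder}"
  assumes \<Omega>: "open \<Omega>" "bounded \<Omega>"
    and int: "integrable (lebesgue_on \<Omega>) (\<lambda>x. unlift \<gamma> (U x))"
    and \<gamma>: "strict_mono_on {1..CARD('l) + 1} \<gamma>"
  shows "total_variation N \<Omega> (\<lambda>x. unlift \<gamma> (U x)) \<le> lifted_total_variation N \<Omega> \<gamma> U"
  unfolding total_variation_def
proof (rule SUP_least)
  fix \<xi> :: "real^'d \<Rightarrow> real^'d" assume "\<xi> \<in> {\<xi> \<in> C1_compact \<Omega>. \<forall>x. dual_norm N (\<xi> x) \<le> 1}"
  then have \<xi>: "\<xi> \<in> C1_compact \<Omega>" "\<And>x. dual_norm N (\<xi> x) \<le> 1" by auto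
  define c :: "'l \<Rightarrow> real" where "c j = \<gamma> (pos j + 1) - \<gamma> (pos j)" for j
  have c: "c j > 0" for j using label_gap_pos[OF \<gamma>, of j] by (simp add: c_def)
  define q :: "real^'d \<Rightarrow> real^'d^'l::{finite,linorder}" where "q x = (\<chi> j. c j *\<^sub>R \<xi> x)" for x
  obtain K where K: "compact K" "K \<subseteq> \<Omega>" "\<And>x. x \<notin> K \<Longrightarrow> \<xi> x = 0"
    and d: "\<And>x. (\<xi> has_derivative frechet_derivative \<xi> (at x)) (at x)"
      "\<And>h. continuous_on UNIV (\<lambda>x. frechet_derivative \<xi> (at x) h)"
    using C1_compactE[OF \<xi>(1)] by metis
  have "linear (\<lambda>v::real^'d. (\<chi> j. c j *\<^sub>R v) :: real^'d^'l::{finite,linorder})"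
    by (rule linearI) (auto simp: vec_eq_iff scaleR_add_right)
  then have bl: "bounded_linear (\<lambda>v::real^'d. (\<chi> j. c j *\<^sub>R v) :: real^'d^'l::{finite,linorder})"
    by (simp add: linear_conv_bounded_linear)
  have "q \<in> C1_compact \<Omega>"
  proof (rule C1_compactI[OF K(1,2)])
    show "q x = 0" if "x \<notin> K" for x using K(3)[OF that] by (simp add: q_def vec_eq_iff)
    show "(q has_derivative (\<lambda>h. \<chi> j. c j *\<^sub>R frechet_derivative \<xi> (at x) h)) (at x)" for x
      unfolding q_def[abs_def] by (rule bounded_linear.has_derivative[OF bl d(1)])
    show "continuous_on UNIV (\<lambda>x. (\<chi> j. c j *\<^sub>R frechet_derivative \<xi> (at x) h) :: real^'d^'l::{finite,linorder})" for h
      by (intro continuous_on_vec_lambda continuous_intros d)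
  qed
  moreover have "q x \<in> lifted_dual_set N \<gamma>" for x
    unfolding lifted_dual_set_def
  proof (intro CollectI allI)
    fix j :: 'l
    have "c j * dual_norm N (\<xi> x) \<le> c j * 1" using c[of j] \<xi>(2)[of x] by (intro mult_left_mono) auto
    then show "dual_norm N (q x $ j) \<le> \<gamma> (pos j + 1) - \<gamma> (pos j)"
      using c[of j] by (simp add: q_def dual_norm_scaleR) (simp add: c_def)
  qed
  ultimately have q: "q \<in> {q \<in> C1_compact \<Omega>. \<forall>x. q x \<in> lifted_dual_set N \<gamma>}" by simp
  have rd: "U x \<bullet> row_divergence q x = (unlift \<gamma> (U x) - \<gamma> 1) * divergence \<xi> x" for x
  proof -
    have "divergence (\<lambda>y. q y $ j) x = c j * divergence \<xi> x" for j
    proof -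
      have "((\<lambda>y. q y $ j) has_derivative (\<lambda>h. c j *\<^sub>R frechet_derivative \<xi> (at x) h)) (at x)"
        unfolding q_def using has_derivative_scaleR_right[OF d(1)[of x], of "c j"] by simp
      from divergence_eq[OF this] show ?thesis by (simp add: divergence_def sum_distrib_left)
    qed
    then show ?thesis
      unfolding row_divergence_inner by (simp add: unlift_def sum_distrib_right mult.assoc c_def)
  qed
  have fm: "integrable (lebesgue_on \<Omega>) (\<lambda>x. \<gamma> 1)"
    by (rule finite_measure.integrable_const[OF finite_measure_lebesgue_on[OF lmeasurable_open[OF \<Omega>(2,1)]]])
  have "(LINT x|lebesgue_on \<Omega>. divergence \<xi> x) = (LINT x|lborel. divergence \<xi> x)"
    using \<xi>(1) by (intro lebesgue_on_integral_eq_lborel[OF \<Omega>(1)] borel_measurable_continuous_onI continuous_on_divergence divergence_zero_outside)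
  then have z: "(LINT x|lebesgue_on \<Omega>. divergence \<xi> x) = 0" using integral_divergence_zero[OF \<xi>(1)] by simp
  have "(LINT x|lebesgue_on \<Omega>. U x \<bullet> row_divergence q x) =
    (LINT x|lebesgue_on \<Omega>. unlift \<gamma> (U x) * divergence \<xi> x - \<gamma> 1 * divergence \<xi> x)"
    unfolding rd by (simp add: left_diff_distrib)
  also have "\<dots> = (LINT x|lebesgue_on \<Omega>. unlift \<gamma> (U x) * divergence \<xi> x)"
    using integrable_times_divergence[OF int \<xi>(1)] integrable_times_divergence[OF fm \<xi>(1)] z
    by (subst Bochner_Integration.integral_diff) auto
  finally have "ereal (- (LINT x|lebesgue_on \<Omega>. unlift \<gamma> (U x) * divergence \<xi> x)) =
    ereal (- (LINT x|lebesgue_on \<Omega>. U x \<bullet> row_divergence q x))" by simp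
  also have "\<dots> \<le> lifted_total_variation N \<Omega> \<gamma> U"
    unfolding lifted_total_variation_def by (rule SUP_upper[OF q])
  finally show "ereal (- (LINT x|lebesgue_on \<Omega>. unlift \<gamma> (U x) * divergence \<xi> x)) \<le> lifted_total_variation N \<Omega> \<gamma> U" .
qed

section \<open>Convexity at a midpoint\<close>

lemma convex_ereal_on_chord:
  fixes f :: "real \<Rightarrow> ereal"
  assumes f: "convex_ereal_on I f" and I: "x \<in> I" "y \<in> I" and m: "x < m" "m < y"
    and fin: "f x = ereal X" "f y = ereal Y"
  shows "f m \<le> ereal (((y - m) * X + (m - x) * Y) / (y - x))"
proof -
  define s where "s = (y - m) / (y - x)"
  define t where "t = (m - x) / (y - x)"
  have st: "s \<ge> 0" "t \<ge> 0" "s + t = 1" using m by (auto simp: s_def t_def add_divide_distrib[symmetric])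
  have "s * x + t * y = ((y - m) * x + (m - x) * y) / (y - x)" by (simp add: s_def t_def add_divide_distrib)
  also have "(y - m) * x + (m - x) * y = m * (y - x)" by (simp add: algebra_simps)
  finally have eq: "s * x + t * y = m" using m by simp
  have "f (s *\<^sub>R x + t *\<^sub>R y) \<le> ereal s * f x + ereal t * f y"
    using f I st unfolding convex_ereal_on_def by blast
  then show ?thesis using fin eq by (simp add: s_def t_def add_divide_distrib)
qed

text \<open>
  \<open>R\<close> stands for a value at \<open>b\<close> that dominates every affine minorant of \<open>f\<close>, for instance that
  of its biconjugate. Let \<open>m\<close> be the midpoint. If \<open>f\<close> is infinite beyond \<open>m\<close>, there are
  arbitrarily steep minorants vanishing at \<open>m\<close>, and \<open>R\<close> is infinite. Otherwise \<open>m\<close> is interior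
  to the effective domain, where \<open>f\<close> has a supporting line; adding its values at \<open>a\<close> and \<open>b\<close>,
  which are below \<open>f a\<close> and \<open>R\<close>, gives \<open>2 * f m\<close>.
\<close>

lemma convex_midpoint_le_left:
  fixes f :: "real \<Rightarrow> ereal"
  assumes f: "convex_ereal_on I f" and nonneg: "\<And>t. t \<in> I \<Longrightarrow> 0 \<le> f t"
    and I: "a \<in> I" "b \<in> I" and ab: "a < b"
    and R: "\<And>s c. (\<And>t. t \<in> I \<Longrightarrow> ereal (s * t - c) \<le> f t) \<Longrightarrow> ereal (s * b - c) \<le> R"
  shows "f ((a + b) / 2) + f ((a + b) / 2) \<le> f a + R"
proof -
  define m where "m = (a + b) / 2"
  have m: "a < m" "m < b" "b - m = m - a" using ab by (auto simp: m_def field_simps)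
  have R0: "0 \<le> R" using R[of 0 0] nonneg by (simp flip: zero_ereal_def)
  show ?thesis
    unfolding m_def[symmetric]
  proof (cases "f a = \<infinity>")
    case True then show "f m + f m \<le> f a + R" using R0 by simp
  next
    case False
    then obtain A where A: "f a = ereal A" using nonneg[OF I(1)] by (cases "f a") auto
    show "f m + f m \<le> f a + R"
    proof (cases "\<forall>t\<in>I. m < t \<longrightarrow> f t = \<infinity>")
      case True
      have "ereal B \<le> R" for B
      proof -
        define s where "s = max 0 B / (b - m)"
        have s: "s \<ge> 0" "s * (b - m) = max 0 B" using m by (auto simp: s_def)
        have "ereal (s * b - s * m) \<le> R"
        proof (rule R)
          fix t assume t: "t \<in> I"
          show "ereal (s * t - s * m) \<le> f t"
          proof (cases "m < t")
            case False
            then have "s * t - s * m \<le> 0" using s(1) by (simp add: mult_left_mono)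
            then have "ereal (s * t - s * m) \<le> 0" by (simp add: zero_ereal_def)
            then show ?thesis using nonneg[OF t] by (rule order_trans)
          qed (use True t in simp)
        qed
        moreover have "s * b - s * m = max 0 B" using s(2) by (simp add: right_diff_distrib)
        ultimately have "ereal (max 0 B) \<le> R" by simp
        then show ?thesis by (rule order_trans[rotated]) simp
      qed
      then have "R = \<infinity>" by (rule ereal_top)
      then show ?thesis using A by simp
    next
      case False
      then obtain t0 where t0: "t0 \<in> I" "m < t0" "f t0 \<noteq> \<infinity>" by blast
      have "is_interval I" using f by (simp add: convex_ereal_on_def is_interval_convex_1)
      then have mI: "m \<in> I" using I t0 m by (meson is_interval_1 less_imp_le)
      obtain T0 where T0: "f t0 = ereal T0" using nonneg[OF t0(1)] t0(3) by (cases "f t0") auto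
      have "f m \<noteq> \<infinity>" using convex_ereal_on_chord[OF f I(1) t0(1) m(1) t0(2) A T0] by auto
      then obtain M where M: "f m = ereal M" using nonneg[OF mI] by (cases "f m") auto
      have slopes: "(M - X) / (m - x) \<le> (Y - M) / (y - m)"
        if "x \<in> I" "y \<in> I" "x < m" "m < y" "f x = ereal X" "f y = ereal Y" for x y X Y
      proof -
        have "M \<le> ((y - m) * X + (m - x) * Y) / (y - x)"
          using convex_ereal_on_chord[OF f that] M by simp
        then have "M * (y - x) \<le> (y - m) * X + (m - x) * Y" using that by (simp add: field_simps)
        then have "(M - X) * (y - m) \<le> (Y - M) * (m - x)" by (simp add: algebra_simps)
        then show ?thesis using that by (simp add: divide_simps mult.commute)
      qed
      \<comment> \<open>The supremum of the slopes of the chords ending in \<open>m\<close> from the left is a subgradient at \<open>m\<close>.\<close>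
      define S where "S = {(M - X) / (m - x) | x X. x \<in> I \<and> x < m \<and> f x = ereal X}"
      have S_ne: "S \<noteq> {}" using I(1) m(1) A by (auto simp: S_def)
      have S_ub: "z \<le> (Y - M) / (y - m)" if "z \<in> S" "y \<in> I" "m < y" "f y = ereal Y" for z y Y
        using that slopes by (auto simp: S_def)
      then have S_bdd: "bdd_above S" using t0 T0 by (meson bdd_above.I)
      define s where "s = Sup S"
      have minorant: "ereal (s * t - (s * m - M)) \<le> f t" if t: "t \<in> I" for t
      proof (cases "f t")
        case (real \<tau>)
        have "M + s * (t - m) \<le> \<tau>"
        proof -
          consider "t < m" | "t = m" | "m < t" by linarith
          then show ?thesis
          proof cases
            case 1
            have "(M - \<tau>) / (m - t) \<le> s" unfolding s_def
              by (rule cSup_upper[OF _ S_bdd]) (use 1 t real in \<open>auto simp: S_def\<close>)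
            then have "M - \<tau> \<le> s * (m - t)" using 1 by (simp add: divide_le_eq)
            then show ?thesis by (simp add: algebra_simps)
          next
            case 2 then show ?thesis using M real by simp
          next
            case 3
            have "s \<le> (\<tau> - M) / (t - m)" unfolding s_def
              by (rule cSup_least[OF S_ne]) (rule S_ub[OF _ t 3 real])
            then have "s * (t - m) \<le> \<tau> - M" using 3 by (simp add: le_divide_eq)
            then show ?thesis by simp
          qed
        qed
        then show ?thesis using real by (simp add: algebra_simps)
      qed (use nonneg[OF t] in auto)
      have right: "ereal (s * b - (s * m - M)) \<le> R" by (rule R) (rule minorant)
      have left: "s * a - (s * m - M) \<le> A" using minorant[OF I(1)] A by simp
      have sum: "(s * a - (s * m - M)) + (s * b - (s * m - M)) = M + M"
        unfolding m_def by (simp add: algebra_simps)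
      show ?thesis
      proof (cases R)
        case (real r)
        then have "s * b - (s * m - M) \<le> r" using right by simp
        then have "M + M \<le> A + r" using left sum by linarith
        then show ?thesis by (simp add: M A real)
      qed (use R0 M A in auto)
    qed
  qed
qed

text \<open>
  The case \<open>b < a\<close> follows by reflection at the origin.
\<close>

lemma convex_midpoint_le:
  fixes f :: "real \<Rightarrow> ereal"
  assumes f: "convex_ereal_on I f" and nonneg: "\<And>t. t \<in> I \<Longrightarrow> 0 \<le> f t"
    and I: "a \<in> I" "b \<in> I" and ab: "a \<noteq> b"
    and R: "\<And>s c. (\<And>t. t \<in> I \<Longrightarrow> ereal (s * t - c) \<le> f t) \<Longrightarrow> ereal (s * b - c) \<le> R"
  shows "f ((a + b) / 2) + f ((a + b) / 2) \<le> f a + R"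
proof (cases "a < b")
  case True then show ?thesis using convex_midpoint_le_left[OF f nonneg I] R by blast
next
  case False
  define I' where "I' = uminus ` I"
  define f' where "f' t = f (- t)" for t
  have I'_iff: "t \<in> I' \<longleftrightarrow> - t \<in> I" for t unfolding I'_def by (metis add.inverse_inverse image_iff)
  have "f' ((- a + - b) / 2) + f' ((- a + - b) / 2) \<le> f' (- a) + R"
  proof (rule convex_midpoint_le_left[where I=I'])
    show "convex_ereal_on I' f'"
      unfolding convex_ereal_on_def
    proof (intro conjI ballI allI impI)
      show "convex I'" unfolding I'_def using f by (simp add: convex_ereal_on_def convex_negations)
      fix x y s t :: real
      assume "x \<in> I'" "y \<in> I'" "0 \<le> s" "0 \<le> t" "s + t = 1"
      then have "f (s *\<^sub>R (- x) + t *\<^sub>R (- y)) \<le> ereal s * f (- x) + ereal t * f (- y)"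
        using f unfolding convex_ereal_on_def I'_iff by blast
      then show "f' (s *\<^sub>R x + t *\<^sub>R y) \<le> ereal s * f' x + ereal t * f' y" by (simp add: f'_def)
    qed
    fix s c assume *: "\<And>t. t \<in> I' \<Longrightarrow> ereal (s * t - c) \<le> f' t"
    have "ereal ((- s) * b - c) \<le> R"
    proof (rule R)
      fix t assume "t \<in> I" then show "ereal ((- s) * t - c) \<le> f t" using *[of "- t"] by (simp add: I'_iff f'_def)
    qed
    then show "ereal (s * (- b) - c) \<le> R" by simp
  qed (use I nonneg ab False in \<open>auto simp: I'_iff f'_def\<close>)
  moreover have "- ((- a + - b) / 2) = (a + b) / 2" by (simp add: field_simps)
  ultimately show ?thesis by (simp only: f'_def minus_minus)
qed

section \<open>The lifted data term\<close>

lemma biconj_le: "biconj f v \<le> f v"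
  unfolding biconj_def fenchel_conj_def[of "fenchel_conj f"]
proof (rule SUP_least)
  fix y
  have "ereal (y \<bullet> v) - f v \<le> fenchel_conj f y"
    unfolding fenchel_conj_def by (rule SUP_upper) simp
  then show "ereal (v \<bullet> y) - fenchel_conj f y \<le> f v"
    by (cases "f v"; cases "fenchel_conj f y") (auto simp: inner_commute)
qed

lemma affine_minorant_le_biconj:
  assumes "\<And>w. ereal (y \<bullet> w - c) \<le> f w"
  shows "ereal (y \<bullet> v - c) \<le> biconj f v"
proof -
  have "fenchel_conj f y \<le> ereal c"
    unfolding fenchel_conj_def
  proof (rule SUP_least)
    fix w show "ereal (y \<bullet> w) - f w \<le> ereal c" using assms[of w] by (cases "f w") auto
  qed
  then have "ereal (y \<bullet> v - c) \<le> ereal (v \<bullet> y) - fenchel_conj f y"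
    by (cases "fenchel_conj f y") (auto simp: inner_commute)
  also have "\<dots> \<le> biconj f v"
    unfolding biconj_def fenchel_conj_def[of "fenchel_conj f"] by (rule SUP_upper) simp
  finally show ?thesis .
qed

lemma lifted_rho_lift_le:
  assumes \<gamma>: "strict_mono_on {1..CARD('l::{finite,linorder}) + 1} \<gamma>" and t: "t \<in> {\<gamma> 1..\<gamma> (CARD('l) + 1)}"
  shows "lifted_rho \<gamma> \<rho> x (lift \<gamma> t :: real^'l::{finite,linorder}) \<le> \<rho> x t"
proof -
  obtain i \<alpha> where i: "i \<in> {1..CARD('l)}" "\<alpha> \<in> {0..1}" "t = sublabel \<gamma> i \<alpha>"
    using exists_sublabel[OF \<gamma> t] by metis
  have "lifted_rho \<gamma> \<rho> x (lift \<gamma> t :: real^'l::{finite,linorder}) \<le>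
    (case (i, \<alpha>) of (i, \<alpha>) \<Rightarrow> \<rho> x (sublabel \<gamma> i \<alpha>) + char_fun {lifted_sublabel i \<alpha>} (lift \<gamma> t :: real^'l::{finite,linorder}))"
    unfolding lifted_rho_def by (rule INF_lower) (use i in auto)
  also have "\<dots> = \<rho> x t" using i lift_sublabel[OF \<gamma> i(1,2)] by (simp add: char_fun_def)
  finally show ?thesis .
qed

text \<open>
  An affine minorant \<open>s * t - c\<close> of \<open>\<rho>\<close> lifts to the affine minorant \<open>s * unlift \<gamma> w - c\<close> of the
  lifted integrand, and affine minorants survive biconjugation.
\<close>

lemma affine_minorant_le_biconj_lifted_rho:
  assumes \<gamma>: "strict_mono_on {1..CARD('l::{finite,linorder}) + 1} \<gamma>" and b: "b \<in> {\<gamma> 1..\<gamma> (CARD('l) + 1)}"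
    and minor: "\<And>t. t \<in> {\<gamma> 1..\<gamma> (CARD('l) + 1)} \<Longrightarrow> ereal (s * t - c) \<le> \<rho> x t"
  shows "ereal (s * b - c) \<le> biconj (lifted_rho \<gamma> \<rho> x) (lift \<gamma> b :: real^'l::{finite,linorder})"
proof -
  define y :: "real^'l::{finite,linorder}" where "y = s *\<^sub>R label_gaps \<gamma>"
  have y: "y \<bullet> v - (c - s * \<gamma> 1) = s * unlift \<gamma> v - c" for v
    by (simp add: y_def unlift_eq_inner algebra_simps)
  have "ereal (y \<bullet> lift \<gamma> b - (c - s * \<gamma> 1)) \<le> biconj (lifted_rho \<gamma> \<rho> x) (lift \<gamma> b :: real^'l::{finite,linorder})"
  proof (rule affine_minorant_le_biconj)
    fix w
    show "ereal (y \<bullet> w - (c - s * \<gamma> 1)) \<le> lifted_rho \<gamma> \<rho> x w"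
      unfolding lifted_rho_def
    proof (rule INF_greatest)
      fix p assume "p \<in> {1..CARD('l)} \<times> {0..1::real}"
      then obtain i \<alpha> where p: "p = (i, \<alpha>)" "i \<in> {1..CARD('l)}" "\<alpha> \<in> {0..1}" by blast
      note mem = sublabel_between(3)[OF \<gamma> p(2,3)]
      have "ereal (y \<bullet> w - (c - s * \<gamma> 1)) \<le> \<rho> x (sublabel \<gamma> i \<alpha>) + char_fun {lifted_sublabel i \<alpha>} w"
      proof (cases "w = lifted_sublabel i \<alpha>")
        case True
        then have "unlift \<gamma> w = sublabel \<gamma> i \<alpha>"
          using unlift_lift[OF \<gamma> mem] lift_sublabel[OF \<gamma> p(2,3)] by simp
        then show ?thesis unfolding y using minor[OF mem] True by (simp add: char_fun_def)
      next
        case False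
        have "\<rho> x (sublabel \<gamma> i \<alpha>) \<noteq> -\<infinity>" using minor[OF mem] by auto
        then show ?thesis using False by (simp add: char_fun_def)
      qed
      then show "ereal (y \<bullet> w - (c - s * \<gamma> 1)) \<le>
        (case p of (i, \<alpha>) \<Rightarrow> \<rho> x (sublabel \<gamma> i \<alpha>) + char_fun {lifted_sublabel i \<alpha>} w)"
        by (simp add: p)
    qed
  qed
  then show ?thesis unfolding y unlift_lift[OF \<gamma> b] .
qed

text \<open>
  For \<open>a = b\<close> this is an equality; otherwise it combines \<open>convex_midpoint_le\<close> with
  \<open>R a \<le> \<rho> x a\<close>.
\<close>

lemma lifted_data_midpoint:
  assumes \<gamma>: "strict_mono_on {1..CARD('l::{finite,linorder}) + 1} \<gamma>"
    and I: "I = {\<gamma> 1..\<gamma> (CARD('l) + 1)}"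
    and conv: "convex_ereal_on I (\<rho> x)" and nonneg: "\<And>t. t \<in> I \<Longrightarrow> 0 \<le> \<rho> x t"
    and ab: "a \<in> I" "b \<in> I"
  defines "R \<equiv> \<lambda>t. biconj (lifted_rho \<gamma> \<rho> x) (lift \<gamma> t :: real^'l::{finite,linorder})"
  shows "\<rho> x ((a + b) / 2) + \<rho> x ((a + b) / 2) + R a \<le> \<rho> x a + \<rho> x a + R b"
    and "0 \<le> R a"
proof -
  have R: "ereal (s * t - c) \<le> R t"
    if "t \<in> I" "\<And>t. t \<in> I \<Longrightarrow> ereal (s * t - c) \<le> \<rho> x t" for s c t
    using affine_minorant_le_biconj_lifted_rho[OF \<gamma>, of t s c \<rho> x] that unfolding R_def I by blast
  have R0: "0 \<le> R t" if "t \<in> I" for t using R[OF that, of 0 0] nonneg by (simp flip: zero_ereal_def)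
  then show "0 \<le> R a" using ab by blast
  show "\<rho> x ((a + b) / 2) + \<rho> x ((a + b) / 2) + R a \<le> \<rho> x a + \<rho> x a + R b"
  proof (cases "a = b")
    case False
    have "\<rho> x ((a + b) / 2) + \<rho> x ((a + b) / 2) \<le> \<rho> x a + R b"
      by (rule convex_midpoint_le[OF conv nonneg ab False]) (use R[OF ab(2)] in auto)
    moreover have "R a \<le> \<rho> x a"
    proof -
      have "R a \<le> lifted_rho \<gamma> \<rho> x (lift \<gamma> a :: real^'l::{finite,linorder})"
        unfolding R_def by (rule biconj_le)
      also have "\<dots> \<le> \<rho> x a" by (rule lifted_rho_lift_le[OF \<gamma> ab(1)[unfolded I]])
      finally show ?thesis .
    qed
    ultimately have "\<rho> x ((a + b) / 2) + \<rho> x ((a + b) / 2) + R a \<le> \<rho> x a + R b + \<rho> x a"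
      by (rule add_mono)
    then show ?thesis by (simp add: ac_simps)
  qed simp
qed

text \<open>
  The lifted integrand is a supremum over uncountably many affine functions, so its
  measurability in \<open>x\<close> is not immediate. The integral \<open>\<integral>\<^sup>+\<close> of an arbitrary function is its
  lower integral, which is still additive when one of the two summands is measurable; this lemma
  and the next are the two inequalities.
\<close>

lemma nn_integral_add_le:
  assumes [measurable]: "f \<in> borel_measurable M"
  shows "(\<integral>\<^sup>+x. f x + g x \<partial>M) \<le> (\<integral>\<^sup>+x. f x \<partial>M) + (\<integral>\<^sup>+x. g x \<partial>M)"
  unfolding nn_integral_def[of M "\<lambda>x. f x + g x"]
proof (rule SUP_least)
  fix s assume "s \<in> {s. simple_function M s \<and> s \<le> (\<lambda>x. f x + g x)}"
  then have s: "simple_function M s" and le: "s x \<le> f x + g x" for x by (auto simp: le_fun_def)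
  have [measurable]: "s \<in> borel_measurable M" using s by (rule borel_measurable_simple_function)
  \<comment> \<open>On extended reals \<open>top - top = top\<close>, so the points with \<open>f x = top\<close> are treated separately.\<close>
  define h where "h x = (if f x = top then 0 else s x - f x)" for x
  have [measurable]: "h \<in> borel_measurable M" unfolding h_def by measurable
  have sh: "s x \<le> f x + h x" for x using linear[of "s x" "f x"] by (auto simp: h_def add_diff_self_ennreal)
  have hg: "h x \<le> g x" for x using le[of x] by (simp add: h_def ennreal_minus_le_iff)
  have "integral\<^sup>S M s = (\<integral>\<^sup>+x. s x \<partial>M)" using s by (simp add: nn_integral_eq_simple_integral)
  also have "\<dots> \<le> (\<integral>\<^sup>+x. f x + h x \<partial>M)" by (intro nn_integral_mono sh)
  also have "\<dots> = (\<integral>\<^sup>+x. f x \<partial>M) + (\<integral>\<^sup>+x. h x \<partial>M)" by (rule nn_integral_add) measurable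
  also have "\<dots> \<le> (\<integral>\<^sup>+x. f x \<partial>M) + (\<integral>\<^sup>+x. g x \<partial>M)"
    by (intro add_left_mono nn_integral_mono hg)
  finally show "integral\<^sup>S M s \<le> (\<integral>\<^sup>+x. f x \<partial>M) + (\<integral>\<^sup>+x. g x \<partial>M)" .
qed

lemma add_le_nn_integral:
  assumes [measurable]: "f \<in> borel_measurable M"
  shows "(\<integral>\<^sup>+x. f x \<partial>M) + (\<integral>\<^sup>+x. g x \<partial>M) \<le> (\<integral>\<^sup>+x. f x + g x \<partial>M)"
proof -
  let ?S = "{s. simple_function M s \<and> s \<le> g}"
  have "(\<lambda>_. 0) \<in> ?S" by (auto simp: le_fun_def)
  then have "?S \<noteq> {}" by blast
  then have "(\<integral>\<^sup>+x. f x \<partial>M) + (\<integral>\<^sup>+x. g x \<partial>M) = (SUP s\<in>?S. (\<integral>\<^sup>+x. f x \<partial>M) + integral\<^sup>S M s)"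
    unfolding nn_integral_def[of M g] by (rule ennreal_SUP_add_right)
  also have "\<dots> \<le> (\<integral>\<^sup>+x. f x + g x \<partial>M)"
  proof (rule SUP_least)
    fix s assume "s \<in> ?S"
    then have s: "simple_function M s" and le: "s x \<le> g x" for x by (auto simp: le_fun_def)
    have [measurable]: "s \<in> borel_measurable M" using s by (rule borel_measurable_simple_function)
    have "(\<integral>\<^sup>+x. f x \<partial>M) + integral\<^sup>S M s = (\<integral>\<^sup>+x. f x + s x \<partial>M)"
      using s by (simp add: nn_integral_add nn_integral_eq_simple_integral)
    also have "\<dots> \<le> (\<integral>\<^sup>+x. f x + g x \<partial>M)" using le by (intro nn_integral_mono add_left_mono)
    finally show "(\<integral>\<^sup>+x. f x \<partial>M) + integral\<^sup>S M s \<le> (\<integral>\<^sup>+x. f x + g x \<partial>M)" .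
  qed
  finally show ?thesis .
qed

lemma e2ennreal_add: "0 \<le> a \<Longrightarrow> 0 \<le> b \<Longrightarrow> e2ennreal (a + b) = e2ennreal a + e2ennreal b"
  using e2ennreal_enn2ereal[of "e2ennreal a + e2ennreal b"]
  by (simp add: plus_ennreal.rep_eq enn2ereal_e2ennreal)

lemma nonneg_integral_nonneg: "0 \<le> nonneg_integral \<Omega> f"
  by (simp add: nonneg_integral_def)

lemma nonneg_integral_mono_AE:
  assumes "AE x in lebesgue_on \<Omega>. f x \<le> g x"
  shows "nonneg_integral \<Omega> f \<le> nonneg_integral \<Omega> g"
  unfolding nonneg_integral_def less_eq_ennreal.rep_eq[symmetric]
  by (rule nn_integral_mono_AE) (use assms in \<open>auto elim!: eventually_mono intro: e2ennreal_mono\<close>)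

lemma nonneg_integral_combine_le:
  assumes f: "f \<in> borel_measurable (lebesgue_on \<Omega>)" and g: "g \<in> borel_measurable (lebesgue_on \<Omega>)"
    and nonneg: "AE x in lebesgue_on \<Omega>. 0 \<le> f x \<and> 0 \<le> g x \<and> 0 \<le> r x \<and> 0 \<le> s x"
    and le: "AE x in lebesgue_on \<Omega>. f x + f x + r x \<le> g x + g x + s x"
  shows "nonneg_integral \<Omega> f + nonneg_integral \<Omega> f + nonneg_integral \<Omega> r
    \<le> nonneg_integral \<Omega> g + nonneg_integral \<Omega> g + nonneg_integral \<Omega> s"
proof -
  let ?M = "lebesgue_on \<Omega>"
  define F where "F x = e2ennreal (f x)" for x
  define G where "G x = e2ennreal (g x)" for x
  define R where "R x = e2ennreal (r x)" for x
  define S where "S x = e2ennreal (s x)" for x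
  have [measurable]: "F \<in> borel_measurable ?M" "G \<in> borel_measurable ?M"
    unfolding F_def G_def using f g by measurable
  have "integral\<^sup>N ?M F + integral\<^sup>N ?M F + integral\<^sup>N ?M R = (\<integral>\<^sup>+x. F x + F x \<partial>?M) + integral\<^sup>N ?M R"
    by (simp add: nn_integral_add)
  also have "\<dots> \<le> (\<integral>\<^sup>+x. (F x + F x) + R x \<partial>?M)" by (rule add_le_nn_integral) measurable
  also have "\<dots> \<le> (\<integral>\<^sup>+x. (G x + G x) + S x \<partial>?M)"
  proof (rule nn_integral_mono_AE)
    show "AE x in ?M. F x + F x + R x \<le> G x + G x + S x"
      using nonneg le
    proof eventually_elim
      case (elim x)
      then have "e2ennreal (f x + f x + r x) \<le> e2ennreal (g x + g x + s x)" by (intro e2ennreal_mono) auto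
      then show ?case using elim by (simp add: F_def G_def R_def S_def e2ennreal_add)
    qed
  qed
  also have "\<dots> \<le> (\<integral>\<^sup>+x. G x + G x \<partial>?M) + integral\<^sup>N ?M S" by (rule nn_integral_add_le) measurable
  also have "\<dots> = integral\<^sup>N ?M G + integral\<^sup>N ?M G + integral\<^sup>N ?M S" by (simp add: nn_integral_add)
  finally have "integral\<^sup>N ?M F + integral\<^sup>N ?M F + integral\<^sup>N ?M R \<le> integral\<^sup>N ?M G + integral\<^sup>N ?M G + integral\<^sup>N ?M S" .
  then show ?thesis
    unfolding nonneg_integral_def plus_ennreal.rep_eq[symmetric] less_eq_ennreal.rep_eq[symmetric]
      F_def G_def R_def S_def by simp
qed

lemma nonneg_integral_cong_AE:
  assumes "AE x in lebesgue_on \<Omega>. f x = g x"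
  shows "nonneg_integral \<Omega> f = nonneg_integral \<Omega> g"
  unfolding nonneg_integral_def
  by (rule arg_cong[of _ _ enn2ereal], rule nn_integral_cong_AE) (use assms in \<open>auto elim!: eventually_mono\<close>)

text \<open>
  The integrated form of \<open>lifted_data_midpoint\<close>. The integrals of \<open>\<rho>\<close> are the measurable
  summands.
\<close>

lemma data_terms_midpoint:
  fixes u v :: "real^'d \<Rightarrow> real" and U :: "real^'d \<Rightarrow> real^'l::{finite,linorder}"
  assumes \<Omega>: "\<Omega> \<in> sets lebesgue"
    and \<gamma>: "strict_mono_on {1..CARD('l) + 1} \<gamma>" and \<Gamma>: "\<Gamma> = {\<gamma> 1..\<gamma> (CARD('l) + 1)}"
    and rho_measurable: "(\<lambda>(x, t). \<rho> x t) \<in> borel_measurable (lebesgue_on \<Omega> \<Otimes>\<^sub>M restrict_space borel \<Gamma>)"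
    and rho_nonneg: "\<forall>x\<in>\<Omega>. \<forall>t\<in>\<Gamma>. 0 \<le> \<rho> x t"
    and rho_convex: "\<forall>x\<in>\<Omega>. convex_ereal_on \<Gamma> (\<rho> x)"
    and u: "u \<in> borel_measurable (lebesgue_on \<Omega>)" "AE x in lebesgue_on \<Omega>. u x \<in> \<Gamma>"
    and v: "v \<in> borel_measurable (lebesgue_on \<Omega>)" "AE x in lebesgue_on \<Omega>. v x \<in> \<Gamma>"
    and U: "AE x in lebesgue_on \<Omega>. U x = lift \<gamma> (v x)"
  defines "w \<equiv> \<lambda>x. (u x + v x) / 2"
  shows "data_term \<Omega> \<rho> w + data_term \<Omega> \<rho> w + lifted_data_term \<Omega> \<gamma> \<rho> (\<lambda>x. lift \<gamma> (u x) :: real^'l::{finite,linorder})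
    \<le> data_term \<Omega> \<rho> u + data_term \<Omega> \<rho> u + lifted_data_term \<Omega> \<gamma> \<rho> U"
    (is ?combined)
    and "lifted_data_term \<Omega> \<gamma> \<rho> (\<lambda>x. lift \<gamma> (u x) :: real^'l::{finite,linorder}) \<le> data_term \<Omega> \<rho> u" (is ?below)
proof -
  let ?M = "lebesgue_on \<Omega>"
  let ?R = "\<lambda>x t. biconj (lifted_rho \<gamma> \<rho> x) (lift \<gamma> t :: real^'l::{finite,linorder})"
  have ne: "\<gamma> 1 \<le> \<gamma> (CARD('l) + 1)" by (rule strict_mono_on_leD[OF \<gamma>]) auto
  have space: "AE x in ?M. x \<in> \<Omega>" using \<Omega> by (auto simp: AE_restrict_space_iff)
  \<comment> \<open>Clamping makes the arguments of \<open>\<rho>\<close> lie in \<open>\<Gamma>\<close> everywhere and not only almost everywhere, as joint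
    measurability of \<open>\<rho>\<close> on \<open>\<Omega> \<times> \<Gamma>\<close> requires.\<close>
  define cl where "cl t = max (\<gamma> 1) (min (\<gamma> (CARD('l) + 1)) t)" for t
  have cl: "cl t \<in> \<Gamma>" "t \<in> \<Gamma> \<Longrightarrow> cl t = t" for t using ne by (auto simp: cl_def \<Gamma>)
  have meas: "(\<lambda>x. \<rho> x (cl (h x))) \<in> borel_measurable ?M" if [measurable]: "h \<in> borel_measurable ?M" for h
  proof -
    have "(\<lambda>x. cl (h x)) \<in> measurable ?M (restrict_space borel \<Gamma>)"
      by (rule measurable_restrict_space2) (auto simp: cl(1), simp add: cl_def)
    then have "(\<lambda>x. (x, cl (h x))) \<in> measurable ?M (?M \<Otimes>\<^sub>M restrict_space borel \<Gamma>)"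
      by (intro measurable_Pair) auto
    from measurable_compose[OF this rho_measurable] show ?thesis by simp
  qed
  have w: "w \<in> borel_measurable ?M" "AE x in ?M. w x \<in> \<Gamma>"
  proof -
    show "w \<in> borel_measurable ?M" unfolding w_def using u(1) v(1) by measurable
    show "AE x in ?M. w x \<in> \<Gamma>" using u(2) v(2) by eventually_elim (auto simp: w_def \<Gamma>)
  qed
  have clamp: "data_term \<Omega> \<rho> h = nonneg_integral \<Omega> (\<lambda>x. \<rho> x (cl (h x)))" if "AE x in ?M. h x \<in> \<Gamma>" for h
    unfolding data_term_def by (rule nonneg_integral_cong_AE) (use that in \<open>auto elim!: eventually_mono simp: cl\<close>)
  have mid: "\<rho> x ((a + b) / 2) + \<rho> x ((a + b) / 2) + ?R x a \<le> \<rho> x a + \<rho> x a + ?R x b" "0 \<le> ?R x a"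
    if "x \<in> \<Omega>" "a \<in> \<Gamma>" "b \<in> \<Gamma>" for x a b
    using lifted_data_midpoint[OF \<gamma> \<Gamma>, of \<rho> x a b] rho_convex rho_nonneg that by auto
  have "nonneg_integral \<Omega> (\<lambda>x. \<rho> x (cl (w x))) + nonneg_integral \<Omega> (\<lambda>x. \<rho> x (cl (w x))) + nonneg_integral \<Omega> (\<lambda>x. ?R x (u x))
    \<le> nonneg_integral \<Omega> (\<lambda>x. \<rho> x (cl (u x))) + nonneg_integral \<Omega> (\<lambda>x. \<rho> x (cl (u x))) + nonneg_integral \<Omega> (\<lambda>x. ?R x (v x))"
  proof (rule nonneg_integral_combine_le[OF meas[OF w(1)] meas[OF u(1)]])
    show "AE x in ?M. 0 \<le> \<rho> x (cl (w x)) \<and> 0 \<le> \<rho> x (cl (u x)) \<and> 0 \<le> ?R x (u x) \<and> 0 \<le> ?R x (v x)"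
      using u(2) v(2) space
    proof eventually_elim
      case (elim x)
      then show ?case using rho_nonneg cl(1) mid(2)[of x "u x" "v x"] mid(2)[of x "v x" "u x"] by simp
    qed
    show "AE x in ?M. \<rho> x (cl (w x)) + \<rho> x (cl (w x)) + ?R x (u x) \<le> \<rho> x (cl (u x)) + \<rho> x (cl (u x)) + ?R x (v x)"
      using u(2) v(2) w(2) space by eventually_elim (simp add: cl mid(1) w_def)
  qed
  moreover have "nonneg_integral \<Omega> (\<lambda>x. ?R x (v x)) = lifted_data_term \<Omega> \<gamma> \<rho> U"
    unfolding lifted_data_term_def by (rule nonneg_integral_cong_AE) (use U in \<open>auto elim!: eventually_mono\<close>)
  ultimately show ?combined
    unfolding clamp[OF u(2)] clamp[OF w(2)] lifted_data_term_def by simp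
  show ?below
    unfolding lifted_data_term_def data_term_def
  proof (rule nonneg_integral_mono_AE)
    show "AE x in ?M. ?R x (u x) \<le> \<rho> x (u x)"
      using u(2)
    proof eventually_elim
      case (elim x)
      have "?R x (u x) \<le> lifted_rho \<gamma> \<rho> x (lift \<gamma> (u x) :: real^'l::{finite,linorder})" by (rule biconj_le)
      also have "\<dots> \<le> \<rho> x (u x)" by (rule lifted_rho_lift_le[OF \<gamma>]) (use elim in \<open>simp add: \<Gamma>\<close>)
      finally show ?case .
    qed
  qed
qed

section \<open>Comparison of the two iterations\<close>

lemma L2_valuedI_bounded:
  fixes f :: "'x::euclidean_space \<Rightarrow> 'v::euclidean_space"
  assumes \<Omega>: "\<Omega> \<in> lmeasurable" and f: "f \<in> borel_measurable (lebesgue_on \<Omega>)"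
    "AE x in lebesgue_on \<Omega>. f x \<in> C" "AE x in lebesgue_on \<Omega>. norm (f x) \<le> B"
  shows "f \<in> L2_valued \<Omega> C"
proof -
  interpret finite_measure "lebesgue_on \<Omega>" by (rule finite_measure_lebesgue_on[OF \<Omega>])
  note f(1)[measurable]
  have "integrable (lebesgue_on \<Omega>) (\<lambda>x. (norm (f x))\<^sup>2)"
  proof (rule integrable_const_bound[where B="B\<^sup>2"])
    show "AE x in lebesgue_on \<Omega>. norm ((norm (f x))\<^sup>2) \<le> B\<^sup>2"
      using f(3) by eventually_elim (auto intro: power_mono)
  qed measurable
  then show ?thesis using f by (simp add: L2_valued_def L2_on_def)
qed

lemma L2_on_integrable:
  assumes \<Omega>: "\<Omega> \<in> lmeasurable" and f: "(f :: 'x::euclidean_space \<Rightarrow> real) \<in> L2_on \<Omega>"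
  shows "integrable (lebesgue_on \<Omega>) f"
proof -
  interpret finite_measure "lebesgue_on \<Omega>" by (rule finite_measure_lebesgue_on[OF \<Omega>])
  have f2: "f \<in> borel_measurable (lebesgue_on \<Omega>)" "integrable (lebesgue_on \<Omega>) (\<lambda>x. (norm (f x))\<^sup>2)"
    using f by (auto simp: L2_on_def)
  show ?thesis
  proof (rule Bochner_Integration.integrable_bound[where f="\<lambda>x. 1 + (norm (f x))\<^sup>2"])
    show "integrable (lebesgue_on \<Omega>) (\<lambda>x. 1 + (norm (f x))\<^sup>2)"
      by (intro Bochner_Integration.integrable_add f2) simp
    have "\<bar>t\<bar> \<le> 1 + t\<^sup>2" for t :: real
      using zero_le_power2[of "\<bar>t\<bar> - 1"] by (simp add: power2_diff) 
    then show "AE x in lebesgue_on \<Omega>. norm (f x) \<le> norm (1 + (norm (f x))\<^sup>2)" by (intro AE_I2) simp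
  qed (rule f2)
qed

lemma integrable_times_bounded:
  fixes P f :: "'x::euclidean_space \<Rightarrow> real"
  assumes P: "integrable (lebesgue_on \<Omega>) P" and f: "f \<in> borel_measurable (lebesgue_on \<Omega>)"
    "AE x in lebesgue_on \<Omega>. \<bar>f x\<bar> \<le> B"
  shows "integrable (lebesgue_on \<Omega>) (\<lambda>x. P x * f x)"
proof (rule Bochner_Integration.integrable_bound[where f="\<lambda>x. B * P x"])
  show "AE x in lebesgue_on \<Omega>. norm (P x * f x) \<le> norm (B * P x)"
    using f(2)
  proof eventually_elim
    case (elim x)
    then have "\<bar>f x\<bar> * \<bar>P x\<bar> \<le> \<bar>B\<bar> * \<bar>P x\<bar>" by (intro mult_right_mono) auto
    then show ?case by (simp add: abs_mult mult.commute)
  qed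
qed (use P f in auto)

lemma AE_lebesgue_on_contradiction:
  assumes "open \<Omega>" "\<Omega> \<noteq> {}" "AE x in lebesgue_on \<Omega>. False" shows False
proof -
  have "AE x in lebesgue. x \<notin> \<Omega>" using assms by (simp add: AE_restrict_space_iff)
  then have "\<Omega> \<in> null_sets lebesgue" using assms(1) by (subst AE_iff_null_sets) auto
  then show False using open_not_negligible[OF assms(1,2)] by (simp add: negligible_iff_null_sets)
qed

theorem proposition2:
  fixes \<Omega> :: "(real^'d) set"
    and N :: tv_kind
    and \<gamma> :: "nat \<Rightarrow> real"
    and \<Gamma> :: "real set"
    and \<rho> :: "real^'d \<Rightarrow> real \<Rightarrow> ereal"
    and u p :: "nat \<Rightarrow> real^'d \<Rightarrow> real"
    and \<u> \<p> :: "nat \<Rightarrow> real^'d \<Rightarrow> real^'l::{finite,linorder}"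
  assumes domain: "open \<Omega>" "bounded \<Omega>"
    and labels: "strict_mono_on {1..CARD('l) + 1} \<gamma>" "\<Gamma> = {\<gamma> 1..\<gamma> (CARD('l) + 1)}"
    and rho_measurable:
      "(\<lambda>(x, t). \<rho> x t) \<in> borel_measurable (lebesgue_on \<Omega> \<Otimes>\<^sub>M restrict_space borel \<Gamma>)"
    and rho_nonneg: "\<forall>x\<in>\<Omega>. \<forall>t\<in>\<Gamma>. 0 \<le> \<rho> x t"
    and rho_proper: "\<exists>x\<in>\<Omega>. \<exists>t\<in>\<Gamma>. \<rho> x t < \<infinity>"
    and rho_convex: "\<forall>x\<in>\<Omega>. convex_ereal_on \<Gamma> (\<rho> x)"
    and classical:
      "bregman_iteration \<Omega> (L2_valued \<Omega> \<Gamma>) (data_term \<Omega> \<rho>) (total_variation N \<Omega>) u p"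
    and classical_unique:
      "\<forall>k\<ge>1. \<forall>v. is_arg_min (bregman_energy \<Omega> (data_term \<Omega> \<rho>) (total_variation N \<Omega>) (p (k - 1)))
                      (\<lambda>v. v \<in> L2_valued \<Omega> \<Gamma>) v \<longrightarrow>
                (AE x in lebesgue_on \<Omega>. v x = u k x)"
    and lifted:
      "bregman_iteration \<Omega> (L2_valued \<Omega> (convex hull lifted_labels))
         (lifted_data_term \<Omega> \<gamma> \<rho>) (lifted_total_variation N \<Omega> \<gamma>) \<u> \<p>"
    and sublabel_integral:
      "\<forall>k\<ge>1. AE x in lebesgue_on \<Omega>. \<u> k x \<in> lifted_labels"
    and subgradients:
      "\<forall>k\<ge>1. AE x in lebesgue_on \<Omega>. \<p> (k - 1) x = p (k - 1) x *\<^sub>R label_gaps \<gamma>"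
  shows "\<forall>k\<ge>1. AE x in lebesgue_on \<Omega>. u k x = unlift \<gamma> (\<u> k x)"
proof (intro allI impI)
  fix k :: nat assume k: "k \<ge> 1"
  let ?M = "lebesgue_on \<Omega>"
  define P where "P = p (k - 1)"
  define PP where "PP = \<p> (k - 1)"
  define v where "v x = unlift \<gamma> (\<u> k x)" for x
  define lu where "lu x = (lift \<gamma> (u k x) :: real^'l::{finite,linorder})" for x
  define w where "w = (\<lambda>x. (u k x + v x) / 2)"
  let ?E = "bregman_energy \<Omega> (data_term \<Omega> \<rho>) (total_variation N \<Omega>) P"
  let ?EE = "bregman_energy \<Omega> (lifted_data_term \<Omega> \<gamma> \<rho>) (lifted_total_variation N \<Omega> \<gamma>) PP"
  note \<gamma> = labels(1) and \<Gamma> = labels(2)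
  have lm: "\<Omega> \<in> lmeasurable" using domain by (intro lmeasurable_open)
  then have sl: "\<Omega> \<in> sets lebesgue" by (rule fmeasurableD)
  interpret finite_measure ?M by (rule finite_measure_lebesgue_on[OF lm])
  have lt: "\<gamma> 1 < \<gamma> (CARD('l) + 1)" by (rule strict_mono_onD[OF \<gamma>]) auto
  define B where "B = max \<bar>\<gamma> 1\<bar> \<bar>\<gamma> (CARD('l) + 1)\<bar>"
  have \<Gamma>B: "\<bar>t\<bar> \<le> B" if "t \<in> \<Gamma>" for t using that by (auto simp: \<Gamma> B_def)

  have argmin: "is_arg_min ?E (\<lambda>v. v \<in> L2_valued \<Omega> \<Gamma>) (u k)"
    and unique: "\<And>v. is_arg_min ?E (\<lambda>v. v \<in> L2_valued \<Omega> \<Gamma>) v \<Longrightarrow> AE x in ?M. v x = u k x"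
    using classical classical_unique k by (auto simp: bregman_iteration_def P_def)
  have largmin: "is_arg_min ?EE (\<lambda>v. v \<in> L2_valued \<Omega> (convex hull lifted_labels)) (\<u> k)"
    using lifted k by (auto simp: bregman_iteration_def PP_def)
  have PL2: "P \<in> L2_on \<Omega>"
    using classical k unfolding bregman_iteration_def P_def subdiff_def
    by (cases "k = 1") (auto simp: L2_on_def)
  have PPL2: "PP \<in> L2_on \<Omega>"
    using lifted k unfolding bregman_iteration_def PP_def subdiff_def
    by (cases "k = 1") (auto simp: L2_on_def)
  have iP: "integrable ?M P" by (rule L2_on_integrable[OF lm PL2])
  have PP: "AE x in ?M. PP x = P x *\<^sub>R label_gaps \<gamma>" using subgradients k by (simp add: P_def PP_def)

  have u: "u k \<in> borel_measurable ?M" "AE x in ?M. u k x \<in> \<Gamma>"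
    using argmin by (auto simp: is_arg_min_def L2_valued_def L2_on_def)
  have U: "\<u> k \<in> borel_measurable ?M" "AE x in ?M. \<u> k x \<in> lifted_labels"
    using largmin sublabel_integral k by (auto simp: is_arg_min_def L2_valued_def L2_on_def)
  have v: "v \<in> borel_measurable ?M" "AE x in ?M. v x \<in> \<Gamma>"
  proof -
    show "v \<in> borel_measurable ?M" unfolding v_def using U(1) by measurable
    show "AE x in ?M. v x \<in> \<Gamma>"
      using U(2) by eventually_elim (simp only: v_def \<Gamma> lifted_labels_cases(1)[OF \<gamma>])
  qed
  have Uv: "AE x in ?M. \<u> k x = lift \<gamma> (v x)"
    using U(2) by eventually_elim (simp only: v_def lifted_labels_cases(2)[OF \<gamma>])
  have lu: "lu \<in> borel_measurable ?M" "lu \<in> L2_valued \<Omega> (convex hull lifted_labels)"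
  proof -
    show m: "lu \<in> borel_measurable ?M" unfolding lu_def using u(1) by measurable
    show "lu \<in> L2_valued \<Omega> (convex hull lifted_labels)"
    proof (rule L2_valuedI_bounded[OF lm m])
      show "AE x in ?M. lu x \<in> convex hull lifted_labels"
        using u(2) by eventually_elim (simp add: lu_def \<Gamma> hull_inc lift_mem_lifted_labels[OF \<gamma>])
      have "norm (lu x) \<le> (\<Sum>j\<in>(UNIV :: 'l set). 1)" for x
        by (rule order_trans[OF norm_le_l1_cart], rule sum_mono)
          (use lift_component_bounds[OF \<gamma>] in \<open>simp add: lu_def\<close>)
      then show "AE x in ?M. norm (lu x) \<le> (\<Sum>j\<in>(UNIV :: 'l set). 1)" by simp
    qed
  qed
  have \<Gamma>L2: "f \<in> L2_valued \<Omega> \<Gamma>" and \<Gamma>int: "integrable ?M f" and Pint: "integrable ?M (\<lambda>x. P x * f x)"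
    if "f \<in> borel_measurable ?M" "AE x in ?M. f x \<in> \<Gamma>" for f
  proof -
    have b: "AE x in ?M. \<bar>f x\<bar> \<le> B" using that(2) by eventually_elim (rule \<Gamma>B)
    show "f \<in> L2_valued \<Omega> \<Gamma>" by (rule L2_valuedI_bounded[OF lm that]) (use b in simp)
    show "integrable ?M f" by (rule integrable_const_bound[of _ B]) (use b that in auto)
    show "integrable ?M (\<lambda>x. P x * f x)" by (rule integrable_times_bounded[OF iP that(1) b])
  qed
  have w: "w \<in> borel_measurable ?M" "AE x in ?M. w x \<in> \<Gamma>"
  proof -
    show "w \<in> borel_measurable ?M" unfolding w_def using u(1) v(1) by measurable
    show "AE x in ?M. w x \<in> \<Gamma>" using u(2) v(2) by eventually_elim (auto simp: w_def \<Gamma>)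
  qed

  \<comment> \<open>If the minimal energy were infinite, every admissible function would be a minimiser, among them the
    constants \<open>\<gamma> 1\<close> and \<open>\<gamma> (CARD('l) + 1)\<close>, against uniqueness on the non-empty open set \<open>\<Omega>\<close>.\<close>
  have E_fin: "?E (u k) \<noteq> \<infinity>"
  proof
    assume top: "?E (u k) = \<infinity>"
    have "AE x in ?M. c = u k x" if "c \<in> \<Gamma>" for c
    proof -
      have c: "(\<lambda>_. c) \<in> L2_valued \<Omega> \<Gamma>" using \<Gamma>L2[of "\<lambda>_. c"] that by simp
      then have "?E (\<lambda>_. c) = \<infinity>" using argmin top by (auto simp: is_arg_min_def)
      then have "is_arg_min ?E (\<lambda>v. v \<in> L2_valued \<Omega> \<Gamma>) (\<lambda>_. c)"
        using argmin c top by (auto simp: is_arg_min_def)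
      then show ?thesis by (rule unique)
    qed
    then have "AE x in ?M. \<gamma> 1 = u k x" "AE x in ?M. \<gamma> (CARD('l) + 1) = u k x" using lt \<Gamma> by auto
    then have "AE x in ?M. False" by eventually_elim (use lt in simp)
    then show False using AE_lebesgue_on_contradiction[OF domain(1)] rho_proper by blast
  qed
  have H_nonneg: "0 \<le> data_term \<Omega> \<rho> f" for f by (simp add: data_term_def nonneg_integral_nonneg)
  have HH_nonneg: "0 \<le> lifted_data_term \<Omega> \<gamma> \<rho> f" for f :: "real^'d \<Rightarrow> real^'l::{finite,linorder}"
    by (simp add: lifted_data_term_def nonneg_integral_nonneg)
  obtain hu where hu: "data_term \<Omega> \<rho> (u k) = ereal hu"
    using E_fin H_nonneg[of "u k"] total_variation_nonneg[of N \<Omega> "u k"] unfolding bregman_energy_def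
    by (cases "data_term \<Omega> \<rho> (u k)"; cases "total_variation N \<Omega> (u k)") auto
  obtain tu where tu: "total_variation N \<Omega> (u k) = ereal tu"
    using E_fin H_nonneg[of "u k"] total_variation_nonneg[of N \<Omega> "u k"] unfolding bregman_energy_def
    by (cases "data_term \<Omega> \<rho> (u k)"; cases "total_variation N \<Omega> (u k)") auto

  note H = data_terms_midpoint[OF sl \<gamma> \<Gamma> rho_measurable rho_nonneg rho_convex u v Uv]
  have Hw: "data_term \<Omega> \<rho> w + data_term \<Omega> \<rho> w + lifted_data_term \<Omega> \<gamma> \<rho> lu
    \<le> data_term \<Omega> \<rho> (u k) + data_term \<Omega> \<rho> (u k) + lifted_data_term \<Omega> \<gamma> \<rho> (\<u> k)"
    unfolding w_def lu_def by (rule H(1))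
  have Hlu: "lifted_data_term \<Omega> \<gamma> \<rho> lu \<le> data_term \<Omega> \<rho> (u k)" unfolding lu_def by (rule H(2))
  obtain hl where hl: "lifted_data_term \<Omega> \<gamma> \<rho> lu = ereal hl"
    using Hlu HH_nonneg[of lu] hu by (cases "lifted_data_term \<Omega> \<gamma> \<rho> lu") auto

  have TVlu: "lifted_total_variation N \<Omega> \<gamma> lu \<le> ereal tu"
    unfolding lu_def tu[symmetric]
    by (rule lifted_total_variation_lift_le[OF domain u(1) u(2)[unfolded \<Gamma>] less_imp_le[OF lt] \<gamma>])
  have TVv: "total_variation N \<Omega> v \<le> lifted_total_variation N \<Omega> \<gamma> (\<u> k)"
    unfolding v_def
    by (rule total_variation_unlift_le[OF domain _ \<gamma>]) (use \<Gamma>int[OF v] in \<open>simp add: v_def\<close>)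

  \<comment> \<open>The constant by which the lifted linear term differs from the classical one.\<close>
  define c where "c = (LINT x|?M. P x * \<gamma> 1)"
  have pair: "pairing \<Omega> PP (V :: real^'d \<Rightarrow> real^'l::{finite,linorder}) = pairing \<Omega> P f - c"
    if V: "V \<in> borel_measurable ?M" "AE x in ?M. unlift \<gamma> (V x) = f x"
      and f: "f \<in> borel_measurable ?M" "AE x in ?M. f x \<in> \<Gamma>" for V f
  proof -
    have [measurable]: "PP \<in> borel_measurable ?M" "P \<in> borel_measurable ?M"
      using PPL2 PL2 by (auto simp: L2_on_def)
    note V(1)[measurable] f(1)[measurable]
    have "(LINT x|?M. PP x \<bullet> V x) = (LINT x|?M. P x * f x - P x * \<gamma> 1)"
    proof (rule integral_cong_AE)
      show "AE x in ?M. PP x \<bullet> V x = P x * f x - P x * \<gamma> 1"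
        using PP V(2)
      proof eventually_elim
        case (elim x)
        then have "f x = \<gamma> 1 + label_gaps \<gamma> \<bullet> V x" by (simp add: unlift_eq_inner)
        then show ?case using elim(1) by (simp add: algebra_simps)
      qed
    qed measurable
    then show ?thesis
      using Pint[OF f] iP by (simp add: pairing_def c_def)
  qed
  have Pu: "pairing \<Omega> PP lu = pairing \<Omega> P (u k) - c"
  proof (rule pair[OF lu(1) _ u])
    show "AE x in ?M. unlift \<gamma> (lu x) = u k x"
      using u(2) by eventually_elim (simp add: lu_def \<Gamma> unlift_lift[OF \<gamma>])
  qed
  have Pv: "pairing \<Omega> PP (\<u> k) = pairing \<Omega> P v - c"
    by (rule pair[OF U(1) _ v]) (simp add: v_def)
  have Pw: "pairing \<Omega> P w = (pairing \<Omega> P (u k) + pairing \<Omega> P v) / 2"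
    unfolding pairing_def w_def
    using Pint[OF u] Pint[OF v] by (simp add: distrib_left add_divide_distrib)

  have "?EE (\<u> k) \<le> ?EE lu" using largmin lu(2) by (auto simp: is_arg_min_def not_less)
  also have "\<dots> \<le> ereal (hl + tu - (pairing \<Omega> P (u k) - c))"
  proof -
    have "?EE lu \<le> ereal hl + ereal tu - ereal (pairing \<Omega> P (u k) - c)"
      unfolding bregman_energy_def hl Pu by (intro ereal_minus_mono add_left_mono TVlu order_refl)
    then show ?thesis by simp
  qed
  finally have EE: "lifted_data_term \<Omega> \<gamma> \<rho> (\<u> k) + lifted_total_variation N \<Omega> \<gamma> (\<u> k)
      - ereal (pairing \<Omega> P v - c) \<le> ereal (hl + tu - (pairing \<Omega> P (u k) - c))"
    by (simp add: bregman_energy_def Pv)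
  have TVU0: "0 \<le> lifted_total_variation N \<Omega> \<gamma> (\<u> k)"
    using total_variation_nonneg TVv by (rule order_trans)
  obtain hU jU where hU: "lifted_data_term \<Omega> \<gamma> \<rho> (\<u> k) = ereal hU"
    and jU: "lifted_total_variation N \<Omega> \<gamma> (\<u> k) = ereal jU"
    using EE TVU0 HH_nonneg[of "\<u> k"]
    by (cases "lifted_data_term \<Omega> \<gamma> \<rho> (\<u> k)"; cases "lifted_total_variation N \<Omega> \<gamma> (\<u> k)") auto
  \<comment> \<open>Optimality of \<open>\<u> k\<close> against the lift of \<open>u k\<close>, in real numbers.\<close>
  have key: "hU + jU - pairing \<Omega> P v \<le> hl + tu - pairing \<Omega> P (u k)"
    using EE by (simp add: hU jU)
  obtain hw where hw: "data_term \<Omega> \<rho> w = ereal hw"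
    using Hw H_nonneg[of w] by (cases "data_term \<Omega> \<rho> w") (auto simp: hu hl hU)
  have Hw': "hw + hw + hl \<le> hu + hu + hU" using Hw by (simp add: hw hl hu hU)
  have TVw: "total_variation N \<Omega> w \<le> ereal ((tu + jU) / 2)"
    unfolding w_def
    by (rule total_variation_midpoint[OF \<Gamma>int[OF u] \<Gamma>int[OF v]]) (use tu TVv jU in auto)

  have "?E w \<le> ereal hw + ereal ((tu + jU) / 2) - ereal (pairing \<Omega> P w)"
    unfolding bregman_energy_def hw by (intro ereal_minus_mono add_left_mono TVw order_refl)
  also have "\<dots> \<le> ereal (hu + tu - pairing \<Omega> P (u k))"
    using Hw' key unfolding Pw by (simp add: field_simps)
  also have "\<dots> = ?E (u k)" by (simp add: bregman_energy_def hu tu)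
  finally have Ew: "?E w \<le> ?E (u k)" .
  have "is_arg_min ?E (\<lambda>v. v \<in> L2_valued \<Omega> \<Gamma>) w"
    using argmin Ew \<Gamma>L2[OF w] unfolding is_arg_min_def by (meson less_le_trans)
  then have "AE x in ?M. w x = u k x" by (rule unique)
  then show "AE x in ?M. u k x = unlift \<gamma> (\<u> k x)"
    by eventually_elim (simp add: w_def v_def)
qed

end
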